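(* Let $p\ge 2$ be an integer, $\mathbb{P}=\{1,\ldots,p-1\}$, let $G$ be the Vilenkin group with dual group $G^*$, and let $\Omega=\{\Omega^{(u)}\}_{u\in\mathbb{P}}$ be a set of measurable subsets of $G^*$. Then $\Omega$ is a wavelet set if and only if both of the following conditions hold: (i) $\{\sigma^k(\Omega^{(u)})\}_{k\in\mathbb{Z},u\in\mathbb{P}}$ tiles $G^*$ up to sets of measure zero, that is, for any $u_1,u_2\in\mathbb{P}$ and $j,k\in\mathbb{Z}$ with $u_1\neq u_2$ or $j\neq k$, $$\mu^*\left(\sigma^j\left(\Omega^{(u_1)}\right)\cap\sigma^k\left(\Omega^{(u_2)}\right)\right)=0$$ and $$\mu^*\left(G^*\setminus\bigcup_{k\in\mathbb{Z},u\in\mathbb{P}}\sigma^k\left(\Omega^{(u)}\right)\right)=0.$$ (ii) For any $u\in\mathbb{P}$, $\Omega^{(u)}$ is $\Lambda$-translation congruent to $U^*$ up to sets of measure zero, that is, there exists a partition $\{\Omega_n^{(u)}: n\in N^{(u)}\}$ of $\Omega^{(u)}$ with index set $N^{(u)}\subset\mathbb{Z}_+$ (elements of $\mathbb{Z}_+$ being identified with elements of $\Lambda\subset G^*$) such that, for any $n_1,n_2\in N^{(u)}$ with $n_1\neq n_2$, $$\mu^*\left(\left(\Omega_{n_1}^{(u)}\ominus n_1\right)\cap\left(\Omega_{n_2}^{(u)}\ominus n_2\right)\right)=0,$$ and $$\bigcup_{n\in N^{(u)}}\left(\Omega_n^{(u)}\ominus n\right)\subset U^*\quad\text{and}\quad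 \mu^*\left(U^*\setminus\bigcup_{n\in N^{(u)}}\left(\Omega_n^{(u)}\ominus n\right)\right)=0.$$
   Context: Let $\mathbb{Z}_+=\{0,1,2,\ldots\}$ and let $p\ge2$ be a fixed integer. The Vilenkin group $G$ is the set of all sequences $x=(x_j)_{j\in\mathbb{Z}}$ with $x_j\in\{0,1,\ldots,p-1\}$ and $x_j=0$ for all $j<k_x$ for some integer $k_x$ depending on $x$. The group operation $\oplus$ is coordinatewise addition modulo $p$, and $\ominus$ is its inverse operation (subtraction). The maps $\rho,\sigma:G\to G$ are $(\rho(x))_j=x_{j+1}$ and $(\sigma(x))_j=x_{j-1}$; they are mutually inverse automorphisms. Let $U=\{x\in G: x_j=0\text{ for all }j\le 0\}$; the sets $x\oplus\rho^m(U)$, $x\in G$, $m\in\mathbb{Z}$, form a base of the topology of $G$, making $G$ a locally compact abelian group. The dual group $G^*$ consists of the same kind of sequences $\omega=(\omega_j)_{j\in\mathbb{Z}}$ with the same operation, topology and maps $\rho,\sigma$, and $U^*\subset G^*$ is defined in the same way as $U$. The pairing is $$\chi(x,\omega)=\exp\left(\frac{2\pi i}{p}\sum_{j\in\mathbb{Z}}x_j\omega_{1-j}\right),\qquad x\in G,\ \omega\in G^*.$$ $\mu$ and $\mu^*$ are the Haar measures on $G$ and $G^*$ normalized by $\mu(U)=1$ and $\mu^*(U^* )=1$. The Fourier transform of $f\in L^1(G)\cap L^2(G)$ is $\widehat f(\omega)=\int_G f(x)\overline{\chi(x,\omega)}\,d\mu(x)$, and the inverse Fourier transform of $f\in L^1(G^*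 )\cap L^2(G^* )$ is $f^\vee(x)=\int_{G^*}f(\omega)\chi(x,\omega)\,d\mu^*(\omega)$; both are extended to $L^2$ in the usual way. Let $\Lambda=\{x\in G: x_j=0\text{ for all }j>0\}$, a countable closed subgroup of $G$; the subgroup of $G^*$ defined in the same way is also denoted $\Lambda$. The bijection $\lambda:\Lambda\to\mathbb{Z}_+$, $\lambda(x)=\sum_{j\in\mathbb{Z}}x_jp^{-j}$, is used to identify elements of $\Lambda$ with elements of $\mathbb{Z}_+$. For $E\subset G^*$ and $n\in\Lambda\subset G^*$, $E\ominus n=\{\omega\ominus n:\omega\in E\}$. For $f\in L^2(G)$, $j\in\mathbb{Z}$, $n\in\Lambda$, set $f_{j,n}(x)=p^{j/2}f(\rho^j(x)\ominus n)$. A set $\{\Omega^{(u)}\subset G^*:u\in\mathbb{P}\}$ of measurable subsets of $G^*$ is called a (multi)wavelet set if, with $\psi^{(u)}=(\mathbf{1}_{\Omega^{(u)}})^\vee$ (in particular $\mathbf{1}_{\Omega^{(u)}}\in L^2(G^* )$), the family $\{\psi^{(u)}_{j,n}\}_{j\in\mathbb{Z},n\in\Lambda,u\in\mathbb{P}}$ is an orthonormal basis of $L^2(G)$. Here $\mathbf{1}_E$ denotes the characteristic function of $E$. *)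

theory Defs
  imports "HOL-Analysis.Analysis"
begin

section \<open>The Vilenkin group\<close>

text \<open>
  The dual group of the Vilenkin group consists of the same sequences, with the same operation,
  topology, shifts and distinguished subsets.  The constants below therefore serve for both groups.
\<close>

definition vilenkin :: "nat \<Rightarrow> (int \<Rightarrow> nat) set" where
  "vilenkin p = {x. (\<forall>j. x j < p) \<and> (\<exists>k. \<forall>j<k. x j = 0)}"

definition oplus :: "nat \<Rightarrow> (int \<Rightarrow> nat) \<Rightarrow> (int \<Rightarrow> nat) \<Rightarrow> int \<Rightarrow> nat" where
  "oplus p x y = (\<lambda>j. (x j + y j) mod p)"

text \<open>The natural number subtraction is exact, since digits are smaller than \<open>p\<close>.\<close>

definition ominus :: "nat \<Rightarrow> (int \<Rightarrow> nat) \<Rightarrow> (int \<Rightarrow> nat) \<Rightarrow> int \<Rightarrow> nat" where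
  "ominus p x y = (\<lambda>j. (x j + (p - y j)) mod p)"

text \<open>\<open>rho_pow m\<close> and \<open>sigma_pow m\<close> are the \<open>m\<close>-th iterates of the two shifts, for any integer \<open>m\<close>.\<close>

definition rho_pow :: "int \<Rightarrow> (int \<Rightarrow> nat) \<Rightarrow> int \<Rightarrow> nat" where
  "rho_pow m x = (\<lambda>j. x (j + m))"

definition sigma_pow :: "int \<Rightarrow> (int \<Rightarrow> nat) \<Rightarrow> int \<Rightarrow> nat" where
  "sigma_pow m x = (\<lambda>j. x (j - m))"

lemma rho_pow_0: "rho_pow 0 = id"
  and rho_pow_add: "rho_pow (m + n) = rho_pow m \<circ> rho_pow n"
  and sigma_pow_0: "sigma_pow 0 = id"
  and sigma_pow_add: "sigma_pow (m + n) = sigma_pow m \<circ> sigma_pow n"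
  and rho_sigma: "rho_pow m \<circ> sigma_pow m = id"
  and sigma_rho: "sigma_pow m \<circ> rho_pow m = id"
  by (auto simp: rho_pow_def sigma_pow_def fun_eq_iff algebra_simps)

definition vilenkin_U :: "nat \<Rightarrow> (int \<Rightarrow> nat) set" where
  "vilenkin_U p = {x \<in> vilenkin p. \<forall>j\<le>0. x j = 0}"

definition vilenkin_topology :: "nat \<Rightarrow> (int \<Rightarrow> nat) topology" where
  "vilenkin_topology p =
     topology_generated_by {oplus p x ` rho_pow m ` vilenkin_U p | x m. x \<in> vilenkin p}"

text \<open>
  The Haar measure as a Borel measure, normalised on \<open>U\<close>.  The group is locally compact and second
  countable, so regularity follows from finiteness on compact sets.
\<close>

definition normalized_haar :: "nat \<Rightarrow> (int \<Rightarrow> nat) measure \<Rightarrow> bool" where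
  "normalized_haar p M \<longleftrightarrow>
     space M = vilenkin p \<and>
     sets M = sigma_sets (vilenkin p) {S. openin (vilenkin_topology p) S} \<and>
     (\<forall>x\<in>vilenkin p. \<forall>A\<in>sets M. emeasure M (oplus p x ` A) = emeasure M A) \<and>
     (\<forall>K. compactin (vilenkin_topology p) K \<longrightarrow> emeasure M K < \<infinity>) \<and>
     emeasure M (vilenkin_U p) = 1"

text \<open>Only finitely many summands of the series in the exponent are nonzero.\<close>

definition pairing :: "nat \<Rightarrow> (int \<Rightarrow> nat) \<Rightarrow> (int \<Rightarrow> nat) \<Rightarrow> complex" where
  "pairing p x w =
     exp (2 * of_real pi * \<i> / of_nat p * of_nat (\<Sum>j | x j * w (1 - j) \<noteq> 0. x j * w (1 - j)))"

section \<open>The subgroup \<open>\<Lambda>\<close> and its identification with the natural numbers\<close>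

definition Lam :: "nat \<Rightarrow> (int \<Rightarrow> nat) set" where
  "Lam p = {x \<in> vilenkin p. \<forall>j>0. x j = 0}"

definition lam :: "nat \<Rightarrow> (int \<Rightarrow> nat) \<Rightarrow> nat" where
  "lam p x = (\<Sum>j | x j \<noteq> 0. x j * p ^ nat (- j))"

definition Lam_of_nat :: "nat \<Rightarrow> nat \<Rightarrow> int \<Rightarrow> nat" where
  "Lam_of_nat p = inv_into (Lam p) (lam p)"

lemma Lam_finite_support:
  assumes "x \<in> Lam p"
  shows "finite {j. x j \<noteq> 0}"
proof -
  obtain k where "\<forall>j<k. x j = 0"
    using assms by (auto simp: Lam_def vilenkin_def)
  then have "{j. x j \<noteq> 0} \<subseteq> {k..0}"
    using assms unfolding Lam_def by (force intro: leI)
  then show ?thesis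
    by (rule finite_subset) simp
qed

lemma lam_step:
  assumes x: "x \<in> Lam p"
  defines "y \<equiv> (\<lambda>j. if j \<le> 0 then x (j - 1) else 0)"
  shows "y \<in> Lam p" and "lam p x = x 0 + p * lam p y"
proof -
  obtain k where "\<forall>j<k. x j = 0"
    using x by (auto simp: Lam_def vilenkin_def)
  then have "\<forall>j<k. y j = 0"
    by (auto simp: y_def)
  moreover have "y j < p" for j
    using x by (auto simp: Lam_def vilenkin_def y_def intro: le_less_trans[OF le0, of "x 0"])
  moreover have "\<forall>j>0. y j = 0"
    by (simp add: y_def)
  ultimately show y: "y \<in> Lam p"
    unfolding Lam_def vilenkin_def by blast
  let ?X = "{j. x j \<noteq> 0}" and ?Y = "{j. y j \<noteq> 0}"
  let ?s = "\<lambda>j::int. j - 1"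
  have X: "?X \<subseteq> insert 0 (?s ` ?Y)"
  proof
    fix j assume "j \<in> ?X"
    then have "j \<le> 0" "x j \<noteq> 0"
      using x unfolding Lam_def by (cases "j > 0"; auto)+
    then have "j = 0 \<or> (j + 1) \<in> ?Y"
      by (auto simp: y_def)
    then show "j \<in> insert 0 (?s ` ?Y)"
      by (auto intro!: image_eqI[of _ _ "j + 1"])
  qed
  have nonpos: "j \<le> 0" if "j \<in> ?Y" for j
    using that by (auto simp: y_def split: if_splits)
  have fin: "finite ?Y"
    using Lam_finite_support[OF y] .
  have "lam p x = (\<Sum>j\<in>insert 0 (?s ` ?Y). x j * p ^ nat (- j))"
    unfolding lam_def using X fin by (intro sum.mono_neutral_left) auto
  also have "\<dots> = x 0 + (\<Sum>j\<in>?s ` ?Y. x j * p ^ nat (- j))"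
  proof (subst sum.insert)
    show "0 \<notin> ?s ` ?Y"
      using nonpos[of 1] by auto
  qed (use fin in auto)
  also have "(\<Sum>j\<in>?s ` ?Y. x j * p ^ nat (- j)) = (\<Sum>j\<in>?Y. x (j - 1) * p ^ nat (1 - j))"
    by (subst sum.reindex) (auto simp: inj_on_def)
  also have "\<dots> = (\<Sum>j\<in>?Y. p * (y j * p ^ nat (- j)))"
  proof (rule sum.cong)
    fix j assume "j \<in> ?Y"
    then have "j \<le> 0" by (rule nonpos)
    then have "nat (1 - j) = Suc (nat (- j))" by simp
    then show "x (j - 1) * p ^ nat (1 - j) = p * (y j * p ^ nat (- j))"
      using \<open>j \<le> 0\<close> by (simp add: y_def)
  qed simp
  finally show "lam p x = x 0 + p * lam p y"
    by (simp add: lam_def sum_distrib_left)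
qed

lemma bij_betw_lam:
  assumes p: "p \<ge> 2"
  shows "bij_betw (lam p) (Lam p) UNIV"
proof (rule bij_betwI')
  fix x y assume x: "x \<in> Lam p" and y: "y \<in> Lam p"
  have "x (- int k) = y (- int k)" if "x \<in> Lam p" "y \<in> Lam p" "lam p x = lam p y" for x y k
    using that
  proof (induction k arbitrary: x y)
    case 0
    then have "x 0 < p" "y 0 < p" by (auto simp: Lam_def vilenkin_def)
    moreover have "lam p x mod p = lam p y mod p" using 0(3) by simp
    ultimately show ?case
      unfolding lam_step(2)[OF 0(1)] lam_step(2)[OF 0(2)] by simp
  next
    case (Suc k)
    let ?x = "\<lambda>j. if j \<le> 0 then x (j - 1) else 0" and ?y = "\<lambda>j. if j \<le> 0 then y (j - 1) else 0"
    have "x 0 < p" "y 0 < p" using Suc by (auto simp: Lam_def vilenkin_def)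
    moreover have "lam p x div p = lam p y div p" using Suc(4) by simp
    ultimately have "lam p ?x = lam p ?y"
      unfolding lam_step(2)[OF Suc(2)] lam_step(2)[OF Suc(3)] by simp
    then have "?x (- int k) = ?y (- int k)"
      using Suc.IH lam_step(1)[OF Suc(2)] lam_step(1)[OF Suc(3)] by blast
    moreover have "- int (Suc k) = - int k - 1" by simp
    ultimately show ?case by (simp only: neg_le_0_iff_le of_nat_0_le_iff if_True)
  qed
  from this[OF x y] have nonpos: "x j = y j" if "lam p x = lam p y" "j \<le> 0" for j
    using that by (cases rule: nonpos_int_cases[OF that(2)]) auto
  show "(lam p x = lam p y) = (x = y)"
  proof
    assume eq: "lam p x = lam p y"
    show "x = y"
    proof
      fix j
      show "x j = y j"
        using nonpos[OF eq] x y by (cases "j \<le> 0") (auto simp: Lam_def)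
    qed
  qed simp
next
  show "\<exists>x\<in>Lam p. n = lam p x" for n
  proof (induction n rule: less_induct)
    case (less n)
    show ?case
    proof (cases "n = 0")
      case True
      have "(\<lambda>_. 0) \<in> Lam p" "lam p (\<lambda>_. 0) = 0"
        using p by (auto simp: Lam_def vilenkin_def lam_def)
      then show ?thesis using True by (intro bexI[of _ "\<lambda>_. 0"]) auto
    next
      case False
      then have "n div p < n" using p by simp
      then obtain y where y: "y \<in> Lam p" "n div p = lam p y"
        using less by blast
      define x where "x = (\<lambda>j. if j = 0 then n mod p else y (j + 1))"
      obtain k where "\<forall>j<k. y j = 0"
        using y by (auto simp: Lam_def vilenkin_def)
      then have "\<forall>j<min 0 (k - 1). x j = 0" by (auto simp: x_def)
      moreover have "x j < p" for j
        using y p by (auto simp: Lam_def vilenkin_def x_def)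
      moreover have "\<forall>j>0. x j = 0"
        using y by (auto simp: Lam_def x_def)
      ultimately have x: "x \<in> Lam p"
        unfolding Lam_def vilenkin_def by blast
      have "(\<lambda>j. if j \<le> 0 then x (j - 1) else 0) = y"
        using y by (auto simp: x_def Lam_def fun_eq_iff)
      then have "lam p x = x 0 + p * (n div p)"
        using lam_step(2)[OF x] y(2) by simp
      then have "lam p x = n"
        by (simp add: x_def)
      then show ?thesis using x by blast
    qed
  qed
qed simp

section \<open>Square-integrable functions and orthonormal bases\<close>

definition L2 :: "'a measure \<Rightarrow> ('a \<Rightarrow> complex) set" where
  "L2 M = {f \<in> borel_measurable M. integrable M (\<lambda>x. (cmod (f x))\<^sup>2)}"

definition L2_inner :: "'a measure \<Rightarrow> ('a \<Rightarrow> complex) \<Rightarrow> ('a \<Rightarrow> complex) \<Rightarrow> complex" where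
  "L2_inner M f g = (\<integral>x. f x * cnj (g x) \<partial>M)"

definition L2_norm :: "'a measure \<Rightarrow> ('a \<Rightarrow> complex) \<Rightarrow> real" where
  "L2_norm M f = sqrt (\<integral>x. (cmod (f x))\<^sup>2 \<partial>M)"

text \<open>An orthonormal family, as a family indexed by \<open>I\<close>, whose linear span is dense.\<close>

definition orthonormal_basis_L2 :: "'a measure \<Rightarrow> 'i set \<Rightarrow> ('i \<Rightarrow> 'a \<Rightarrow> complex) \<Rightarrow> bool" where
  "orthonormal_basis_L2 M I e \<longleftrightarrow>
     (\<forall>i\<in>I. e i \<in> L2 M) \<and>
     (\<forall>i\<in>I. \<forall>k\<in>I. L2_inner M (e i) (e k) = (if i = k then 1 else 0)) \<and>
     (\<forall>f\<in>L2 M. \<forall>\<epsilon>>0. \<exists>F c. finite F \<and> F \<subseteq> I \<and> L2_norm M (\<lambda>x. f x - (\<Sum>i\<in>F. c i * e i x)) < \<epsilon>)"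

section \<open>Wavelet sets\<close>

text \<open>
  The inverse Fourier transform on the intersection of \<open>L\<^sup>1\<close> and \<open>L\<^sup>2\<close> of the dual group, with
  respect to the Haar measure \<open>M\<close> there.  It is applied only to indicator functions
  in \<open>L\<^sup>2\<close>; these are integrable, so the extension to all of \<open>L\<^sup>2\<close> is not needed.
\<close>

definition inverse_fourier ::
    "nat \<Rightarrow> (int \<Rightarrow> nat) measure \<Rightarrow> ((int \<Rightarrow> nat) \<Rightarrow> complex) \<Rightarrow> (int \<Rightarrow> nat) \<Rightarrow> complex" where
  "inverse_fourier p M f x = (\<integral>w. f w * pairing p x w \<partial>M)"

definition dilate_translate ::
    "nat \<Rightarrow> ((int \<Rightarrow> nat) \<Rightarrow> complex) \<Rightarrow> int \<Rightarrow> (int \<Rightarrow> nat) \<Rightarrow> (int \<Rightarrow> nat) \<Rightarrow> complex" where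
  "dilate_translate p f j n x = of_real (real p powr (real_of_int j / 2)) * f (ominus p (rho_pow j x) n)"

text \<open>\<open>M\<close> and \<open>M'\<close> are the Haar measures on the group and on its dual, respectively.\<close>

definition wavelet_set ::
    "nat \<Rightarrow> (int \<Rightarrow> nat) measure \<Rightarrow> (int \<Rightarrow> nat) measure \<Rightarrow> (nat \<Rightarrow> (int \<Rightarrow> nat) set) \<Rightarrow> bool" where
  "wavelet_set p M M' \<Omega> \<longleftrightarrow>
     (\<forall>u\<in>{1..p - 1}. \<Omega> u \<in> sets M' \<and> indicator (\<Omega> u) \<in> L2 M') \<and>
     orthonormal_basis_L2 M ({1..p - 1} \<times> UNIV \<times> Lam p)
       (\<lambda>(u, j, n). dilate_translate p (inverse_fourier p M' (indicator (\<Omega> u))) j n)"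

end

theory Submission
  imports Defs
begin

text \<open>
  Under the Fourier transform, \<open>\<psi>\<^bsub>j,n\<^esub>\<close> corresponds to the function \<open>\<omega> \<mapsto> p\<^bsup>-j/2\<^esup> cnj \<chi>(n, \<sigma>\<^bsup>j\<^esup> \<omega>)\<close> on
  \<open>\<rho>\<^sup>j(\<Omega>)\<close>, extended by zero.
  By Plancherel the wavelet system is therefore an orthonormal basis iff these functions form one.
  Since \<open>\<chi>(n, \<sqdot>)\<close> is \<open>\<Lambda>\<close>-periodic, orthonormality at the level \<open>j = 0\<close> says that the image of
  \<open>\<mu>\<close> restricted to \<open>\<Omega>\<close> under reduction modulo \<open>\<Lambda>\<close> has the same Fourier coefficients as \<open>\<mu>\<close> restricted to \<open>U\<close>.
  Indicators of cylinders in \<open>U\<close> are finite combinations of characters, so the two measures agree,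
  which is condition (ii). Conversely, under (ii) the functions of a fixed level and a fixed \<open>u\<close> form an orthonormal basis of
  \<open>L\<^sup>2(\<rho>\<^sup>j(\<Omega>))\<close>; spaces for different indices are orthogonal iff their supports are almost disjoint, and
  together they are everything iff the supports cover the group.
\<close>

section \<open>Approximation in mean square\<close>

text \<open>Closed spans are handled through finite combinations and an epsilon, and squared norms
  stay in \<open>ennreal\<close>, where infinite values need no side conditions. Because
  \<open>inverse_fourier\<close> is a plain integral, the isometry is stated on the intersection of
  L1 and L2, and surjectivity takes the form that each cylinder indicator is the transform of a
  function in that intersection. Condition (ii) speaks of an arbitrary partition, but the exact
  inclusion of the translated pieces in U leaves no choice: the piece with index n must be the part
  of \<Omega> inside n \<oplus> U. This is what allows the partition to be traded for an image
  measure. The delicate point is the necessity of disjointness. Orthogonality of two subfamilies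
  says nothing about their supports unless each subfamily is dense in the L2 space of its support,
  so (ii) has to be derived before disjointness and spread to all levels by scaling. It also gives
  each set measure 1, which supplies the square integrability in the converse direction.\<close>

text \<open>
  \<open>d = 0\<close> gives the squared \<open>L\<^sup>2\<close> norm; \<open>d = 1\<close> adds the \<open>L\<^sup>1\<close> norm, which lets a single density argument
  produce approximations in both senses.
\<close>

definition qdev :: "real \<Rightarrow> 'a measure \<Rightarrow> ('a \<Rightarrow> complex) \<Rightarrow> ennreal" where
  "qdev d M f = (\<integral>\<^sup>+x. ennreal (d * cmod (f x) + (cmod (f x))\<^sup>2) \<partial>M)"

lemma qdev_cong:
  assumes "\<And>x. x \<in> space M \<Longrightarrow> f x = g x"
  shows "qdev d M f = qdev d M g"
  unfolding qdev_def by (intro nn_integral_cong) (simp add: assms)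

lemma qdev_cong_AE:
  assumes "AE x in M. f x = g x"
  shows "qdev d M f = qdev d M g"
  unfolding qdev_def by (intro nn_integral_cong_AE) (use assms in auto)

lemma qdev_mono:
  assumes "0 \<le> d" "\<And>x. x \<in> space M \<Longrightarrow> cmod (f x) \<le> cmod (g x)"
  shows "qdev d M f \<le> qdev d M g"
  unfolding qdev_def
  by (intro nn_integral_mono ennreal_leI add_mono mult_left_mono power_mono) (use assms in auto)

lemma qdev_minus_commute: "qdev d M (\<lambda>x. f x - g x) = qdev d M (\<lambda>x. g x - f x)"
  unfolding qdev_def by (simp add: norm_minus_commute)

text \<open>By (a + b)^2 \<le> 2 a^2 + 2 b^2 the factor 2 serves for both terms at once, whatever
  \<open>d\<close> is. The loss is harmless wherever the right-hand side can be made arbitrarily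
  small.\<close>

lemma qdev_add:
  assumes d: "0 \<le> d" and [measurable]: "f \<in> borel_measurable M" "g \<in> borel_measurable M"
  shows "qdev d M (\<lambda>x. f x + g x) \<le> 2 * qdev d M f + 2 * qdev d M g"
proof -
  have *: "d * cmod (a + b) + (cmod (a + b))\<^sup>2
      \<le> 2 * (d * cmod a + (cmod a)\<^sup>2) + 2 * (d * cmod b + (cmod b)\<^sup>2)" for a b
  proof -
    have "cmod (a + b) \<le> cmod a + cmod b" by (rule norm_triangle_ineq)
    then have "(cmod (a + b))\<^sup>2 \<le> (cmod a + cmod b)\<^sup>2"
      by (intro power_mono) auto
    also have "\<dots> \<le> 2 * (cmod a)\<^sup>2 + 2 * (cmod b)\<^sup>2"
      using zero_le_power2[of "cmod a - cmod b"] unfolding power2_sum power2_diff by linarith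
    finally have 1: "(cmod (a + b))\<^sup>2 \<le> 2 * (cmod a)\<^sup>2 + 2 * (cmod b)\<^sup>2" .
    have "d * cmod (a + b) \<le> d * (2 * cmod a + 2 * cmod b)"
      using d norm_triangle_ineq[of a b] norm_ge_zero[of a] norm_ge_zero[of b]
      by (intro mult_left_mono) linarith+
    then show ?thesis using 1 by (simp add: algebra_simps)
  qed
  have "qdev d M (\<lambda>x. f x + g x) \<le> (\<integral>\<^sup>+x. 2 * ennreal (d * cmod (f x) + (cmod (f x))\<^sup>2)
      + 2 * ennreal (d * cmod (g x) + (cmod (g x))\<^sup>2) \<partial>M)"
    unfolding qdev_def
  proof (intro nn_integral_mono)
    fix x
    have "ennreal (d * cmod (f x + g x) + (cmod (f x + g x))\<^sup>2) \<le>
      ennreal (2 * (d * cmod (f x) + (cmod (f x))\<^sup>2) + 2 * (d * cmod (g x) + (cmod (g x))\<^sup>2))"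
      by (intro ennreal_leI *)
    also have "\<dots> = 2 * ennreal (d * cmod (f x) + (cmod (f x))\<^sup>2)
      + 2 * ennreal (d * cmod (g x) + (cmod (g x))\<^sup>2)"
      using d by (subst ennreal_plus) (auto simp: ennreal_mult)
    finally show "ennreal (d * cmod (f x + g x) + (cmod (f x + g x))\<^sup>2) \<le> \<dots>" .
  qed
  also have "\<dots> = 2 * qdev d M f + 2 * qdev d M g"
    unfolding qdev_def by (subst nn_integral_add) (auto simp: nn_integral_cmult)
  finally show ?thesis .
qed

lemma qdev_triangle:
  assumes "0 \<le> d" "f \<in> borel_measurable M" "g \<in> borel_measurable M" "h \<in> borel_measurable M"
  shows "qdev d M (\<lambda>x. f x - h x) \<le> 2 * qdev d M (\<lambda>x. f x - g x) + 2 * qdev d M (\<lambda>x. g x - h x)"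
  using qdev_add[of d "\<lambda>x. f x - g x" M "\<lambda>x. g x - h x"] assms by simp

text \<open>The linear term scales by |c| and the quadratic one by |c|^2; their sum bounds either,
  and only its finiteness matters.\<close>

lemma qdev_cmult:
  assumes d: "0 \<le> d" and [measurable]: "f \<in> borel_measurable M"
  shows "qdev d M (\<lambda>x. c * f x) \<le> ennreal (cmod c + (cmod c)\<^sup>2) * qdev d M f"
proof -
  have "qdev d M (\<lambda>x. c * f x) \<le>
      (\<integral>\<^sup>+x. ennreal (cmod c + (cmod c)\<^sup>2) * ennreal (d * cmod (f x) + (cmod (f x))\<^sup>2) \<partial>M)"
    unfolding qdev_def using d
    by (intro nn_integral_mono) (auto simp: ennreal_mult[symmetric] norm_mult algebra_simps power2_eq_square intro!: ennreal_leI)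
  also have "\<dots> = ennreal (cmod c + (cmod c)\<^sup>2) * qdev d M f"
    unfolding qdev_def by (rule nn_integral_cmult) simp
  finally show ?thesis .
qed

lemma qdev_indicator:
  assumes "0 \<le> d" "A \<in> sets M"
  shows "qdev d M (indicator A) = ennreal (d + 1) * emeasure M A"
proof -
  have "qdev d M (indicator A) = (\<integral>\<^sup>+x. ennreal (d + 1) * indicator A x \<partial>M)"
    unfolding qdev_def by (intro nn_integral_cong) (auto split: split_indicator)
  then show ?thesis using assms by (simp add: nn_integral_cmult_indicator)
qed

lemma qdev_finite_iff:
  assumes [measurable]: "f \<in> borel_measurable M"
  shows "qdev 1 M f < \<infinity> \<longleftrightarrow> integrable M f \<and> f \<in> L2 M"
    and "qdev 0 M f < \<infinity> \<longleftrightarrow> f \<in> L2 M"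
proof -
  show 0: "qdev 0 M f < \<infinity> \<longleftrightarrow> f \<in> L2 M"
    unfolding qdev_def L2_def by (simp add: integrable_iff_bounded)
  have "qdev 1 M f = (\<integral>\<^sup>+x. ennreal (cmod (f x)) \<partial>M) + qdev 0 M f"
    unfolding qdev_def by (simp add: nn_integral_add)
  then show "qdev 1 M f < \<infinity> \<longleftrightarrow> integrable M f \<and> f \<in> L2 M"
    using 0 by (simp add: integrable_iff_bounded)
qed

lemma qdev_0_le_1: "qdev 0 M f \<le> qdev 1 M f"
  unfolding qdev_def by (intro nn_integral_mono ennreal_leI) simp

lemma L2_norm_less_iff:
  assumes "f \<in> L2 M" "0 < e"
  shows "L2_norm M f < e \<longleftrightarrow> qdev 0 M f < ennreal (e\<^sup>2)"
proof -
  have "qdev 0 M f = ennreal (\<integral>x. (cmod (f x))\<^sup>2 \<partial>M)"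
    unfolding qdev_def using assms by (simp add: L2_def nn_integral_eq_integral)
  moreover have "0 \<le> (\<integral>x. (cmod (f x))\<^sup>2 \<partial>M)" by simp
  ultimately show ?thesis
    using assms(2) real_less_rsqrt real_sqrt_less_iff[of _ "e\<^sup>2"]
    by (simp add: L2_norm_def ennreal_less_iff)
qed

section \<open>The inner product on square-integrable functions\<close>

lemma borel_measurable_cnj:
  "f \<in> borel_measurable M \<Longrightarrow> (\<lambda>x. cnj (f x)) \<in> borel_measurable M"
  by (rule measurable_compose[OF _ borel_measurable_continuous_onI]) (auto intro: continuous_intros)

lemma L2_add:
  assumes "f \<in> L2 M" "g \<in> L2 M"
  shows "(\<lambda>x. f x + g x) \<in> L2 M"
proof -
  have [measurable]: "f \<in> borel_measurable M" "g \<in> borel_measurable M"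
    using assms by (auto simp: L2_def)
  have "qdev 0 M (\<lambda>x. f x + g x) \<le> 2 * qdev 0 M f + 2 * qdev 0 M g"
    by (rule qdev_add) auto
  also have "\<dots> < \<infinity>"
    using assms qdev_finite_iff(2)[of f M] qdev_finite_iff(2)[of g M]
    by (simp add: ennreal_mult_less_top)
  finally show ?thesis using qdev_finite_iff(2)[of "\<lambda>x. f x + g x" M] by simp
qed

lemma L2_cmult:
  assumes "f \<in> L2 M"
  shows "(\<lambda>x. c * f x) \<in> L2 M"
  using assms by (auto simp: L2_def norm_mult power_mult_distrib)

lemma L2_diff: "f \<in> L2 M \<Longrightarrow> g \<in> L2 M \<Longrightarrow> (\<lambda>x. f x - g x) \<in> L2 M"
  using L2_add[of f M "\<lambda>x. -1 * g x"] L2_cmult[of g M "-1"] by simp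

lemma L2_zero: "(\<lambda>x. 0) \<in> L2 M"
  by (simp add: L2_def)

lemma L2_sum: "(\<And>i. i \<in> F \<Longrightarrow> e i \<in> L2 M) \<Longrightarrow> (\<lambda>x. \<Sum>i\<in>F. c i * e i x) \<in> L2 M"
proof (induction F rule: infinite_finite_induct)
  case (insert i F)
  then show ?case
    using L2_add[OF L2_cmult[of "e i" M "c i"], of "\<lambda>x. \<Sum>i\<in>F. c i * e i x"] by simp
qed (simp_all add: L2_zero)

lemma L2_mult_integrable:
  assumes "f \<in> L2 M" "g \<in> L2 M"
  shows "integrable M (\<lambda>x. f x * cnj (g x))"
proof (rule Bochner_Integration.integrable_bound)
  show "integrable M (\<lambda>x. (cmod (f x))\<^sup>2 + (cmod (g x))\<^sup>2)"
    using assms by (auto simp: L2_def)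
  have [measurable]: "f \<in> borel_measurable M" "g \<in> borel_measurable M"
    using assms by (auto simp: L2_def)
  show "(\<lambda>x. f x * cnj (g x)) \<in> borel_measurable M"
    by (intro borel_measurable_times borel_measurable_cnj) measurable
  show "AE x in M. norm (f x * cnj (g x)) \<le> norm ((cmod (f x))\<^sup>2 + (cmod (g x))\<^sup>2)"
  proof (rule AE_I2)
    fix x
    have "2 * (cmod (f x) * cmod (g x)) \<le> (cmod (f x))\<^sup>2 + (cmod (g x))\<^sup>2"
      using zero_le_power2[of "cmod (f x) - cmod (g x)"] unfolding power2_diff by linarith
    moreover have "0 \<le> cmod (f x) * cmod (g x)" by simp
    ultimately have "cmod (f x) * cmod (g x) \<le> (cmod (f x))\<^sup>2 + (cmod (g x))\<^sup>2" by linarith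
    then show "norm (f x * cnj (g x)) \<le> norm ((cmod (f x))\<^sup>2 + (cmod (g x))\<^sup>2)"
      by (simp add: norm_mult)
  qed
qed

lemma qdev_0_eq_inner:
  assumes "f \<in> L2 M"
  shows "complex_of_real (enn2real (qdev 0 M f)) = L2_inner M f f"
proof -
  have "enn2real (qdev 0 M f) = (\<integral>x. (cmod (f x))\<^sup>2 \<partial>M)"
    unfolding qdev_def using assms by (subst integral_eq_nn_integral) (auto simp: L2_def)
  then show ?thesis
    unfolding L2_inner_def by (simp flip: complex_norm_square integral_complex_of_real)
qed

lemma L2_inner_sum_left:
  assumes "finite F" "\<And>i. i \<in> F \<Longrightarrow> e i \<in> L2 M" "g \<in> L2 M"
  shows "L2_inner M (\<lambda>x. \<Sum>i\<in>F. c i * e i x) g = (\<Sum>i\<in>F. c i * L2_inner M (e i) g)"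
proof -
  have "L2_inner M (\<lambda>x. \<Sum>i\<in>F. c i * e i x) g = (\<integral>x. (\<Sum>i\<in>F. c i * (e i x * cnj (g x))) \<partial>M)"
    unfolding L2_inner_def by (simp add: sum_distrib_right mult.assoc)
  also have "\<dots> = (\<Sum>i\<in>F. \<integral>x. c i * (e i x * cnj (g x)) \<partial>M)"
    by (rule Bochner_Integration.integral_sum)
      (intro integrable_mult_right L2_mult_integrable assms)
  finally show ?thesis
    unfolding L2_inner_def by simp
qed

lemma L2_inner_commute: "L2_inner M f g = cnj (L2_inner M g f)"
proof -
  have "(\<integral>x. cnj (g x * cnj (f x)) \<partial>M) = cnj (\<integral>x. g x * cnj (f x) \<partial>M)"
    by (rule Bochner_Integration.integral_cnj)
  then show ?thesis unfolding L2_inner_def by (simp add: mult.commute del: integral_cnj)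
qed

lemma L2_inner_sum_right:
  assumes "finite F" "\<And>i. i \<in> F \<Longrightarrow> e i \<in> L2 M" "g \<in> L2 M"
  shows "L2_inner M g (\<lambda>x. \<Sum>i\<in>F. c i * e i x) = (\<Sum>i\<in>F. cnj (c i) * L2_inner M g (e i))"
  by (subst L2_inner_commute, subst L2_inner_sum_left)
     (use assms in \<open>auto simp flip: L2_inner_commute intro: sum.cong\<close>)

text \<open>The squared norm of a combination is a quadratic form in the coefficients, given by the
  Gram matrix. The families may be far from orthogonal, as are cylinder indicators of different
  depths with nested supports.\<close>

lemma qdev_sum_eq:
  assumes "finite F" "\<And>i. i \<in> F \<Longrightarrow> e i \<in> L2 M" "\<And>i. i \<in> F \<Longrightarrow> g i \<in> L2 N"
    and "\<And>i j. i \<in> F \<Longrightarrow> j \<in> F \<Longrightarrow> L2_inner M (e i) (e j) = L2_inner N (g i) (g j)"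
  shows "qdev 0 M (\<lambda>x. \<Sum>i\<in>F. c i * e i x) = qdev 0 N (\<lambda>x. \<Sum>i\<in>F. c i * g i x)"
proof -
  let ?f = "\<lambda>x. \<Sum>i\<in>F. c i * e i x" and ?h = "\<lambda>x. \<Sum>i\<in>F. c i * g i x"
  have f: "?f \<in> L2 M" and h: "?h \<in> L2 N" using assms by (auto intro: L2_sum)
  have "L2_inner M ?f ?f = (\<Sum>i\<in>F. c i * (\<Sum>j\<in>F. cnj (c j) * L2_inner M (e i) (e j)))"
    using assms f by (simp add: L2_inner_sum_left L2_inner_sum_right)
  also have "\<dots> = (\<Sum>i\<in>F. c i * (\<Sum>j\<in>F. cnj (c j) * L2_inner N (g i) (g j)))"
    using assms by simp
  also have "\<dots> = L2_inner N ?h ?h"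
    using assms h by (simp add: L2_inner_sum_left L2_inner_sum_right)
  finally have "enn2real (qdev 0 M ?f) = enn2real (qdev 0 N ?h)"
    using qdev_0_eq_inner[OF f] qdev_0_eq_inner[OF h] by (metis of_real_eq_iff)
  moreover have "qdev 0 M ?f < \<infinity>" "qdev 0 N ?h < \<infinity>"
    using f h qdev_finite_iff(2)[of ?f M] qdev_finite_iff(2)[of ?h N] by (auto simp: L2_def)
  ultimately show ?thesis by (metis ennreal_enn2real infinity_ennreal_def)
qed

section \<open>Finite spans and their closures\<close>

definition lincomb :: "'i set \<Rightarrow> ('i \<Rightarrow> 'a \<Rightarrow> complex) \<Rightarrow> ('a \<Rightarrow> complex) set" where
  "lincomb I e = {\<lambda>x. \<Sum>i\<in>F. c i * e i x | F c. finite F \<and> F \<subseteq> I}"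

lemma lincomb_mem: "i \<in> I \<Longrightarrow> e i \<in> lincomb I e"
  unfolding lincomb_def by (intro CollectI exI[of _ "{i}"] exI[of _ "\<lambda>_. 1"]) auto

lemma lincomb_zero: "(\<lambda>x. 0) \<in> lincomb I e"
  unfolding lincomb_def by (intro CollectI exI[of _ "{}"]) auto

lemma lincomb_cmult: "s \<in> lincomb I e \<Longrightarrow> (\<lambda>x. c * s x) \<in> lincomb I e"
proof -
  assume "s \<in> lincomb I e"
  then obtain F a where F: "finite F" "F \<subseteq> I" "s = (\<lambda>x. \<Sum>i\<in>F. a i * e i x)"
    by (auto simp: lincomb_def)
  have "(\<lambda>x. c * s x) = (\<lambda>x. \<Sum>i\<in>F. (c * a i) * e i x)"
    by (simp add: F(3) sum_distrib_left mult.assoc)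
  then show ?thesis using F unfolding lincomb_def
    by (intro CollectI exI[of _ F] exI[of _ "\<lambda>i. c * a i"]) auto
qed

lemma lincomb_add: 
  assumes "s \<in> lincomb I e" "t \<in> lincomb I e"
  shows "(\<lambda>x. s x + t x) \<in> lincomb I e"
proof -
  from assms obtain F a G b where F: "finite F" "F \<subseteq> I" "s = (\<lambda>x. \<Sum>i\<in>F. a i * e i x)"
    and G: "finite G" "G \<subseteq> I" "t = (\<lambda>x. \<Sum>i\<in>G. b i * e i x)"
    by (auto simp: lincomb_def)
  define c where "c i = (if i \<in> F then a i else 0) + (if i \<in> G then b i else 0)" for i
  have "(\<Sum>i\<in>F \<union> G. c i * e i x) = s x + t x" for x
  proof -
    have "(\<Sum>i\<in>F \<union> G. c i * e i x) = (\<Sum>i\<in>F \<union> G. if i \<in> F then a i * e i x else 0)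
        + (\<Sum>i\<in>F \<union> G. if i \<in> G then b i * e i x else 0)"
      unfolding sum.distrib[symmetric] c_def by (intro sum.cong) (auto simp: algebra_simps)
    also have "(\<Sum>i\<in>F \<union> G. if i \<in> F then a i * e i x else 0) = s x"
      unfolding F(3) using F G by (intro sum.mono_neutral_cong_right) auto
    also have "(\<Sum>i\<in>F \<union> G. if i \<in> G then b i * e i x else 0) = t x"
      unfolding G(3) using F G by (intro sum.mono_neutral_cong_right) auto
    finally show ?thesis .
  qed
  then show ?thesis unfolding lincomb_def
    using F G by (intro CollectI exI[of _ "F \<union> G"] exI[of _ c]) auto
qed

lemma lincomb_sum:
  "(\<And>i. i \<in> F \<Longrightarrow> s i \<in> lincomb I e) \<Longrightarrow> (\<lambda>x. \<Sum>i\<in>F. c i * s i x) \<in> lincomb I e"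
proof (induction F rule: infinite_finite_induct)
  case (insert i F)
  then show ?case
    using lincomb_add[OF lincomb_cmult[of "s i" I e "c i"], of "\<lambda>x. \<Sum>i\<in>F. c i * s i x"] by simp
qed (simp_all add: lincomb_zero)

lemma lincomb_diff:
  "s \<in> lincomb I e \<Longrightarrow> t \<in> lincomb I e \<Longrightarrow> (\<lambda>x. s x - t x) \<in> lincomb I e"
  using lincomb_add[of s I e "\<lambda>x. -1 * t x"] lincomb_cmult[of t I e "-1"] by simp

lemma lincomb_induct [consumes 1, case_names zero add]:
  assumes "s \<in> lincomb I e"
    and "P (\<lambda>x. 0)"
    and "\<And>i c t. i \<in> I \<Longrightarrow> t \<in> lincomb I e \<Longrightarrow> P t \<Longrightarrow> P (\<lambda>x. c * e i x + t x)"
  shows "P s"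
proof -
  from assms(1) obtain F c where F: "finite F" "F \<subseteq> I" "s = (\<lambda>x. \<Sum>i\<in>F. c i * e i x)"
    by (auto simp: lincomb_def)
  have "(\<lambda>x. \<Sum>i\<in>F. c i * e i x) \<in> lincomb I e \<and> P (\<lambda>x. \<Sum>i\<in>F. c i * e i x)"
    using F(1,2) by induction (auto intro!: assms lincomb_zero lincomb_add lincomb_cmult lincomb_mem)
  then show ?thesis using F by simp
qed

lemma lincomb_measurable:
  "s \<in> lincomb I e \<Longrightarrow> (\<And>i. i \<in> I \<Longrightarrow> e i \<in> borel_measurable M) \<Longrightarrow> s \<in> borel_measurable M"
  unfolding lincomb_def by (auto intro!: borel_measurable_sum borel_measurable_times)

text \<open>Membership in the closure of the finite span: in mean square for \<open>d = 0\<close>,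
  in mean square and in mean simultaneously for \<open>d = 1\<close>.\<close>

definition appr :: "real \<Rightarrow> 'a measure \<Rightarrow> 'i set \<Rightarrow> ('i \<Rightarrow> 'a \<Rightarrow> complex) \<Rightarrow> ('a \<Rightarrow> complex) \<Rightarrow> bool" where
  "appr d M I e f \<longleftrightarrow> (\<forall>r>0. \<exists>s\<in>lincomb I e. qdev d M (\<lambda>x. f x - s x) < ennreal r)"

lemma apprD: "appr d M I e f \<Longrightarrow> 0 < r \<Longrightarrow> \<exists>s\<in>lincomb I e. qdev d M (\<lambda>x. f x - s x) < ennreal r"
  by (simp add: appr_def)

lemma appr_lincomb: "s \<in> lincomb I e \<Longrightarrow> appr d M I e s"
  unfolding appr_def by (auto intro!: bexI[of _ s] simp: qdev_def)

text \<open>Accounts for the loss in \<open>qdev_add\<close> and \<open>qdev_triangle\<close>: two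
  errors below r/4, each doubled, stay below r.\<close>

lemma ennreal_quarters_less:
  assumes "a < ennreal (r / 4)" "b < ennreal (r / 4)"
  shows "2 * a + 2 * b < ennreal r"
proof -
  have "2 * a + 2 * b < 2 * ennreal (r / 4) + 2 * ennreal (r / 4)"
    using assms by (intro add_strict_mono ennreal_mult_strict_left_mono) auto
  moreover have "0 < ennreal (r / 4)" by (rule le_less_trans[OF zero_le assms(1)])
  then have "0 < r" by (simp add: ennreal_less_zero_iff)
  then have "2 * ennreal (r / 4) + 2 * ennreal (r / 4) = ennreal r"
    by (simp add: ennreal_mult[symmetric] ennreal_plus[symmetric] ennreal_numeral[symmetric] del: ennreal_plus ennreal_numeral)
  ultimately show ?thesis by simp
qed

lemma appr_lim:
  assumes d: "0 \<le> d" and e: "\<And>i. i \<in> I \<Longrightarrow> e i \<in> borel_measurable M" and f: "f \<in> borel_measurable M"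
    and h: "\<And>r. 0 < r \<Longrightarrow>
      \<exists>h. h \<in> borel_measurable M \<and> appr d M I e h \<and> qdev d M (\<lambda>x. f x - h x) < ennreal r"
  shows "appr d M I e f"
  unfolding appr_def
proof (intro allI impI)
  fix r :: real assume "0 < r"
  then have r: "0 < r / 4" by simp
  from h[OF r] obtain h where h: "h \<in> borel_measurable M" "appr d M I e h"
    "qdev d M (\<lambda>x. f x - h x) < ennreal (r / 4)" by blast
  from apprD[OF h(2) r] obtain s where s: "s \<in> lincomb I e"
    "qdev d M (\<lambda>x. h x - s x) < ennreal (r / 4)" by blast
  have "s \<in> borel_measurable M" using lincomb_measurable s e by blast
  then have "qdev d M (\<lambda>x. f x - s x) \<le> 2 * qdev d M (\<lambda>x. f x - h x) + 2 * qdev d M (\<lambda>x. h x - s x)"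
    using qdev_triangle[OF d f h(1)] by blast
  also have "\<dots> < ennreal r" by (rule ennreal_quarters_less[OF h(3) s(2)])
  finally show "\<exists>s\<in>lincomb I e. qdev d M (\<lambda>x. f x - s x) < ennreal r"
    using s by blast
qed

lemma appr_cmult:
  assumes d: "0 \<le> d" and e: "\<And>i. i \<in> I \<Longrightarrow> e i \<in> borel_measurable M"
    and f: "f \<in> borel_measurable M" "appr d M I e f"
  shows "appr d M I e (\<lambda>x. c * f x)"
  unfolding appr_def
proof (intro allI impI)
  fix r :: real assume r: "0 < r"
  \<comment> \<open>The added 1 keeps \<open>K\<close> positive when \<open>c\<close> is
    zero.\<close>
  define K where "K = cmod c + (cmod c)\<^sup>2 + 1"
  have K: "K > 0" unfolding K_def by (simp add: add_nonneg_pos)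
  from apprD[OF f(2), of "r / K"] r K obtain s where s: "s \<in> lincomb I e"
    "qdev d M (\<lambda>x. f x - s x) < ennreal (r / K)" by auto
  have "s \<in> borel_measurable M" using lincomb_measurable s e by blast
  then have "qdev d M (\<lambda>x. c * (f x - s x)) \<le> ennreal (cmod c + (cmod c)\<^sup>2) * qdev d M (\<lambda>x. f x - s x)"
    using f by (intro qdev_cmult d) auto
  also have "\<dots> \<le> ennreal K * qdev d M (\<lambda>x. f x - s x)"
    unfolding K_def by (intro mult_right_mono ennreal_leI) auto
  also have "\<dots> < ennreal K * ennreal (r / K)"
    using s K by (intro ennreal_mult_strict_left_mono) auto
  also have "\<dots> = ennreal r"
    using K r by (simp add: ennreal_mult[symmetric])
  finally show "\<exists>s\<in>lincomb I e. qdev d M (\<lambda>x. c * f x - s x) < ennreal r"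
    using lincomb_cmult[OF s(1), of c] by (auto simp: right_diff_distrib)
qed

lemma appr_add:
  assumes d: "0 \<le> d" and e: "\<And>i. i \<in> I \<Longrightarrow> e i \<in> borel_measurable M"
    and f: "f \<in> borel_measurable M" "appr d M I e f"
    and g: "g \<in> borel_measurable M" "appr d M I e g"
  shows "appr d M I e (\<lambda>x. f x + g x)"
  unfolding appr_def
proof (intro allI impI)
  fix r :: real assume "0 < r"
  then have r: "0 < r / 4" by simp
  from apprD[OF f(2) r] obtain s where s: "s \<in> lincomb I e"
    "qdev d M (\<lambda>x. f x - s x) < ennreal (r / 4)" by blast
  from apprD[OF g(2) r] obtain t where t: "t \<in> lincomb I e"
    "qdev d M (\<lambda>x. g x - t x) < ennreal (r / 4)" by blast
  have m: "s \<in> borel_measurable M" "t \<in> borel_measurable M"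
    using lincomb_measurable s t e by blast+
  have "qdev d M (\<lambda>x. (f x + g x) - (s x + t x)) = qdev d M (\<lambda>x. (f x - s x) + (g x - t x))"
    by (simp add: algebra_simps)
  also have "\<dots> \<le> 2 * qdev d M (\<lambda>x. f x - s x) + 2 * qdev d M (\<lambda>x. g x - t x)"
    using m f g by (intro qdev_add d) auto
  also have "\<dots> < ennreal r" by (rule ennreal_quarters_less[OF s(2) t(2)])
  finally show "\<exists>s\<in>lincomb I e. qdev d M (\<lambda>x. (f x + g x) - s x) < ennreal r"
    using lincomb_add[OF s(1) t(1)] by (intro bexI[of _ "\<lambda>x. s x + t x"])
qed

text \<open>Finite combinations of the \<open>h k\<close> inherit approximability, and so do their
  limits. Density is passed on in stages in this way, from indicators of sets of finite measure to
  cylinders, and from either of them to the system of interest.\<close>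

lemma appr_trans:
  assumes d: "0 \<le> d" and e: "\<And>i. i \<in> I \<Longrightarrow> e i \<in> borel_measurable M"
    and h: "\<And>k. k \<in> K \<Longrightarrow> h k \<in> borel_measurable M" "\<And>k. k \<in> K \<Longrightarrow> appr d M I e (h k)"
    and f: "f \<in> borel_measurable M" "appr d M K h f"
  shows "appr d M I e f"
proof (rule appr_lim[OF d e f(1)])
  fix r :: real assume "0 < r"
  from apprD[OF f(2) this] obtain s where s: "s \<in> lincomb K h"
    "qdev d M (\<lambda>x. f x - s x) < ennreal r" by blast
  from s(1) have "s \<in> borel_measurable M \<and> appr d M I e s"
  proof (induction rule: lincomb_induct)
    case zero
    show ?case by (auto intro: appr_lincomb lincomb_zero)
  next
    case (add i c t)
    have "appr d M I e (\<lambda>x. c * h i x)"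
      by (rule appr_cmult[OF d e]) (use add h in auto)
    with add h show ?case
      by (auto intro!: appr_add d e)
  qed
  with s show "\<exists>h. h \<in> borel_measurable M \<and> appr d M I e h \<and> qdev d M (\<lambda>x. f x - h x) < ennreal r"
    by blast
qed

lemma appr_AE:
  assumes "AE x in M. f x = g x" "appr d M I e f"
  shows "appr d M I e g"
proof -
  have "qdev d M (\<lambda>x. g x - s x) = qdev d M (\<lambda>x. f x - s x)" for s
    using assms(1) by (intro qdev_cong_AE) auto
  then show ?thesis using assms(2) by (simp add: appr_def)
qed

text \<open>Finite measure of the union makes the measure of the tails tend to zero, so finitely
  many of the sets already approximate the union.\<close>

lemma appr_indicator_UN:
  fixes D :: "nat \<Rightarrow> 'a set"
  assumes d: "0 \<le> d" and e: "\<And>i. i \<in> I \<Longrightarrow> e i \<in> borel_measurable M"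
    and D: "\<And>n. D n \<in> sets M" "disjoint_family D" "\<And>n. appr d M I e (indicator (D n))"
    and fin: "emeasure M (\<Union>n. D n) < \<infinity>"
  shows "appr d M I e (indicator (\<Union>n. D n))"
proof (rule appr_lim[OF d e])
  show "indicator (\<Union>n. D n) \<in> borel_measurable M" using D(1) by measurable
  fix r :: real assume r: "0 < r"
  define T where "T n = (\<Union>i\<in>{n..}. D i)" for n
  have T: "T n \<in> sets M" for n using D(1) unfolding T_def by auto
  have "(\<lambda>n. emeasure M (T n)) \<longlonglongrightarrow> emeasure M (\<Inter>n. T n)"
  proof (rule Lim_emeasure_decseq)
    show "range T \<subseteq> sets M" using T by auto
    show "decseq T" unfolding T_def decseq_def by (intro allI impI UN_mono) auto
    have "emeasure M (T n) \<le> emeasure M (\<Union>n. D n)" for n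
      unfolding T_def using D(1) by (intro emeasure_mono) auto
    then show "emeasure M (T n) \<noteq> \<infinity>" for n
      using fin by (metis infinity_ennreal_def leD)
  qed
  moreover have "(\<Inter>n. T n) = {}"
  proof -
    have "x \<notin> (\<Inter>n. T n)" for x
    proof
      assume x: "x \<in> (\<Inter>n. T n)"
      then obtain i where i: "x \<in> D i" unfolding T_def by auto
      from x have "x \<in> T (Suc i)" by blast
      then obtain j where "j \<ge> Suc i" "x \<in> D j" unfolding T_def by auto
      with i disjoint_family_onD[OF D(2), of i j] show False by auto
    qed
    then show ?thesis by blast
  qed
  ultimately have "(\<lambda>n. emeasure M (T n)) \<longlonglongrightarrow> 0" by simp
  \<comment> \<open>\<open>qdev\<close> of an indicator is \<open>d + 1\<close> times the measure of
    the set, whence the divisor.\<close>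
  then have "eventually (\<lambda>n. emeasure M (T n) < ennreal (r / (d + 1))) sequentially"
    using r d by (intro order_tendstoD(2)) (auto simp: add_nonneg_pos)
  then obtain n where n: "emeasure M (T n) < ennreal (r / (d + 1))"
    by (auto simp: eventually_sequentially)
  define h :: "'a \<Rightarrow> complex" where "h x = (\<Sum>i<n. 1 * indicator (D i) x)" for x
  have h_eq: "h x = indicator (\<Union>i<n. D i) x" for x
    unfolding h_def using D(2)
    by (subst indicator_UN_disjoint) (auto simp: disjoint_family_on_def)
  have "appr d M I e h"
  proof (rule appr_trans[OF d e, where K = UNIV and h = "\<lambda>i. indicator (D i)"])
    show "h \<in> borel_measurable M" unfolding h_def using D(1) by measurable
    show "appr d M UNIV (\<lambda>i. indicator (D i)) h"
      unfolding h_def by (intro appr_lincomb lincomb_sum lincomb_mem) auto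
  qed (use D in auto)
  moreover have "h \<in> borel_measurable M" unfolding h_def using D(1) by measurable
  moreover have "qdev d M (\<lambda>x. indicator (\<Union>n. D n) x - h x) < ennreal r"
  proof -
    have "indicator (\<Union>n. D n) x - h x = indicator (T n) x" for x
    proof -
      have "x \<notin> T n" if "x \<in> D i" "i < n" for i
        using that disjoint_family_onD[OF D(2), of i] unfolding T_def by (fastforce simp: disjoint_iff)
      moreover have "x \<in> T n" if "x \<in> D i" "\<forall>i<n. x \<notin> D i" for i
        using that unfolding T_def by (metis UN_I atLeast_iff not_le)
      moreover have "x \<in> (\<Union>n. D n)" if "x \<in> T n"
        using that unfolding T_def by auto
      ultimately show ?thesis
        unfolding h_eq indicator_def by (auto 0 3)
    qed
    then have "qdev d M (\<lambda>x. indicator (\<Union>n. D n) x - h x) = qdev d M (indicator (T n))"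
      by (intro qdev_cong) auto
    also have "\<dots> = ennreal (d + 1) * emeasure M (T n)"
      by (rule qdev_indicator[OF d T])
    also have "\<dots> < ennreal (d + 1) * ennreal (r / (d + 1))"
      using n d by (intro ennreal_mult_strict_left_mono) (auto simp del: ennreal_plus)
    also have "\<dots> = ennreal r"
      using d r by (simp add: ennreal_mult[symmetric] del: ennreal_plus)
    finally show ?thesis .
  qed
  ultimately show "\<exists>h. h \<in> borel_measurable M \<and> appr d M I e h \<and>
      qdev d M (\<lambda>x. indicator (\<Union>n. D n) x - h x) < ennreal r" by blast
qed (use assms in auto)

text \<open>Simple functions S converging pointwise to f with |S| \<le> 2|f| converge in
  \<open>qdev\<close> by dominated convergence; the nonzero levels of such an S yield the
  combination of indicators.\<close>

lemma appr_indicators: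
  assumes d: "0 \<le> d" and f: "f \<in> borel_measurable M" and fin: "qdev d M f < \<infinity>"
  shows "appr d M {A \<in> sets M. emeasure M A < \<infinity>} indicator f"
  unfolding appr_def
proof (intro allI impI)
  fix r :: real assume r: "0 < r"
  let ?I = "{A \<in> sets M. emeasure M A < \<infinity>}"
  note [measurable] = f
  obtain S where S: "\<And>i. simple_function M (S i)" "\<And>x. x \<in> space M \<Longrightarrow> (\<lambda>i. S i x) \<longlonglongrightarrow> f x"
    "\<And>i x. x \<in> space M \<Longrightarrow> cmod (S i x) \<le> 2 * cmod (f x)"
    using borel_measurable_implies_sequence_metric[OF f, of 0] by simp metis
  have [measurable]: "S i \<in> borel_measurable M" for i
    using S(1) by (rule borel_measurable_simple_function)
  \<comment> \<open>From |S| \<le> 2|f| the difference is at most 3|f|. The linear term grows by at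
    most 3 and the square by at most 9, so 12 dominates both.\<close>
  have "(\<lambda>i. qdev d M (\<lambda>x. f x - S i x)) \<longlonglongrightarrow> (\<integral>\<^sup>+x. 0 \<partial>M)"
    unfolding qdev_def
  proof (rule nn_integral_dominated_convergence
      [where w = "\<lambda>x. ennreal (3 + 9) * ennreal (d * cmod (f x) + (cmod (f x))\<^sup>2)"])
    show "(\<integral>\<^sup>+x. ennreal (3 + 9) * ennreal (d * cmod (f x) + (cmod (f x))\<^sup>2) \<partial>M) < \<infinity>"
      using fin unfolding qdev_def by (subst nn_integral_cmult) (auto simp: ennreal_mult_less_top)
    show "AE x in M. ennreal (d * cmod (f x - S j x) + (cmod (f x - S j x))\<^sup>2)
      \<le> ennreal (3 + 9) * ennreal (d * cmod (f x) + (cmod (f x))\<^sup>2)" for j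
    proof (rule AE_I2)
      fix x assume "x \<in> space M"
      then have *: "cmod (f x - S j x) \<le> 3 * cmod (f x)"
        using S(3)[of x j] norm_triangle_ineq4[of "f x" "S j x"] by linarith
      have "d * cmod (f x - S j x) \<le> 12 * (d * cmod (f x))"
        using mult_left_mono[OF *, of d] d mult_nonneg_nonneg[OF d norm_ge_zero[of "f x"]]
        unfolding mult.left_commute[of d 3] by linarith
      moreover have "(cmod (f x - S j x))\<^sup>2 \<le> 9 * (cmod (f x))\<^sup>2"
        using power_mono[OF * norm_ge_zero, of 2] by (simp add: power_mult_distrib)
      then have "(cmod (f x - S j x))\<^sup>2 \<le> 12 * (cmod (f x))\<^sup>2"
        by (rule order_trans) simp
      ultimately show "ennreal (d * cmod (f x - S j x) + (cmod (f x - S j x))\<^sup>2)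
        \<le> ennreal (3 + 9) * ennreal (d * cmod (f x) + (cmod (f x))\<^sup>2)"
        using d by (subst ennreal_mult[symmetric]) (auto intro!: ennreal_leI simp: algebra_simps simp del: ennreal_plus)
    qed
    show "AE x in M. (\<lambda>i. ennreal (d * cmod (f x - S i x) + (cmod (f x - S i x))\<^sup>2)) \<longlonglongrightarrow> 0"
    proof (rule AE_I2)
      fix x assume "x \<in> space M"
      have "(\<lambda>i. d * cmod (f x - S i x) + (cmod (f x - S i x))\<^sup>2)
          \<longlonglongrightarrow> d * cmod (f x - f x) + (cmod (f x - f x))\<^sup>2"
        using S(2)[OF \<open>x \<in> space M\<close>] by (intro tendsto_intros)
      then show "(\<lambda>i. ennreal (d * cmod (f x - S i x) + (cmod (f x - S i x))\<^sup>2)) \<longlonglongrightarrow> 0"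
        using tendsto_ennrealI by fastforce
    qed
  qed auto
  then have "(\<lambda>i. qdev d M (\<lambda>x. f x - S i x)) \<longlonglongrightarrow> 0" by simp
  then have "eventually (\<lambda>i. qdev d M (\<lambda>x. f x - S i x) < ennreal r) sequentially"
    using r by (intro order_tendstoD(2)) auto
  then obtain i where i: "qdev d M (\<lambda>x. f x - S i x) < ennreal r"
    by (auto simp: eventually_sequentially)
  \<comment> \<open>The value 0 is left out because its level set may have infinite measure; it
    contributes nothing to the sum.\<close>
  define s where "s x = (\<Sum>y\<in>S i ` space M - {0}. y * indicator (S i -` {y} \<inter> space M) x)" for x
  have finS: "finite (S i ` space M)" using S(1) by (rule simple_functionD)
  have "s x = S i x" if "x \<in> space M" for x
  proof -
    have "s x = (\<Sum>y\<in>S i ` space M - {0}. if y = S i x then y else 0)"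
      unfolding s_def using that by (intro sum.cong) (auto simp: indicator_def)
    also have "\<dots> = S i x" using finS that by (auto simp: sum.delta)
    finally show ?thesis .
  qed
  then have "qdev d M (\<lambda>x. f x - s x) < ennreal r"
    using i qdev_cong[of M "\<lambda>x. f x - s x" "\<lambda>x. f x - S i x" d] by simp
  moreover have "s \<in> lincomb ?I indicator"
    unfolding s_def
  proof (intro lincomb_sum lincomb_mem CollectI conjI)
    fix y assume y: "y \<in> S i ` space M - {0}"
    show m: "S i -` {y} \<inter> space M \<in> sets M" by measurable
    let ?A = "S i -` {y} \<inter> space M"
    \<comment> \<open>Chebyshev's inequality: on the level set |y| \<le> 2|f|, so |y|^2 times its
      measure is at most four times a finite quantity.\<close>
    have "ennreal ((cmod y)\<^sup>2) * emeasure M ?A = (\<integral>\<^sup>+x. ennreal ((cmod y)\<^sup>2) * indicator ?A x \<partial>M)"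
      using m by (simp add: nn_integral_cmult_indicator)
    also have "\<dots> \<le> (\<integral>\<^sup>+x. ennreal 4 * ennreal (d * cmod (f x) + (cmod (f x))\<^sup>2) \<partial>M)"
    proof (intro nn_integral_mono)
      fix x assume x: "x \<in> space M"
      show "ennreal ((cmod y)\<^sup>2) * indicator ?A x \<le> ennreal 4 * ennreal (d * cmod (f x) + (cmod (f x))\<^sup>2)"
      proof (cases "x \<in> ?A")
        case True
        then have "cmod y \<le> 2 * cmod (f x)" using S(3)[OF x, of i] by auto
        then have "(cmod y)\<^sup>2 \<le> (2 * cmod (f x))\<^sup>2" by (intro power_mono) auto
        also have "\<dots> \<le> 4 * (d * cmod (f x) + (cmod (f x))\<^sup>2)"
          using d by (simp add: power_mult_distrib)
        finally show ?thesis
          using True d by (subst ennreal_mult[symmetric]) (simp_all add: ennreal_leI del: ennreal_plus)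
      qed simp
    qed
    also have "\<dots> = ennreal 4 * qdev d M f" unfolding qdev_def by (rule nn_integral_cmult) simp
    also have "\<dots> < \<infinity>" using fin by (simp add: ennreal_mult_less_top)
    finally show "emeasure M ?A < \<infinity>"
      using y by (auto simp: ennreal_mult_less_top)
  qed
  ultimately show "\<exists>s\<in>lincomb ?I indicator. qdev d M (\<lambda>x. f x - s x) < ennreal r" by blast
qed

text \<open>The quantifier over all radii absorbs the passage from a norm to its square. Membership
  of all \<open>e i\<close> in L2 has to come before the comparison: the Bochner integral inside
  \<open>L2_norm\<close> is zero where integrability fails, and the norm then carries no
  information.\<close>

lemma orthonormal_basis_L2_iff_appr:
  "orthonormal_basis_L2 M I e \<longleftrightarrow>
     (\<forall>i\<in>I. e i \<in> L2 M) \<and>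
     (\<forall>i\<in>I. \<forall>k\<in>I. L2_inner M (e i) (e k) = (if i = k then 1 else 0)) \<and>
     (\<forall>f\<in>L2 M. appr 0 M I e f)" (is "_ \<longleftrightarrow> ?L2 \<and> ?orth \<and> ?complete")
proof -
  have *: "(\<forall>r>0. \<exists>F c. finite F \<and> F \<subseteq> I \<and> L2_norm M (\<lambda>x. f x - (\<Sum>i\<in>F. c i * e i x)) < r)
      \<longleftrightarrow> appr 0 M I e f" (is "(\<forall>r>0. ?norm r) \<longleftrightarrow> _") if e: ?L2 and f: "f \<in> L2 M" for f
  proof -
    have n: "?norm r \<longleftrightarrow> (\<exists>s\<in>lincomb I e. qdev 0 M (\<lambda>x. f x - s x) < ennreal (r\<^sup>2))" if "r > 0" for r
    proof -
      have "L2_norm M (\<lambda>x. f x - (\<Sum>i\<in>F. c i * e i x)) < r \<longleftrightarrow>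
          qdev 0 M (\<lambda>x. f x - (\<Sum>i\<in>F. c i * e i x)) < ennreal (r\<^sup>2)" if "F \<subseteq> I" for F c
        using that e by (intro L2_norm_less_iff L2_diff[OF f] L2_sum \<open>r > 0\<close>) auto
      then show ?thesis unfolding lincomb_def by (auto 4 3)
    qed
    show ?thesis
      unfolding appr_def
    proof (intro iffI allI impI)
      fix r :: real
      assume *: "\<forall>r>0. ?norm r" and "r > 0"
      then have "?norm (sqrt r)" by simp
      then show "\<exists>s\<in>lincomb I e. qdev 0 M (\<lambda>x. f x - s x) < ennreal r"
        using n[of "sqrt r"] \<open>r > 0\<close> by simp
    next
      fix r :: real
      assume *: "\<forall>r>0. \<exists>s\<in>lincomb I e. qdev 0 M (\<lambda>x. f x - s x) < ennreal r" and "r > 0"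
      then show "?norm r" using n[of r] *[rule_format, of "r\<^sup>2"] by simp
    qed
  qed
  show ?thesis
  proof (cases ?L2)
    case True
    then show ?thesis
      unfolding orthonormal_basis_L2_def by (intro conj_cong ball_cong refl *)
  qed (simp only: orthonormal_basis_L2_def simp_thms)
qed

section \<open>Integrals of indicators, limits of squared norms, polarization\<close>

lemma integral_indicator_complex:
  assumes "A \<in> sets M" "emeasure M A < \<infinity>"
  shows "(\<integral>x. indicator A x \<partial>M) = complex_of_real (measure M A)"
proof -
  have "(\<integral>x. indicator A x \<partial>M) = (\<integral>x. indicator A x *\<^sub>R (1 :: complex) \<partial>M)"
    by (intro Bochner_Integration.integral_cong) (auto simp: indicator_def)
  also have "\<dots> = measure M A *\<^sub>R 1"
    using has_bochner_integral_indicator[OF assms, of "1 :: complex"]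
    by (rule has_bochner_integral_integral_eq)
  finally show ?thesis by (simp add: scaleR_conv_of_real)
qed

text \<open>Young's inequality 2ab \<le> t a^2 + b^2/t. In contrast to \<open>qdev_add\<close>, the
  constant of the main term can be brought as close to 1 as desired, as exact equality of norms in
  the limit demands.\<close>

lemma qdev_add_le:
  assumes t: "0 < t" and [measurable]: "f \<in> borel_measurable M" "g \<in> borel_measurable M"
  shows "qdev 0 M (\<lambda>x. f x + g x) \<le> ennreal (1 + t) * qdev 0 M f + ennreal (1 + 1 / t) * qdev 0 M g"
proof -
  have *: "(cmod (a + b))\<^sup>2 \<le> (1 + t) * (cmod a)\<^sup>2 + (1 + 1 / t) * (cmod b)\<^sup>2" for a b
  proof -
    have "(cmod (a + b))\<^sup>2 \<le> (cmod a + cmod b)\<^sup>2"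
      by (intro power_mono norm_triangle_ineq) simp
    moreover have "0 \<le> (t * cmod a - cmod b)\<^sup>2 / t" using t by simp
    then have "2 * (cmod a * cmod b) \<le> t * (cmod a)\<^sup>2 + (cmod b)\<^sup>2 / t"
      using t by (simp add: power2_eq_square field_simps)
    ultimately show ?thesis by (simp add: power2_sum distrib_right)
  qed
  have "qdev 0 M (\<lambda>x. f x + g x) \<le> (\<integral>\<^sup>+x. ennreal (1 + t) * ennreal ((cmod (f x))\<^sup>2)
      + ennreal (1 + 1 / t) * ennreal ((cmod (g x))\<^sup>2) \<partial>M)"
    unfolding qdev_def
  proof (intro nn_integral_mono)
    fix x
    have "ennreal ((cmod (f x + g x))\<^sup>2) \<le> ennreal ((1 + t) * (cmod (f x))\<^sup>2 + (1 + 1 / t) * (cmod (g x))\<^sup>2)"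
      by (intro ennreal_leI *)
    also have "\<dots> = ennreal ((1 + t) * (cmod (f x))\<^sup>2) + ennreal ((1 + 1 / t) * (cmod (g x))\<^sup>2)"
      using t by (intro ennreal_plus mult_nonneg_nonneg) simp_all
    also have "\<dots> = ennreal (1 + t) * ennreal ((cmod (f x))\<^sup>2) + ennreal (1 + 1 / t) * ennreal ((cmod (g x))\<^sup>2)"
      using t by (subst (1 2) ennreal_mult) simp_all
    finally show "ennreal (0 * cmod (f x + g x) + (cmod (f x + g x))\<^sup>2) \<le> \<dots>" by simp
  qed
  also have "\<dots> = ennreal (1 + t) * qdev 0 M f + ennreal (1 + 1 / t) * qdev 0 M g"
    unfolding qdev_def by (subst nn_integral_add) (simp_all add: nn_integral_cmult del: ennreal_plus)
  finally show ?thesis .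
qed

text \<open>Two uses of Young's inequality, one for f against \<open>s n\<close> and one for
  \<open>r n\<close> against g, cost a factor (1 + t)^2 in the limit over n; then t tends to 0.
  Being one-sided, it is applied twice in Plancherel, with the roles exchanged.\<close>

lemma qdev_le_if_approx:
  assumes f: "f \<in> borel_measurable M" "\<And>n. s n \<in> borel_measurable M"
    and g: "g \<in> borel_measurable N" "\<And>n. r n \<in> borel_measurable N"
    and lim_s: "(\<lambda>n. qdev 0 M (\<lambda>x. f x - s n x)) \<longlonglongrightarrow> 0"
    and lim_r: "(\<lambda>n. qdev 0 N (\<lambda>x. r n x - g x)) \<longlonglongrightarrow> 0"
    and eq: "\<And>n. qdev 0 M (s n) = qdev 0 N (r n)"
  shows "qdev 0 M f \<le> qdev 0 N g"
proof (cases "qdev 0 N g")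
  case (real b)
  have *: "qdev 0 M f \<le> ennreal ((1 + t)\<^sup>2 * b)" if t: "0 < t" for t :: real
  proof (rule LIMSEQ_le_const)
    let ?c = "ennreal (1 + t)" and ?d = "ennreal (1 + 1 / t)"
    let ?h = "\<lambda>n. ?c * (?c * qdev 0 N g + ?d * qdev 0 N (\<lambda>x. r n x - g x)) + ?d * qdev 0 M (\<lambda>x. f x - s n x)"
    have "(\<lambda>n. ?h n)
        \<longlonglongrightarrow> ?c * (?c * qdev 0 N g + ?d * 0) + ?d * 0"
      by (intro tendsto_add ennreal_tendsto_cmult lim_s lim_r tendsto_const) simp_all
    also have "?c * (?c * qdev 0 N g + ?d * 0) + ?d * 0 = ennreal ((1 + t)\<^sup>2 * b)"
      using t real by (simp add: power2_eq_square ennreal_mult mult.assoc del: ennreal_plus)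
    finally show "(\<lambda>n. ?h n)
        \<longlonglongrightarrow> ennreal ((1 + t)\<^sup>2 * b)" .
    have "qdev 0 M f \<le> ?h n" for n
    proof -
      have "qdev 0 M (\<lambda>x. s n x + (f x - s n x)) \<le> ?c * qdev 0 M (s n) + ?d * qdev 0 M (\<lambda>x. f x - s n x)"
        using f by (intro qdev_add_le t) auto
      moreover have "qdev 0 N (\<lambda>x. g x + (r n x - g x)) \<le> ?c * qdev 0 N g + ?d * qdev 0 N (\<lambda>x. r n x - g x)"
        using g by (intro qdev_add_le t) auto
      ultimately show ?thesis
        by (simp add: eq del: ennreal_plus) (meson add_right_mono mult_left_mono order_trans zero_le)
    qed
    then show "\<exists>n0. \<forall>n\<ge>n0. qdev 0 M f \<le>
        ?h n"
      by blast
  qed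
  have "(\<lambda>n. ennreal ((1 + inverse (real (Suc n)))\<^sup>2 * b)) \<longlonglongrightarrow> ennreal ((1 + 0)\<^sup>2 * b)"
    by (intro tendsto_ennrealI tendsto_intros LIMSEQ_inverse_real_of_nat)
  then have "qdev 0 M f \<le> ennreal ((1 + 0)\<^sup>2 * b)"
    by (rule LIMSEQ_le_const) (use * in auto)
  then show ?thesis using real by simp
qed simp

lemma L2_inner_add_cmult:
  assumes "f \<in> L2 M" "g \<in> L2 M"
  shows "L2_inner M (\<lambda>x. f x + c * g x) (\<lambda>x. f x + c * g x)
    = L2_inner M f f + cnj c * L2_inner M f g + c * L2_inner M g f + c * cnj c * L2_inner M g g"
proof -
  have "L2_inner M (\<lambda>x. f x + c * g x) (\<lambda>x. f x + c * g x) = (\<integral>x. f x * cnj (f x) + cnj c * (f x * cnj (g x))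
      + c * (g x * cnj (f x)) + c * cnj c * (g x * cnj (g x)) \<partial>M)"
    unfolding L2_inner_def by (intro Bochner_Integration.integral_cong) (simp_all add: algebra_simps)
  also have "\<dots> = L2_inner M f f + cnj c * L2_inner M f g + c * L2_inner M g f + c * cnj c * L2_inner M g g"
    using assms unfolding L2_inner_def
    by (simp add: L2_mult_integrable integrable_mult_right)
  finally show ?thesis .
qed

text \<open>Polarization: \<open>c = 1\<close> yields the sum of the inner product and its
  conjugate, \<open>c = \<i>\<close> their difference.\<close>

lemma L2_inner_eq_if_qdev_eq:
  assumes L2: "f \<in> L2 M" "g \<in> L2 M" "f' \<in> L2 N" "g' \<in> L2 N"
    and eq: "qdev 0 M f = qdev 0 N f'" "qdev 0 M g = qdev 0 N g'"
      "\<And>c. qdev 0 M (\<lambda>x. f x + c * g x) = qdev 0 N (\<lambda>x. f' x + c * g' x)"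
  shows "L2_inner M f g = L2_inner N f' g'"
proof -
  have ff: "L2_inner M f f = L2_inner N f' f'" "L2_inner M g g = L2_inner N g' g'"
    using L2 eq by (simp_all flip: qdev_0_eq_inner)
  have *: "cnj c * L2_inner M f g + c * L2_inner M g f = cnj c * L2_inner N f' g' + c * L2_inner N g' f'" for c
  proof -
    have "L2_inner M (\<lambda>x. f x + c * g x) (\<lambda>x. f x + c * g x) = L2_inner N (\<lambda>x. f' x + c * g' x) (\<lambda>x. f' x + c * g' x)"
      using L2 by (simp add: L2_add L2_cmult eq(3) flip: qdev_0_eq_inner)
    then show ?thesis using L2 ff by (simp add: L2_inner_add_cmult)
  qed
  have "\<i> * (L2_inner M g f - L2_inner M f g) = \<i> * (L2_inner N g' f' - L2_inner N f' g')"
    using *[of \<i>] by (simp add: algebra_simps)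
  then have "L2_inner M g f - L2_inner M f g = L2_inner N g' f' - L2_inner N f' g'" by simp
  moreover have "L2_inner M f g + L2_inner M g f = L2_inner N f' g' + L2_inner N g' f'"
    using *[of 1] by simp
  ultimately have "2 * L2_inner M f g = 2 * L2_inner N f' g'" by (simp add: algebra_simps) algebra
  then show ?thesis by simp
qed

lemma L2_cong: "(\<And>x. x \<in> space M \<Longrightarrow> f x = g x) \<Longrightarrow> f \<in> L2 M \<longleftrightarrow> g \<in> L2 M"
  unfolding L2_def
  by (simp cong: measurable_cong Bochner_Integration.integrable_cong)

lemma orthonormal_basis_L2_cong:
  assumes "\<And>i x. i \<in> I \<Longrightarrow> x \<in> space M \<Longrightarrow> e i x = e' i x"
  shows "orthonormal_basis_L2 M I e \<longleftrightarrow> orthonormal_basis_L2 M I e'"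
proof -
  have "(\<forall>i\<in>I. e i \<in> L2 M) \<longleftrightarrow> (\<forall>i\<in>I. e' i \<in> L2 M)"
    by (intro ball_cong refl L2_cong assms)
  moreover have "L2_inner M (e i) (e k) = L2_inner M (e' i) (e' k)" if "i \<in> I" "k \<in> I" for i k
    unfolding L2_inner_def using that by (intro Bochner_Integration.integral_cong) (simp_all add: assms)
  moreover have N: "L2_norm M (\<lambda>x. f x - (\<Sum>i\<in>F. c i * e i x)) = L2_norm M (\<lambda>x. f x - (\<Sum>i\<in>F. c i * e' i x))"
    if "F \<subseteq> I" for f F c
  proof -
    have "(\<Sum>i\<in>F. c i * e i x) = (\<Sum>i\<in>F. c i * e' i x)" if "x \<in> space M" for x
      using that \<open>F \<subseteq> I\<close> assms by (intro sum.cong refl) auto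
    then show ?thesis
      unfolding L2_norm_def by (intro arg_cong[where f = sqrt] Bochner_Integration.integral_cong) simp_all
  qed
  have "(\<exists>F c. finite F \<and> F \<subseteq> I \<and> L2_norm M (\<lambda>x. f x - (\<Sum>i\<in>F. c i * e i x)) < r) \<longleftrightarrow>
      (\<exists>F c. finite F \<and> F \<subseteq> I \<and> L2_norm M (\<lambda>x. f x - (\<Sum>i\<in>F. c i * e' i x)) < r)" for f r
    by (rule ex_cong1, rule ex_cong1, rule conj_cong[OF refl], rule conj_cong[OF refl], simp only: N)
  ultimately show ?thesis unfolding orthonormal_basis_L2_def by (simp cong: ball_cong del: ex_simps)
qed

lemma appr_reindex:
  assumes "appr d M I e f" "\<And>i. i \<in> I \<Longrightarrow> h i \<in> J \<and> e' (h i) = e i"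
  shows "appr d M J e' f"
proof -
  have "lincomb I e \<subseteq> lincomb J e'"
  proof
    fix s assume "s \<in> lincomb I e"
    then show "s \<in> lincomb J e'"
    proof (induction rule: lincomb_induct)
      case (add i c t)
      then show ?case
        using assms(2)[of i] lincomb_mem[of "h i" J e'] by (auto intro!: lincomb_add lincomb_cmult)
    qed (rule lincomb_zero)
  qed
  then show ?thesis using assms(1) unfolding appr_def by blast
qed

text \<open>Pythagoras: the squared norm of the difference is the sum of the two squared
  norms.\<close>

lemma qdev_le_diff_if_orthogonal:
  assumes "f \<in> L2 M" "g \<in> L2 M" "L2_inner M f g = 0"
  shows "qdev 0 M f \<le> qdev 0 M (\<lambda>x. f x - g x)"
proof -
  have fg: "(\<lambda>x. f x - g x) \<in> L2 M" using assms by (intro L2_diff)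
  have "L2_inner M g f = 0" using assms(3) L2_inner_commute[of M g f] by simp
  then have "L2_inner M (\<lambda>x. f x - g x) (\<lambda>x. f x - g x) = L2_inner M f f + L2_inner M g g"
    using L2_inner_add_cmult[OF assms(1,2), of "-1"] assms(3) by simp
  then have "enn2real (qdev 0 M (\<lambda>x. f x - g x)) = enn2real (qdev 0 M f) + enn2real (qdev 0 M g)"
    using assms fg by (simp flip: qdev_0_eq_inner of_real_add)
  then have "enn2real (qdev 0 M f) \<le> enn2real (qdev 0 M (\<lambda>x. f x - g x))" by simp
  moreover have "qdev 0 M f < top" "qdev 0 M (\<lambda>x. f x - g x) < top"
    using qdev_finite_iff(2)[of f M] qdev_finite_iff(2)[of "\<lambda>x. f x - g x" M] assms fg
    by (simp_all add: L2_def)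
  ultimately show ?thesis by (metis ennreal_enn2real ennreal_leI)
qed

lemma eq_0_if_le_all_ennreal:
  fixes x :: ennreal
  assumes "\<And>e. 0 < e \<Longrightarrow> x \<le> ennreal (c * e)" "0 < c"
  shows "x = 0"
proof (rule ccontr)
  assume "x \<noteq> 0"
  then have "0 < x" by (simp add: zero_less_iff_neq_zero)
  then obtain z where z: "0 < z" "z < x" using dense by blast
  then obtain r where r: "0 < ennreal r" "ennreal r < x" by (cases z) auto
  then have "0 < r / c" using assms(2) by (simp add: ennreal_less_zero_iff)
  from assms(1)[OF this] have "x \<le> ennreal r" using assms(2) by simp
  then show False using r by simp
qed

section \<open>Cylinders and characters\<close>

definition root_pow :: "nat \<Rightarrow> nat \<Rightarrow> complex" where
  "root_pow p n = exp (2 * of_real pi * \<i> / of_nat p * of_nat n)"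

locale vilenkin_group =
  fixes p :: nat
  assumes p_ge2: "2 \<le> p"
begin

abbreviation V :: "(int \<Rightarrow> nat) set" where "V \<equiv> vilenkin p"
abbreviation U :: "(int \<Rightarrow> nat) set" where "U \<equiv> vilenkin_U p"
abbreviation add (infixl "\<oplus>" 65) where "x \<oplus> y \<equiv> oplus p x y"
abbreviation sub (infixl "\<ominus>" 65) where "x \<ominus> y \<equiv> ominus p x y"
abbreviation chi :: "(int \<Rightarrow> nat) \<Rightarrow> (int \<Rightarrow> nat) \<Rightarrow> complex" where "chi \<equiv> pairing p"
abbreviation zero :: "int \<Rightarrow> nat" ("\<zero>") where "\<zero> \<equiv> \<lambda>_. 0"

text \<open>The translate by \<open>a\<close> of the image of \<open>U\<close> under
  \<open>rho_pow (- k)\<close>, described by digits: a basic open set that shrinks as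
  \<open>k\<close> grows. For \<open>a = \<zero>\<close> it is a subgroup.\<close>

definition cyl :: "(int \<Rightarrow> nat) \<Rightarrow> int \<Rightarrow> (int \<Rightarrow> nat) set" where
  "cyl a k = {y \<in> V. \<forall>j\<le>k. y j = a j}"

section \<open>Digitwise arithmetic of the group\<close>

lemma p_pos: "0 < p" using p_ge2 by simp

lemma V_less: "x \<in> V \<Longrightarrow> x j < p"
  by (simp add: vilenkin_def)

lemma V_support: "x \<in> V \<Longrightarrow> \<exists>k. \<forall>j<k. x j = 0"
  by (simp add: vilenkin_def)

lemma V_I: "(\<And>j. x j < p) \<Longrightarrow> \<forall>j<k. x j = 0 \<Longrightarrow> x \<in> V"
  unfolding vilenkin_def by blast

lemma zero_V: "\<zero> \<in> V"
  using p_pos by (simp add: vilenkin_def)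

lemma add_V:
  assumes "x \<in> V" "y \<in> V"
  shows "x \<oplus> y \<in> V"
proof -
  obtain k l where "\<forall>j<k. x j = 0" "\<forall>j<l. y j = 0"
    using assms V_support by meson
  then have "\<forall>j<min k l. (x \<oplus> y) j = 0" by (simp add: oplus_def)
  then show ?thesis by (rule V_I[rotated]) (simp add: oplus_def p_pos)
qed

lemma sub_V:
  assumes "x \<in> V" "y \<in> V"
  shows "x \<ominus> y \<in> V"
proof -
  obtain k l where "\<forall>j<k. x j = 0" "\<forall>j<l. y j = 0"
    using assms V_support by meson
  then have "\<forall>j<min k l. (x \<ominus> y) j = 0" by (simp add: ominus_def)
  then show ?thesis by (rule V_I[rotated]) (simp add: ominus_def p_pos)
qed

lemma rho_V:
  assumes "x \<in> V"
  shows "rho_pow m x \<in> V"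
proof -
  obtain k where "\<forall>j<k. x j = 0" using assms V_support by meson
  then have "\<forall>j<k - m. rho_pow m x j = 0" by (simp add: rho_pow_def)
  moreover have "rho_pow m x j < p" for j using V_less[OF assms] by (simp add: rho_pow_def)
  ultimately show ?thesis unfolding vilenkin_def by blast
qed

lemma sigma_eq_rho: "sigma_pow m = rho_pow (- m)"
  by (simp add: sigma_pow_def rho_pow_def fun_eq_iff)

lemma sigma_V: "x \<in> V \<Longrightarrow> sigma_pow m x \<in> V"
  by (simp add: sigma_eq_rho rho_V)

lemma rho_sigma_apply [simp]: "rho_pow m (sigma_pow m x) = x" "sigma_pow m (rho_pow m x) = x"
  by (simp_all add: rho_pow_def sigma_pow_def)

lemma sub_add_cancel:
  assumes "x \<in> V" "y \<in> V"
  shows "(x \<ominus> y) \<oplus> y = x"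
proof
  fix j
  have "x j + (p - y j) + y j = x j + p" using V_less[OF assms(2), of j] by simp
  then show "((x \<ominus> y) \<oplus> y) j = x j"
    using V_less[OF assms(1), of j] by (simp add: oplus_def ominus_def mod_add_left_eq)
qed

lemma add_sub_cancel:
  assumes "x \<in> V" "y \<in> V"
  shows "(x \<oplus> y) \<ominus> y = x"
proof
  fix j
  have "x j + y j + (p - y j) = x j + p" using V_less[OF assms(2), of j] by simp
  then show "((x \<oplus> y) \<ominus> y) j = x j"
    using V_less[OF assms(1), of j] by (simp add: oplus_def ominus_def mod_add_left_eq)
qed

lemma add_commute: "x \<oplus> y = y \<oplus> x"
  by (simp add: oplus_def add.commute)

lemma add_zero [simp]: "x \<in> V \<Longrightarrow> x \<oplus> \<zero> = x"
  using V_less by (simp add: oplus_def fun_eq_iff)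

lemma sub_digit_zero_iff:
  assumes "x \<in> V" "y \<in> V"
  shows "(x \<ominus> y) j = 0 \<longleftrightarrow> x j = y j"
proof
  assume "(x \<ominus> y) j = 0"
  then have "((x \<ominus> y) \<oplus> y) j = y j" using V_less[OF assms(2), of j] by (simp add: oplus_def)
  then show "x j = y j" by (simp add: sub_add_cancel assms)
next
  assume "x j = y j"
  then show "(x \<ominus> y) j = 0" using V_less[OF assms(2), of j] by (simp add: ominus_def)
qed

subsection \<open>Cylinders\<close>

lemma cyl_subset_V: "cyl a k \<subseteq> V"
  by (auto simp: cyl_def)

lemma cyl_self: "a \<in> V \<Longrightarrow> a \<in> cyl a k"
  by (simp add: cyl_def)

lemma cyl_eq: "b \<in> cyl a k \<Longrightarrow> cyl b k = cyl a k"
  by (auto simp: cyl_def)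

lemma cyl_mono: "k \<le> l \<Longrightarrow> cyl a l \<subseteq> cyl a k"
  by (auto simp: cyl_def)

lemma U_eq_cyl: "U = cyl \<zero> 0"
  by (auto simp: cyl_def vilenkin_U_def)

text \<open>Cylinders behave like balls of an ultrametric: two of them are nested or
  disjoint.\<close>

lemma cyl_Int:
  assumes "k \<le> l"
  shows "cyl a k \<inter> cyl b l = (if \<forall>j\<le>k. a j = b j then cyl b l else {})"
proof (cases "\<forall>j\<le>k. a j = b j")
  case True
  then show ?thesis using assms by (auto simp: cyl_def)
next
  case False
  then obtain j where "j \<le> k" "a j \<noteq> b j" by blast
  then show ?thesis using assms False by (auto simp: cyl_def)
qed

lemma add_cyl:
  assumes "x \<in> V" "a \<in> V"
  shows "(\<lambda>y. y \<oplus> x) ` cyl a k = cyl (a \<oplus> x) k"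
proof (intro equalityI subsetI)
  fix z assume "z \<in> cyl (a \<oplus> x) k"
  then have z: "z \<in> V" "\<forall>j\<le>k. z j = (a \<oplus> x) j" by (auto simp: cyl_def)
  have "(z \<ominus> x) j = a j" if "j \<le> k" for j
  proof -
    have "(z \<ominus> x) j = ((a \<oplus> x) \<ominus> x) j" using z(2) that by (simp add: ominus_def)
    then show ?thesis by (simp add: add_sub_cancel assms)
  qed
  then have "z \<ominus> x \<in> cyl a k" using sub_V[OF z(1) assms(1)] by (simp add: cyl_def)
  then show "z \<in> (\<lambda>y. y \<oplus> x) ` cyl a k"
    using sub_add_cancel[OF z(1) assms(1)] by (metis image_eqI)
next
  fix z assume "z \<in> (\<lambda>y. y \<oplus> x) ` cyl a k"
  then obtain y where "y \<in> cyl a k" "z = y \<oplus> x" by blast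
  then show "z \<in> cyl (a \<oplus> x) k" using assms add_V[of y x] by (simp add: cyl_def) (simp add: oplus_def)
qed

lemma add_vimage_cyl:
  assumes "x \<in> V" "a \<in> V"
  shows "(\<lambda>y. y \<oplus> x) -` cyl a k \<inter> V = cyl (a \<ominus> x) k"
proof (intro equalityI subsetI)
  fix y assume y: "y \<in> (\<lambda>y. y \<oplus> x) -` cyl a k \<inter> V"
  have "y j = (a \<ominus> x) j" if "j \<le> k" for j
  proof -
    have "y j = ((y \<oplus> x) \<ominus> x) j" using y assms by (simp add: add_sub_cancel)
    also have "\<dots> = (a \<ominus> x) j" using y that by (simp add: cyl_def ominus_def)
    finally show ?thesis .
  qed
  then show "y \<in> cyl (a \<ominus> x) k" using y by (simp add: cyl_def)
next
  fix y assume y: "y \<in> cyl (a \<ominus> x) k"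
  have "(y \<oplus> x) j = a j" if "j \<le> k" for j
  proof -
    have "(y \<oplus> x) j = ((a \<ominus> x) \<oplus> x) j" using y that by (simp add: cyl_def oplus_def)
    then show ?thesis by (simp add: sub_add_cancel assms)
  qed
  then show "y \<in> (\<lambda>y. y \<oplus> x) -` cyl a k \<inter> V" using y assms by (auto simp: cyl_def add_V)
qed

lemma rho_vimage_cyl: "rho_pow m -` cyl a k \<inter> V = cyl (sigma_pow m a) (k + m)"
proof -
  have "y \<in> V \<and> rho_pow m y \<in> cyl a k \<longleftrightarrow> y \<in> cyl (sigma_pow m a) (k + m)" for y
  proof -
    have "(\<forall>j\<le>k. y (j + m) = a j) \<longleftrightarrow> (\<forall>j\<le>k + m. y j = a (j - m))"
      by (metis add_le_cancel_right diff_add_cancel add_diff_cancel_right')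
    then show ?thesis unfolding cyl_def using rho_V[of y m]
      by (auto simp: rho_pow_def sigma_pow_def)
  qed
  then show ?thesis by blast
qed

text \<open>The standard representative of a coset of \<open>cyl \<zero> k\<close>. For
  \<open>k = 0\<close> it is the integer part, an element of \<Lambda>.\<close>

definition trunc :: "int \<Rightarrow> (int \<Rightarrow> nat) \<Rightarrow> int \<Rightarrow> nat" where
  "trunc k x = (\<lambda>j. if j \<le> k then x j else 0)"

lemma trunc_V: "x \<in> V \<Longrightarrow> trunc k x \<in> V"
  using p_pos unfolding vilenkin_def trunc_def by fastforce

lemma cyl_trunc: "cyl (trunc k a) k = cyl a k"
  by (auto simp: cyl_def trunc_def)

lemma finite_digits:
  "finite {x :: int \<Rightarrow> nat. (\<forall>j. x j < p) \<and> (\<forall>j. j \<notin> {l..k} \<longrightarrow> x j = 0)}"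
proof (rule finite_subset)
  show "finite {x :: int \<Rightarrow> nat. \<forall>j. (j \<in> {l..k::int} \<longrightarrow> x j \<in> {..<p}) \<and> (j \<notin> {l..k} \<longrightarrow> x j = 0)}"
    by (rule finite_set_of_finite_funs) auto
qed auto

lemma countable_trunc: "countable (trunc k ` V)"
proof (rule countable_subset)
  show "trunc k ` V \<subseteq> (\<Union>l::int. {x. (\<forall>j. x j < p) \<and> (\<forall>j. j \<notin> {l..k} \<longrightarrow> x j = 0)})"
  proof
    fix y assume "y \<in> trunc k ` V"
    then obtain x where x: "x \<in> V" "y = trunc k x" by blast
    obtain l where "\<forall>j<l. x j = 0" using V_support[OF x(1)] by blast
    then show "y \<in> (\<Union>l::int. {x. (\<forall>j. x j < p) \<and> (\<forall>j. j \<notin> {l..k} \<longrightarrow> x j = 0)})"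
      using V_less[OF trunc_V[OF x(1), of k]] x(2) by (auto simp: trunc_def intro!: exI[of _ l])
  qed
  show "countable (\<Union>l::int. {x. (\<forall>j. x j < p) \<and> (\<forall>j. j \<notin> {l..k} \<longrightarrow> x j = 0)})"
    by (rule countable_UN[OF countableI_type], rule countable_finite, rule finite_digits)
qed

lemma Lam_eq_trunc: "Lam p = trunc 0 ` V"
proof
  show "Lam p \<subseteq> trunc 0 ` V"
  proof
    fix x assume "x \<in> Lam p"
    then have "x \<in> V" "x = trunc 0 x" by (auto simp: Lam_def trunc_def fun_eq_iff)
    then show "x \<in> trunc 0 ` V" by blast
  qed
  show "trunc 0 ` V \<subseteq> Lam p" using trunc_V by (auto simp: Lam_def trunc_def)
qed

lemma Lam_V: "n \<in> Lam p \<Longrightarrow> n \<in> V"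
  by (simp add: Lam_def)

lemma Lam_sub: "m \<in> Lam p \<Longrightarrow> n \<in> Lam p \<Longrightarrow> m \<ominus> n \<in> Lam p"
  using sub_V by (auto simp: Lam_def ominus_def)

text \<open>The empty set is added for stability under intersection, as cylinders may be
  disjoint.\<close>

definition cylinders :: "(int \<Rightarrow> nat) set set" where
  "cylinders = insert {} {cyl a k | a k. a \<in> V}"

lemma cyl_mem_cylinders: "a \<in> V \<Longrightarrow> cyl a k \<in> cylinders"
  by (auto simp: cylinders_def)

lemma countable_cylinders: "countable cylinders"
proof -
  have "cylinders \<subseteq> insert {} (\<Union>k. (\<lambda>a. cyl a k) ` trunc k ` V)"
  proof
    fix A assume "A \<in> cylinders"
    then consider "A = {}" | a k where "a \<in> V" "A = cyl a k" by (auto simp: cylinders_def)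
    then show "A \<in> insert {} (\<Union>k. (\<lambda>a. cyl a k) ` trunc k ` V)"
    proof cases
      case 2
      then have "A = cyl (trunc k a) k" by (simp add: cyl_trunc)
      with 2(1) show ?thesis by blast
    qed simp
  qed
  then show ?thesis
    by (rule countable_subset)
      (intro countable_insert countable_UN[OF countableI_type] countable_image countable_trunc)
qed

lemma Int_stable_cylinders: "Int_stable cylinders"
proof -
  have *: "cyl a k \<inter> cyl b l \<in> cylinders" if "a \<in> V" "b \<in> V" for a b k l
  proof (cases "k \<le> l")
    case True
    then show ?thesis using that by (auto simp: cyl_Int cylinders_def)
  next
    case False
    then have "cyl a k \<inter> cyl b l = (if \<forall>j\<le>l. b j = a j then cyl a k else {})"
      using cyl_Int[of l k b a] by (simp add: Int_commute)
    then show ?thesis using that by (auto simp: cylinders_def)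
  qed
  show ?thesis
    unfolding Int_stable_def
  proof (intro ballI)
    fix A B assume "A \<in> cylinders" "B \<in> cylinders"
    then consider "A \<inter> B = {}" | a k b l where "A = cyl a k" "B = cyl b l" "a \<in> V" "b \<in> V"
      by (auto simp: cylinders_def)
    then show "A \<inter> B \<in> cylinders"
      by cases (simp_all only: *, simp add: cylinders_def)
  qed
qed

section \<open>Cylinders as base of the topology and generators of the Borel sets\<close>

lemma translate_rho_U:
  assumes "x \<in> V"
  shows "oplus p x ` rho_pow m ` U = cyl x (- m)"
proof -
  have "rho_pow m ` U = cyl \<zero> (- m)"
  proof -
    have "y \<in> rho_pow m ` U \<longleftrightarrow> y \<in> cyl \<zero> (- m)" for y
    proof
      assume "y \<in> rho_pow m ` U"
      then obtain x where "x \<in> V" "\<forall>j\<le>0. x j = 0" "y = rho_pow m x"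
        by (auto simp: vilenkin_U_def)
      then show "y \<in> cyl \<zero> (- m)" using rho_V[of x m] by (simp add: cyl_def) (simp add: rho_pow_def)
    next
      assume y: "y \<in> cyl \<zero> (- m)"
      then have "sigma_pow m y \<in> U"
        using sigma_V[of y m] by (simp add: cyl_def vilenkin_U_def) (simp add: sigma_pow_def)
      then have "rho_pow m (sigma_pow m y) \<in> rho_pow m ` U" by (rule imageI)
      then show "y \<in> rho_pow m ` U" by (simp only: rho_sigma_apply)
    qed
    then show ?thesis by blast
  qed
  moreover have "oplus p x = (\<lambda>y. y \<oplus> x)" by (rule ext) (rule add_commute)
  moreover have "\<zero> \<oplus> x = x" using add_commute[of x \<zero>] assms by simp
  ultimately show ?thesis
    using add_cyl[OF assms zero_V, of "-m"] by simp
qed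

lemma openin_vilenkin_cyl:
  assumes "openin (vilenkin_topology p) S" "x \<in> S"
  shows "x \<in> V \<and> (\<exists>k. cyl x k \<subseteq> S)"
proof -
  have "generate_topology_on {oplus p x ` rho_pow m ` U | x m. x \<in> V} S"
    using assms(1) by (simp add: vilenkin_topology_def openin_topology_generated_by_iff)
  then show ?thesis using assms(2)
  proof (induction arbitrary: x rule: generate_topology_on.induct)
    case (Int A B)
    then obtain k l where "x \<in> V" "cyl x k \<subseteq> A" "cyl x l \<subseteq> B" by blast
    then have "x \<in> V" "cyl x (max k l) \<subseteq> A \<inter> B"
      using cyl_mono[of k "max k l" x] cyl_mono[of l "max k l" x] by auto
    then show ?case by blast
  next
    case (UN K)
    then obtain A where "A \<in> K" "x \<in> A" by blast
    with UN.IH[OF this] show ?case by blast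
  next
    case (Basis A)
    then obtain a m where "a \<in> V" "A = cyl a (- m)" using translate_rho_U by blast
    with Basis(2) show ?case using cyl_eq[of x a "-m"] cyl_subset_V by blast
  qed simp
qed

lemma openin_cyl: "a \<in> V \<Longrightarrow> openin (vilenkin_topology p) (cyl a k)"
  unfolding vilenkin_topology_def openin_topology_generated_by_iff
  by (rule generate_topology_on.Basis) (use translate_rho_U[of a "-k"] in force)

text \<open>Every open set is the union of the cylinders inside it, and there are only countably
  many cylinders altogether.\<close>

lemma sigma_sets_open_eq:
  "sigma_sets V {S. openin (vilenkin_topology p) S} = sigma_sets V cylinders"
proof (rule sigma_sets_eqI)
  fix S assume "S \<in> {S. openin (vilenkin_topology p) S}"
  then have *: "x \<in> V \<and> (\<exists>k. cyl x k \<subseteq> S)" if "x \<in> S" for x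
    using openin_vilenkin_cyl that by blast
  have "S = \<Union>{A \<in> cylinders. A \<subseteq> S}"
  proof (intro equalityI subsetI)
    fix x assume "x \<in> S"
    with * obtain k where "x \<in> V" "cyl x k \<subseteq> S" by blast
    then show "x \<in> \<Union>{A \<in> cylinders. A \<subseteq> S}"
      using cyl_self cyl_mem_cylinders by blast
  qed auto
  moreover have "\<Union>{A \<in> cylinders. A \<subseteq> S} \<in> sigma_sets V cylinders"
    by (rule sigma_sets_UNION) (use countable_cylinders in \<open>auto intro: countable_subset sigma_sets.Basic\<close>)
  ultimately show "S \<in> sigma_sets V cylinders" by simp
next
  fix A assume "A \<in> cylinders"
  then show "A \<in> sigma_sets V {S. openin (vilenkin_topology p) S}"
    unfolding cylinders_def by (auto intro: openin_cyl)
qed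

subsection \<open>Characters\<close>

lemma root_pow_add: "root_pow p (m + n) = root_pow p m * root_pow p n"
  by (simp add: root_pow_def distrib_left exp_add)

lemma root_pow_mult_p: "root_pow p (p * n) = 1"
proof -
  have "2 * complex_of_real pi * \<i> / of_nat p * of_nat (p * n) = \<i> * (of_real (real_of_int (int n) * 2 * pi))"
    using p_pos by simp
  then show ?thesis unfolding root_pow_def exp_eq_1 by (auto intro!: exI[of _ "int n"])
qed

lemma root_pow_mod: "root_pow p (n mod p) = root_pow p n"
proof -
  have "root_pow p n = root_pow p (p * (n div p) + n mod p)" by simp
  then show ?thesis unfolding root_pow_add root_pow_mult_p by simp
qed

lemma norm_root_pow: "cmod (root_pow p n) = 1"
proof -
  have "2 * complex_of_real pi * \<i> / of_nat p * of_nat n = \<i> * of_real (2 * pi / p * n)" by simp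
  then show ?thesis unfolding root_pow_def by (simp only: norm_exp_i_times)
qed

lemma root_pow_neq_1:
  assumes "0 < n" "n < p"
  shows "root_pow p n \<noteq> 1"
proof
  have eq: "2 * complex_of_real pi * \<i> / of_nat p * of_nat n = \<i> * of_real (2 * pi / p * n)" by simp
  assume "root_pow p n = 1"
  then obtain m :: int where "2 * pi / p * n = of_int (2 * m) * pi"
    unfolding root_pow_def eq exp_eq_1 by auto
  then have "real n = of_int m * real p" using p_pos by (simp add: field_simps)
  then have "of_int (int n) = (of_int (m * int p) :: real)" by simp
  then have "int n = m * int p" by (simp only: of_int_eq_iff)
  then have "int p dvd int n" by simp
  then have "p dvd n" by simp
  then show False using assms by (auto dest: dvd_imp_le)
qed

text \<open>Any finite index set containing the support is allowed, so that several pairings can be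
  expanded over a common one.\<close>

lemma pairing_eq_prod:
  assumes "finite J" "\<And>j. j \<notin> J \<Longrightarrow> x j * w (1 - j) = 0"
  shows "chi x w = (\<Prod>j\<in>J. root_pow p (x j * w (1 - j)))"
proof -
  have *: "root_pow p (\<Sum>j\<in>J. f j) = (\<Prod>j\<in>J. root_pow p (f j))" for f
    using assms(1) by induction (simp_all add: root_pow_add, simp add: root_pow_def)
  have "(\<Sum>j | x j * w (1 - j) \<noteq> 0. x j * w (1 - j)) = (\<Sum>j\<in>J. x j * w (1 - j))"
  proof (rule sum.mono_neutral_left)
    show "{j. x j * w (1 - j) \<noteq> 0} \<subseteq> J"
    proof
      fix j assume "j \<in> {j. x j * w (1 - j) \<noteq> 0}"
      then show "j \<in> J" using assms(2)[of j] by (cases "j \<in> J") simp_all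
    qed
  qed (use assms(1) in auto)
  then have "chi x w = root_pow p (\<Sum>j\<in>J. x j * w (1 - j))"
    by (simp only: pairing_def root_pow_def)
  then show ?thesis by (simp only: *)
qed

lemma pairing_add_left:
  assumes x: "x \<in> V" "y \<in> V" and w: "w \<in> V"
  shows "chi (x \<oplus> y) w = chi x w * chi y w"
proof -
  obtain a b c where a: "\<forall>j<a. x j = 0" "\<forall>j<b. y j = 0" "\<forall>j<c. w j = 0"
    using x w V_support by meson
  \<comment> \<open>To the left of \<open>min a b\<close> the digits of \<open>x\<close> and
    \<open>y\<close> vanish; for \<open>j > 1 - c\<close> the index \<open>1 - j\<close> lies below
    \<open>c\<close>, where \<open>w\<close> vanishes.\<close>
  define J where "J = {min a b..1 - c}"
  have J: "finite J" by (simp add: J_def)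
  have "w (1 - j) = 0 \<or> (x j = 0 \<and> y j = 0)" if "j \<notin> J" for j
    using that a unfolding J_def by auto
  then have *: "x j * w (1 - j) = 0" "y j * w (1 - j) = 0" "(x \<oplus> y) j * w (1 - j) = 0"
    if "j \<notin> J" for j
    using that by (auto simp: oplus_def dest!: meta_spec[of _ j])
  have "root_pow p ((x \<oplus> y) j * w (1 - j)) = root_pow p (x j * w (1 - j)) * root_pow p (y j * w (1 - j))" for j
  proof -
    have "root_pow p ((x \<oplus> y) j * w (1 - j)) = root_pow p ((x j + y j) * w (1 - j))"
      by (subst (1 2) root_pow_mod[symmetric]) (simp add: oplus_def mod_mult_left_eq)
    then show ?thesis by (simp add: distrib_right root_pow_add)
  qed
  then show ?thesis
    using J * by (simp add: pairing_eq_prod[of J] prod.distrib)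
qed

lemma pairing_commute: "chi x w = chi w x"
proof -
  have "(\<Sum>j | x j * w (1 - j) \<noteq> 0. x j * w (1 - j)) = (\<Sum>j | w j * x (1 - j) \<noteq> 0. w j * x (1 - j))"
    by (rule sum.reindex_bij_witness[of _ "\<lambda>j. 1 - j" "\<lambda>j. 1 - j"]) (auto simp: mult.commute)
  then show ?thesis by (simp add: pairing_def)
qed

lemma norm_pairing [simp]: "cmod (chi x w) = 1"
  using norm_root_pow unfolding pairing_def root_pow_def by blast

lemma pairing_mult_cnj [simp]: "chi x w * cnj (chi x w) = 1" "cnj (chi x w) * chi x w = 1"
  using complex_norm_square[of "chi x w"] by (simp_all add: mult.commute)

lemma pairing_sub_left:
  assumes "x \<in> V" "y \<in> V" "w \<in> V"
  shows "chi (x \<ominus> y) w = chi x w * cnj (chi y w)"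
proof -
  have "chi x w = chi (x \<ominus> y) w * chi y w"
    using pairing_add_left[OF sub_V[OF assms(1,2)] assms(2,3)] assms by (simp add: sub_add_cancel)
  then show ?thesis by (simp add: mult.assoc)
qed

lemma pairing_add_right: "x \<in> V \<Longrightarrow> w \<in> V \<Longrightarrow> v \<in> V \<Longrightarrow> chi x (w \<oplus> v) = chi x w * chi x v"
  using pairing_add_left pairing_commute by metis

lemma pairing_sub_right: "x \<in> V \<Longrightarrow> w \<in> V \<Longrightarrow> v \<in> V \<Longrightarrow> chi x (w \<ominus> v) = chi x w * cnj (chi x v)"
  using pairing_sub_left pairing_commute by metis

lemma pairing_eq_1: "(\<And>j. x j * w (1 - j) = 0) \<Longrightarrow> chi x w = 1"
  by (subst pairing_eq_prod[of "{}"]) auto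

lemma pairing_zero [simp]: "chi \<zero> w = 1" "chi x \<zero> = 1"
  by (simp_all add: pairing_eq_1)

text \<open>Only indices \<open>j > - k\<close> carry digits of \<open>x\<close>, and these meet
  digits of the second argument at positions \<open>1 - j \<le> k\<close>. In particular
  \<open>cyl \<zero> (- k)\<close> annihilates \<open>cyl \<zero> k\<close>.\<close>

lemma pairing_cong_cyl:
  assumes "x \<in> cyl \<zero> (- k)" "w' \<in> cyl w k"
  shows "chi x w' = chi x w"
proof -
  have "x j * w' (1 - j) = x j * w (1 - j)" for j
    using assms by (cases "j \<le> - k") (auto simp: cyl_def)
  then show ?thesis by (simp only: pairing_def)
qed

lemma pairing_Lam_Lam: "m \<in> Lam p \<Longrightarrow> n \<in> Lam p \<Longrightarrow> chi m n = 1"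
proof (rule pairing_eq_1)
  fix j assume "m \<in> Lam p" "n \<in> Lam p"
  then show "m j * n (1 - j) = 0" by (cases "j > 0") (auto simp: Lam_def)
qed

text \<open>A shift of the summation index. The reflection of indices in the pairing makes each
  shift its own adjoint, where an unreflected sum would give the inverse shift.\<close>

lemma pairing_rho: "chi (rho_pow k x) w = chi x (rho_pow k w)"
proof -
  have "(\<Sum>j | x (j + k) * w (1 - j) \<noteq> 0. x (j + k) * w (1 - j))
      = (\<Sum>j | x j * w (1 - j + k) \<noteq> 0. x j * w (1 - j + k))"
    by (rule sum.reindex_bij_witness[of _ "\<lambda>j. j - k" "\<lambda>j. j + k"]) (auto simp: algebra_simps)
  then show ?thesis by (simp only: pairing_def rho_pow_def)
qed

text \<open>A single digit 1 opposite a nonzero digit of \<open>x\<close> isolates that digit as a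
  nontrivial root of unity. Hence the annihilator of \<open>cyl \<zero> k\<close> is exactly
  \<open>cyl \<zero> (- k)\<close>.\<close>

lemma pairing_nontrivial:
  assumes "x \<in> V" "x \<notin> cyl \<zero> (- k)"
  obtains v where "v \<in> cyl \<zero> k" "chi x v \<noteq> 1"
proof -
  obtain j where j: "j \<le> - k" "x j \<noteq> 0" using assms by (auto simp: cyl_def)
  define v where "v = (\<lambda>i::int. if i = 1 - j then 1 else 0 :: nat)"
  have "v \<in> V" using p_ge2 unfolding vilenkin_def v_def by (auto intro!: exI[of _ "1 - j"])
  then have "v \<in> cyl \<zero> k" using j by (auto simp: cyl_def v_def)
  moreover have "chi x v = root_pow p (x j)"
    by (subst pairing_eq_prod[of "{j}"]) (auto simp: v_def)
  then have "chi x v \<noteq> 1" using root_pow_neq_1[of "x j"] V_less[OF assms(1), of j] j by simp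
  ultimately show ?thesis by (rule that)
qed

end

section \<open>Haar measure\<close>

locale vilenkin_haar = vilenkin_group +
  fixes M :: "(int \<Rightarrow> nat) measure"
  assumes haar: "normalized_haar p M"
begin

section \<open>Measurability through cylinders\<close>

lemma space_M: "space M = V"
  using haar by (simp add: normalized_haar_def)

lemma sets_M: "sets M = sigma_sets V cylinders"
  using haar by (simp add: normalized_haar_def sigma_sets_open_eq)

lemma cylinders_subset: "cylinders \<subseteq> Pow V"
  using cyl_subset_V by (auto simp: cylinders_def)

lemma sets_cylinders: "A \<in> cylinders \<Longrightarrow> A \<in> sets M"
  by (simp add: sets_M)

lemma sets_cyl: "a \<in> V \<Longrightarrow> cyl a k \<in> sets M"
  by (simp add: sets_cylinders cyl_mem_cylinders)

lemma sets_U: "U \<in> sets M"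
  by (simp add: U_eq_cyl sets_cyl zero_V)

lemma sets_subset_V: "A \<in> sets M \<Longrightarrow> A \<subseteq> V"
  using sets.sets_into_space space_M by blast

text \<open>Such a set is a union of cylinders of one depth, and only countably many cylinders
  exist.\<close>

lemma sets_cyl_invariant:
  assumes "A \<subseteq> V" "\<And>x. x \<in> A \<Longrightarrow> cyl x k \<subseteq> A"
  shows "A \<in> sets M"
proof -
  have "A = \<Union>((\<lambda>x. cyl x k) ` A)"
    using assms cyl_self by blast
  moreover have "countable ((\<lambda>x. cyl x k) ` A)"
    by (rule countable_subset[OF _ countable_cylinders]) (use assms cyl_mem_cylinders in blast)
  moreover have "(\<lambda>x. cyl x k) ` A \<subseteq> sets M"
    using assms sets_cyl by blast
  ultimately show ?thesis
    using sets.countable_Union by metis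
qed

lemma measurable_cyl_invariant:
  assumes "\<And>x. x \<in> V \<Longrightarrow> f x \<in> space N" "\<And>x y. x \<in> V \<Longrightarrow> y \<in> cyl x k \<Longrightarrow> f y = f x"
  shows "f \<in> measurable M N"
proof (rule measurableI)
  fix A assume "A \<in> sets N"
  show "f -` A \<inter> space M \<in> sets M"
  proof (rule sets_cyl_invariant)
    fix x assume x: "x \<in> f -` A \<inter> space M"
    show "cyl x k \<subseteq> f -` A \<inter> space M"
    proof
      fix y assume y: "y \<in> cyl x k"
      then have "f y = f x" using assms(2) x space_M by blast
      then show "y \<in> f -` A \<inter> space M" using x y cyl_subset_V space_M by auto
    qed
  qed (simp add: space_M)
qed (simp add: assms space_M)

lemma measurable_pairing [measurable]:
  assumes "x \<in> V"
  shows "chi x \<in> borel_measurable M" "(\<lambda>w. chi w x) \<in> borel_measurable M"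
proof -
  obtain k where k: "\<forall>j<k. x j = 0" using V_support[OF assms] by blast
  show "chi x \<in> borel_measurable M"
  proof (rule measurable_cyl_invariant)
    \<comment> \<open>Depth \<open>1 - k\<close> suffices: \<open>x\<close> vanishes below
      \<open>k\<close>, that is, up to position \<open>- (1 - k)\<close>.\<close>
    fix w v assume "w \<in> V" "v \<in> cyl w (1 - k)"
    then show "chi x v = chi x w"
      by (intro pairing_cong_cyl[of x "1 - k"]) (use k assms in \<open>auto simp: cyl_def\<close>)
  qed simp
  then show "(\<lambda>w. chi w x) \<in> borel_measurable M"
    by (simp add: pairing_commute[of _ x])
qed

section \<open>The measure of cylinders and uniqueness\<close>

lemma emeasure_cyl_translate:
  assumes "a \<in> V"
  shows "emeasure M (cyl a k) = emeasure M (cyl \<zero> k)"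
proof -
  have "oplus p a = (\<lambda>y. y \<oplus> a)" by (rule ext) (rule add_commute)
  moreover have "\<zero> \<oplus> a = a" using add_commute[of a \<zero>] assms by simp
  ultimately have "oplus p a ` cyl \<zero> k = cyl a k"
    using add_cyl[OF assms zero_V, of k] by simp
  then show ?thesis
    using haar assms sets_cyl[OF zero_V, of k] unfolding normalized_haar_def by metis
qed

text \<open>The digit at position \<open>k + 1\<close> splits the cylinder into \<open>p\<close>
  translates of the next smaller one.\<close>

lemma emeasure_cyl_Suc: "emeasure M (cyl \<zero> k) = of_nat p * emeasure M (cyl \<zero> (k + 1))"
proof -
  define b where "b d = (\<lambda>j. if j = k + 1 then d else 0 :: nat)" for d
  have bV: "b d \<in> V" if "d < p" for d
    using that p_pos by (intro V_I[of _ "k + 1"]) (auto simp: b_def)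
  have "cyl \<zero> k = (\<Union>d\<in>{..<p}. cyl (b d) (k + 1))"
  proof (intro equalityI subsetI)
    fix y assume y: "y \<in> cyl \<zero> k"
    then have yV: "y \<in> V" using cyl_subset_V by blast
    have "y \<in> cyl (b (y (k + 1))) (k + 1)"
      using y unfolding cyl_def b_def by auto
    then show "y \<in> (\<Union>d\<in>{..<p}. cyl (b d) (k + 1))" using V_less[OF yV] by blast
  next
    fix y assume "y \<in> (\<Union>d\<in>{..<p}. cyl (b d) (k + 1))"
    then obtain d where "y \<in> cyl (b d) (k + 1)" by blast
    then show "y \<in> cyl \<zero> k" by (auto simp: cyl_def b_def)
  qed
  moreover have "emeasure M (\<Union>d\<in>{..<p}. cyl (b d) (k + 1)) = (\<Sum>d<p. emeasure M (cyl (b d) (k + 1)))"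
  proof (rule sum_emeasure[symmetric])
    show "disjoint_family_on (\<lambda>d. cyl (b d) (k + 1)) {..<p}"
      unfolding disjoint_family_on_def
    proof (intro ballI impI)
      fix d e :: nat assume "d \<noteq> e"
      then have "\<not> (\<forall>j\<le>k + 1. b d j = b e j)" by (auto simp: b_def)
      then show "cyl (b d) (k + 1) \<inter> cyl (b e) (k + 1) = {}"
        by (subst cyl_Int) auto
    qed
  qed (use bV sets_cyl in auto)
  moreover have "(\<Sum>d<p. emeasure M (cyl (b d) (k + 1))) = (\<Sum>d<p. emeasure M (cyl \<zero> (k + 1)))"
    by (intro sum.cong refl emeasure_cyl_translate bV) simp
  ultimately show ?thesis by simp
qed

lemma emeasure_cyl:
  assumes "a \<in> V"
  shows "emeasure M (cyl a k) = ennreal (real p powi (- k))"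
proof -
  have "emeasure M (cyl \<zero> k) = ennreal (real p powi (- k))"
  proof (induction k rule: int_induct[where k = 0])
    case base
    then show ?case using haar by (simp add: normalized_haar_def U_eq_cyl)
  next
    case (step1 i)
    let ?e = "emeasure M (cyl \<zero> (i + 1))"
    have eq: "of_nat p * ?e = ennreal (real p powi (- i))" using step1(2) emeasure_cyl_Suc[of i] by simp
    \<comment> \<open>The division by \<open>p\<close> is carried out in the reals, so infinity is
      excluded first.\<close>
    have "?e \<noteq> top"
    proof
      assume "?e = top"
      then have "of_nat p * top = ennreal (real p powi (- i))" using eq by (simp only:)
      then show False using p_pos by (simp add: ennreal_mult_top)
    qed
    then obtain r where r: "0 \<le> r" "?e = ennreal r" by (metis ennreal_cases)
    then have "ennreal (real p * r) = ennreal (real p powi (- i))"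
      using eq by (simp add: ennreal_mult ennreal_of_nat_eq_real_of_nat)
    then have "real p * r = real p powi (- i)" using r by (subst (asm) ennreal_inj) auto
    then have "r = real p powi (- i) / real p" using p_pos by (simp add: field_simps)
    also have "\<dots> = real p powi (- i - 1)" using p_pos by (simp add: power_int_diff)
    also have "- i - 1 = - (i + 1)" by simp
    finally show ?case using r by (simp only:)
  next
    case (step2 i)
    have "real p * real p powi (- i) = real p powi (- (i - 1))"
      using p_pos power_int_add[of "real p" 1 "- i"] by (simp add: algebra_simps)
    then show ?case using step2 emeasure_cyl_Suc[of "i - 1"]
      by (simp add: ennreal_mult[symmetric] ennreal_of_nat_eq_real_of_nat)
  qed
  then show ?thesis by (simp add: emeasure_cyl_translate[OF assms])
qed

lemma emeasure_U: "emeasure M U = 1"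
  using haar by (simp add: normalized_haar_def)

lemma emeasure_cyl_finite: "a \<in> V \<Longrightarrow> emeasure M (cyl a k) < \<infinity>"
  by (simp add: emeasure_cyl)

lemma measure_cyl: "a \<in> V \<Longrightarrow> measure M (cyl a k) = real p powi (- k)"
  by (simp add: measure_def emeasure_cyl)

lemma V_eq_UN_cyl: "V = (\<Union>n. cyl \<zero> (- int n))"
proof (intro equalityI subsetI)
  fix x assume x: "x \<in> V"
  obtain k where "\<forall>j<k. x j = 0" using V_support[OF x] by blast
  then have "x \<in> cyl \<zero> (- int (nat (1 - k)))" using x by (auto simp: cyl_def)
  then show "x \<in> (\<Union>n. cyl \<zero> (- int n))" by blast
qed (auto simp: cyl_def)

text \<open>Uniqueness on an intersection-stable generator, with the growing cylinders
  \<open>cyl \<zero> (- int n)\<close> as exhaustion by sets of finite measure. The constant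
  \<open>c\<close> is 1 for uniqueness and translation invariance, and a power of \<open>p\<close>
  for shifts.\<close>

lemma eq_density_if_eq_on_cyl:
  assumes N: "sets N = sets M"
    and eq: "\<And>a k. a \<in> V \<Longrightarrow> emeasure N (cyl a k) = ennreal c * emeasure M (cyl a k)"
  shows "N = density M (\<lambda>_. ennreal c)"
proof (rule measure_eqI_generator_eq[OF Int_stable_cylinders cylinders_subset])
  show "sets N = sigma_sets V cylinders" "sets (density M (\<lambda>_. ennreal c)) = sigma_sets V cylinders"
    using N sets_M by auto
  show "emeasure N A = emeasure (density M (\<lambda>_. ennreal c)) A" if "A \<in> cylinders" for A
    using that eq sets_cyl unfolding cylinders_def by (auto simp: emeasure_density_const)
  show "range (\<lambda>n. cyl \<zero> (- int n)) \<subseteq> cylinders" using cyl_mem_cylinders[OF zero_V] by blast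
  show "(\<Union>n. cyl \<zero> (- int n)) = V" by (rule V_eq_UN_cyl[symmetric])
  show "emeasure N (cyl \<zero> (- int n)) \<noteq> \<infinity>" for n
    using eq[OF zero_V] emeasure_cyl_finite[OF zero_V, of "- int n"]
    by (simp add: ennreal_mult_eq_top_iff)
qed

text \<open>Invariance and normalization fix the value on each cylinder. As the group and its dual
  are modelled by the same sequences, this identifies the two measures of the theorem, and a single
  one serves throughout.\<close>

lemma haar_unique:
  assumes "normalized_haar p N"
  shows "N = M"
proof -
  interpret N: vilenkin_haar p N by unfold_locales fact
  have "N = density M (\<lambda>_. ennreal 1)"
    by (rule eq_density_if_eq_on_cyl) (simp_all add: N.sets_M sets_M N.emeasure_cyl emeasure_cyl)
  then show ?thesis by (simp add: density_1)
qed

section \<open>The measure under translations and shifts\<close>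

lemma measurable_from_cyl:
  assumes "\<And>x. x \<in> V \<Longrightarrow> f x \<in> V" "\<And>a k. a \<in> V \<Longrightarrow> f -` cyl a k \<inter> V \<in> sets M"
  shows "f \<in> measurable M M"
proof (rule measurable_sigma_sets[OF sets_M])
  show "f -` A \<inter> space M \<in> sets M" if "A \<in> cylinders" for A
    using that assms(2) by (auto simp: space_M cylinders_def)
qed (use assms(1) cylinders_subset in \<open>auto simp: space_M\<close>)

lemma measurable_add [measurable]:
  assumes "x \<in> V"
  shows "(\<lambda>w. w \<oplus> x) \<in> measurable M M"
  by (rule measurable_from_cyl)
     (use assms in \<open>auto simp: add_vimage_cyl intro!: sets_cyl sub_V add_V\<close>)

lemma measurable_rho [measurable]: "rho_pow m \<in> measurable M M"
  by (rule measurable_from_cyl) (auto simp: rho_vimage_cyl intro!: sets_cyl rho_V sigma_V)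

lemma measurable_sigma [measurable]: "sigma_pow m \<in> measurable M M"
  by (simp add: sigma_eq_rho)

lemma distr_add:
  assumes "x \<in> V"
  shows "distr M M (\<lambda>w. w \<oplus> x) = M"
proof -
  have "distr M M (\<lambda>w. w \<oplus> x) = density M (\<lambda>_. ennreal 1)"
  proof (rule eq_density_if_eq_on_cyl)
    fix a k assume a: "a \<in> V"
    have "emeasure (distr M M (\<lambda>w. w \<oplus> x)) (cyl a k) = emeasure M ((\<lambda>w. w \<oplus> x) -` cyl a k \<inter> space M)"
      by (rule emeasure_distr) (simp_all add: measurable_add assms sets_cyl a)
    also have "\<dots> = emeasure M (cyl a k)"
      by (simp add: space_M add_vimage_cyl assms a emeasure_cyl sub_V)
    finally show "emeasure (distr M M (\<lambda>w. w \<oplus> x)) (cyl a k) = ennreal 1 * emeasure M (cyl a k)"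
      by simp
  qed simp
  then show ?thesis by (simp add: density_1)
qed

lemma distr_rho: "distr M M (rho_pow m) = density M (\<lambda>_. ennreal (real p powi (- m)))"
proof (rule eq_density_if_eq_on_cyl)
  fix a k assume a: "a \<in> V"
  have "emeasure (distr M M (rho_pow m)) (cyl a k) = emeasure M (rho_pow m -` cyl a k \<inter> space M)"
    by (rule emeasure_distr) (simp_all add: measurable_rho sets_cyl a)
  also have "\<dots> = ennreal (real p powi (- (k + m)))"
    by (simp only: space_M rho_vimage_cyl emeasure_cyl[OF sigma_V[OF a]])
  also have "real p powi (- (k + m)) = real p powi (- m) * real p powi (- k)"
    using p_pos power_int_add[of "real p" "- m" "- k"] by (simp add: add.commute)
  also have "ennreal \<dots> = ennreal (real p powi (- m)) * emeasure M (cyl a k)"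
    by (simp add: emeasure_cyl a ennreal_mult)
  finally show "emeasure (distr M M (rho_pow m)) (cyl a k)
    = ennreal (real p powi (- m)) * emeasure M (cyl a k)" .
qed simp

lemma integral_add:
  fixes f :: "(int \<Rightarrow> nat) \<Rightarrow> complex"
  assumes "x \<in> V" "f \<in> borel_measurable M"
  shows "(\<integral>w. f (w \<oplus> x) \<partial>M) = (\<integral>w. f w \<partial>M)"
  using integral_distr[OF measurable_add[OF assms(1)] assms(2)] by (simp add: distr_add assms)

lemma nn_integral_rho:
  assumes "f \<in> borel_measurable M"
  shows "(\<integral>\<^sup>+w. f (rho_pow m w) \<partial>M) = ennreal (real p powi (- m)) * (\<integral>\<^sup>+w. f w \<partial>M)"
  using nn_integral_distr[OF measurable_rho[of m], of f] assms
  by (simp add: distr_rho nn_integral_density nn_integral_cmult)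

lemma integral_rho:
  fixes f :: "(int \<Rightarrow> nat) \<Rightarrow> complex"
  assumes "f \<in> borel_measurable M"
  shows "(\<integral>w. f (rho_pow m w) \<partial>M) = of_real (real p powi (- m)) * (\<integral>w. f w \<partial>M)"
proof -
  have "(\<integral>w. f (rho_pow m w) \<partial>M) = (\<integral>w. f w \<partial>distr M M (rho_pow m))"
    by (rule integral_distr[OF measurable_rho assms, symmetric])
  also have "\<dots> = (\<integral>w. (real p powi (- m)) *\<^sub>R f w \<partial>M)"
    unfolding distr_rho by (rule integral_density) (use assms in auto)
  finally show ?thesis by (simp add: scaleR_conv_of_real)
qed

lemma emeasure_vimage_add:
  assumes "x \<in> V" "A \<in> sets M"
  shows "emeasure M ((\<lambda>w. w \<oplus> x) -` A \<inter> V) = emeasure M A"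
  using emeasure_distr[OF measurable_add[OF assms(1)] assms(2)] assms
  by (simp add: distr_add space_M)

lemma sub_image_eq:
  assumes "x \<in> V" "A \<subseteq> V"
  shows "(\<lambda>w. w \<ominus> x) ` A = (\<lambda>w. w \<oplus> x) -` A \<inter> V"
proof (intro equalityI subsetI)
  fix y assume y: "y \<in> (\<lambda>w. w \<oplus> x) -` A \<inter> V"
  then have "y = (y \<oplus> x) \<ominus> x" using add_sub_cancel assms by simp
  then show "y \<in> (\<lambda>w. w \<ominus> x) ` A" using y by blast
next
  fix y assume "y \<in> (\<lambda>w. w \<ominus> x) ` A"
  then obtain w where "w \<in> A" "y = w \<ominus> x" by blast
  then show "y \<in> (\<lambda>w. w \<oplus> x) -` A \<inter> V"
    using sub_add_cancel[of w x] sub_V[of w x] assms by auto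
qed

lemma sets_sub_image:
  assumes "x \<in> V" "A \<in> sets M"
  shows "(\<lambda>w. w \<ominus> x) ` A \<in> sets M" "emeasure M ((\<lambda>w. w \<ominus> x) ` A) = emeasure M A"
proof -
  note eq = sub_image_eq[OF assms(1) sets_subset_V[OF assms(2)]]
  show "(\<lambda>w. w \<ominus> x) ` A \<in> sets M"
    using measurable_sets[OF measurable_add[OF assms(1)] assms(2)] by (simp add: eq space_M)
  show "emeasure M ((\<lambda>w. w \<ominus> x) ` A) = emeasure M A"
    by (simp add: eq emeasure_vimage_add assms)
qed

lemma sigma_image_eq:
  assumes "A \<subseteq> V"
  shows "sigma_pow m ` A = rho_pow m -` A \<inter> V"
proof (intro equalityI subsetI)
  fix y assume y: "y \<in> rho_pow m -` A \<inter> V"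
  then have "sigma_pow m (rho_pow m y) \<in> sigma_pow m ` A" by blast
  then show "y \<in> sigma_pow m ` A" by simp
next
  fix y assume "y \<in> sigma_pow m ` A"
  then show "y \<in> rho_pow m -` A \<inter> V" using assms sigma_V by auto
qed

lemma sets_sigma_image:
  assumes "A \<in> sets M"
  shows "sigma_pow m ` A \<in> sets M"
    "emeasure M (sigma_pow m ` A) = ennreal (real p powi (- m)) * emeasure M A"
proof -
  note eq = sigma_image_eq[OF sets_subset_V[OF assms]]
  show "sigma_pow m ` A \<in> sets M"
    using measurable_sets[OF measurable_rho assms] by (simp add: eq space_M)
  have "emeasure M (rho_pow m -` A \<inter> V) = emeasure (distr M M (rho_pow m)) A"
    using emeasure_distr[OF measurable_rho assms] by (simp add: space_M)
  then show "emeasure M (sigma_pow m ` A) = ennreal (real p powi (- m)) * emeasure M A"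
    by (simp add: eq distr_rho emeasure_density_const assms)
qed

text \<open>Either the character is trivial on the subgroup \<open>cyl \<zero> k\<close>, or some
  translation inside the subgroup multiplies the integral by a number other than 1 while leaving it
  unchanged.\<close>

lemma integral_pairing_cyl_zero:
  assumes "x \<in> V"
  shows "(\<integral>w. indicator (cyl \<zero> k) w * chi x w \<partial>M)
    = (if x \<in> cyl \<zero> (- k) then of_real (real p powi (- k)) else 0)"
proof (cases "x \<in> cyl \<zero> (- k)")
  case True
  have "indicator (cyl \<zero> k) w * chi x w = indicator (cyl \<zero> k) w" for w
    using pairing_cong_cyl[OF True, of w \<zero>] by (auto simp: indicator_def)
  then have "(\<integral>w. indicator (cyl \<zero> k) w * chi x w \<partial>M) = (\<integral>w. indicator (cyl \<zero> k) w \<partial>M)"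
    by (simp only:)
  also have "\<dots> = of_real (measure M (cyl \<zero> k))"
    by (rule integral_indicator_complex[OF sets_cyl emeasure_cyl_finite]) (rule zero_V)+
  finally show ?thesis using True by (simp add: measure_cyl zero_V)
next
  case False
  then obtain v where v: "v \<in> cyl \<zero> k" "chi x v \<noteq> 1" using pairing_nontrivial assms by blast
  then have vV: "v \<in> V" using cyl_subset_V by blast
  define f where "f w = indicator (cyl \<zero> k) w * chi x w" for w
  have [measurable]: "f \<in> borel_measurable M"
    unfolding f_def using sets_cyl[OF zero_V, of k] assms by measurable
  have "f (w \<oplus> v) = chi x v * f w" if "w \<in> V" for w
  proof -
    have "w \<oplus> v \<in> cyl \<zero> k \<longleftrightarrow> w \<in> cyl \<zero> k"
    proof -
      have "v \<ominus> v = \<zero>" using sub_digit_zero_iff[OF vV vV] by blast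
      moreover have "w \<in> (\<lambda>y. y \<oplus> v) -` cyl \<zero> k \<inter> V \<longleftrightarrow> w \<in> cyl (v \<ominus> v) k"
        using add_vimage_cyl[OF vV vV, of k] cyl_eq[OF v(1)] by simp
      ultimately show ?thesis using that by simp
    qed
    then show ?thesis
      using assms that vV by (simp add: f_def pairing_add_right indicator_def)
  qed
  then have "(\<integral>w. f (w \<oplus> v) \<partial>M) = (\<integral>w. chi x v * f w \<partial>M)"
    by (intro Bochner_Integration.integral_cong) (auto simp: space_M)
  then have "(\<integral>w. f w \<partial>M) = chi x v * (\<integral>w. f w \<partial>M)"
    using integral_add[OF vV, of f] by simp
  then have "(\<integral>w. f w \<partial>M) = 0" using v(2) by simp
  then show ?thesis using False by (simp add: f_def)
qed

lemma integral_pairing_cyl: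
  assumes "x \<in> V" "a \<in> V"
  shows "(\<integral>w. indicator (cyl a k) w * chi x w \<partial>M)
    = (if x \<in> cyl \<zero> (- k) then of_real (real p powi (- k)) * chi x a else 0)"
proof -
  define f where "f w = indicator (cyl a k) w * chi x w" for w
  have [measurable]: "f \<in> borel_measurable M"
    unfolding f_def using sets_cyl[OF assms(2), of k] assms by measurable
  have "f (w \<oplus> a) = chi x a * (indicator (cyl \<zero> k) w * chi x w)" if "w \<in> V" for w
  proof -
    have "a \<ominus> a = \<zero>" using sub_digit_zero_iff[OF assms(2,2)] by blast
    then have "w \<oplus> a \<in> cyl a k \<longleftrightarrow> w \<in> cyl \<zero> k"
      using add_vimage_cyl[OF assms(2,2), of k] that by (metis IntI IntD1 vimage_eq)
    then show ?thesis
      using assms that by (simp add: f_def pairing_add_right indicator_def)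
  qed
  then have "(\<integral>w. f (w \<oplus> a) \<partial>M) = (\<integral>w. chi x a * (indicator (cyl \<zero> k) w * chi x w) \<partial>M)"
    by (intro Bochner_Integration.integral_cong) (auto simp: space_M)
  then have "(\<integral>w. f w \<partial>M) = chi x a * (\<integral>w. indicator (cyl \<zero> k) w * chi x w \<partial>M)"
    using integral_add[OF assms(2), of f] by simp
  then show ?thesis by (simp add: f_def integral_pairing_cyl_zero assms)
qed

section \<open>Density of cylinder step functions\<close>

definition cyl_ind :: "(int \<Rightarrow> nat) \<times> int \<Rightarrow> (int \<Rightarrow> nat) \<Rightarrow> complex" where
  "cyl_ind = (\<lambda>(a, k). indicator (cyl a k))"

lemma cyl_ind_measurable: "i \<in> V \<times> UNIV \<Longrightarrow> cyl_ind i \<in> borel_measurable M"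
  using sets_cyl by (auto simp: cyl_ind_def)

lemma
  assumes i: "i \<in> V \<times> UNIV"
  shows cyl_ind_integrable: "integrable M (cyl_ind i)" and cyl_ind_L2: "cyl_ind i \<in> L2 M"
proof -
  obtain a k where ak: "i = (a, k)" "a \<in> V" using i by auto
  have "qdev 1 M (cyl_ind i) < \<infinity>"
    unfolding ak cyl_ind_def prod.case
    using emeasure_cyl_finite[OF ak(2)] sets_cyl[OF ak(2)]
    by (subst qdev_indicator) (simp_all add: ennreal_mult_less_top)
  then show "integrable M (cyl_ind i)" "cyl_ind i \<in> L2 M"
    using qdev_finite_iff(1)[OF cyl_ind_measurable[OF i]] by blast+
qed

text \<open>Induction over the generated \<sigma>-algebra. Intersecting with a fixed cylinder keeps
  all measures finite, so complements become differences of approximable functions and disjoint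
  unions have small tails.\<close>

lemma appr_indicator_Int_cyl:
  assumes d: "0 \<le> d" and "A \<in> sets M"
  shows "appr d M (V \<times> UNIV) cyl_ind (indicator (A \<inter> cyl \<zero> m))"
proof -
  note K = sets_cyl[OF zero_V, of m]
  have cylinder: "appr d M (V \<times> UNIV) cyl_ind (indicator B)" if "B \<in> cylinders" for B
  proof (cases "B = {}")
    case True
    then have "indicator B = (\<lambda>x. 0 :: complex)" by (simp add: fun_eq_iff)
    then show ?thesis using appr_lincomb[OF lincomb_zero] by (simp only:)
  next
    case False
    then obtain a k where "a \<in> V" "B = cyl a k" using \<open>B \<in> cylinders\<close> by (auto simp: cylinders_def)
    then have "indicator B \<in> lincomb (V \<times> UNIV) cyl_ind"
      using lincomb_mem[of "(a, k)" "V \<times> UNIV" cyl_ind] by (simp add: cyl_ind_def)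
    then show ?thesis by (rule appr_lincomb)
  qed
  have "A \<in> sigma_sets V cylinders" using assms(2) sets_M by simp
  from Int_stable_cylinders cylinders_subset this show ?thesis
  proof (induction rule: sigma_sets_induct_disjoint)
    case (basic A)
    then show ?case
      using Int_stable_cylinders cyl_mem_cylinders[OF zero_V, of m]
      by (intro cylinder) (auto simp: Int_stable_def)
  next
    case empty
    have "{} \<in> cylinders" by (simp add: cylinders_def)
    from cylinder[OF this] show ?case by (simp only: Int_empty_left)
  next
    case (compl A)
    then have A: "A \<in> sets M" by (simp add: sets_M)
    have "indicator ((V - A) \<inter> cyl \<zero> m) = (\<lambda>x. indicator (cyl \<zero> m) x + (-1) * indicator (A \<inter> cyl \<zero> m) x :: complex)"
      using cyl_subset_V by (auto simp: indicator_def fun_eq_iff)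
    moreover have "appr d M (V \<times> UNIV) cyl_ind
        (\<lambda>x. indicator (cyl \<zero> m) x + (-1) * indicator (A \<inter> cyl \<zero> m) x)"
      using A K compl cylinder[OF cyl_mem_cylinders[OF zero_V]]
      by (intro appr_add appr_cmult d cyl_ind_measurable) auto
    ultimately show ?case by simp
  next
    case (union A)
    then have A: "A n \<in> sets M" for n by (auto simp: sets_M)
    have "appr d M (V \<times> UNIV) cyl_ind (indicator (\<Union>n. A n \<inter> cyl \<zero> m))"
    proof (rule appr_indicator_UN[OF d])
      show "emeasure M (\<Union>n. A n \<inter> cyl \<zero> m) < \<infinity>"
        by (rule le_less_trans[OF emeasure_mono emeasure_cyl_finite[OF zero_V, of m]]) (use K in auto)
      show "disjoint_family (\<lambda>n. A n \<inter> cyl \<zero> m)"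
        using union(1) by (auto simp: disjoint_family_on_def)
    qed (use A K union cyl_ind_measurable in auto)
    then show ?case by (simp add: UN_simps)
  qed
qed

lemma appr_indicator_cyl:
  assumes d: "0 \<le> d" and A: "A \<in> sets M" "emeasure M A < \<infinity>"
  shows "appr d M (V \<times> UNIV) cyl_ind (indicator A)"
proof -
  define K where "K n = cyl \<zero> (- int n)" for n
  have K: "K n \<in> sets M" for n using sets_cyl[OF zero_V] by (simp add: K_def)
  have D: "disjointed K n \<in> sets M" for n
    using sets.range_disjointed_sets[of K M] K by auto
  have "(\<Union>n. A \<inter> disjointed K n) = A \<inter> (\<Union>n. K n)"
    using UN_disjointed_eq[of K] by auto
  also have "\<dots> = A" using V_eq_UN_cyl sets_subset_V[OF A(1)] by (auto simp: K_def)
  finally have eq: "(\<Union>n. A \<inter> disjointed K n) = A" .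
  have "appr d M (V \<times> UNIV) cyl_ind (indicator (\<Union>n. A \<inter> disjointed K n))"
  proof (rule appr_indicator_UN[OF d])
    fix n
    have "A \<inter> disjointed K n = (A \<inter> disjointed K n) \<inter> cyl \<zero> (- int n)"
      using disjointed_subset[of K n] by (auto simp: K_def)
    then show "appr d M (V \<times> UNIV) cyl_ind (indicator (A \<inter> disjointed K n))"
      using appr_indicator_Int_cyl[OF d, of "A \<inter> disjointed K n" "- int n"] A D by auto
    show "A \<inter> disjointed K n \<in> sets M" using A D by auto
    show "disjoint_family (\<lambda>n. A \<inter> disjointed K n)"
      using disjoint_family_disjointed[of K] by (auto simp: disjoint_family_on_def)
    show "emeasure M (\<Union>n. A \<inter> disjointed K n) < \<infinity>" using A by (simp only: eq)
  qed (rule cyl_ind_measurable)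
  then show ?thesis by (simp only: eq)
qed

lemma appr_cyl:
  assumes d: "0 \<le> d" and f: "f \<in> borel_measurable M" "qdev d M f < \<infinity>"
  shows "appr d M (V \<times> UNIV) cyl_ind f"
  by (rule appr_trans[OF d cyl_ind_measurable, where K = "{A \<in> sets M. emeasure M A < \<infinity>}" and h = indicator])
     (use assms appr_indicators appr_indicator_cyl in auto)

subsection \<open>Plancherel\<close>

abbreviation IF :: "((int \<Rightarrow> nat) \<Rightarrow> complex) \<Rightarrow> (int \<Rightarrow> nat) \<Rightarrow> complex" where
  "IF \<equiv> inverse_fourier p M"

lemma integrable_mult_pairing:
  assumes "integrable M f" "x \<in> V"
  shows "integrable M (\<lambda>w. f w * chi x w)"
proof (rule Bochner_Integration.integrable_bound[OF assms(1)])
  show "(\<lambda>w. f w * chi x w) \<in> borel_measurable M"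
    using assms by (intro borel_measurable_times) auto
  show "AE w in M. norm (f w * chi x w) \<le> norm (f w)"
    by (simp add: norm_mult)
qed

lemma IF_add_cmult:
  assumes "integrable M f" "integrable M g" "x \<in> V"
  shows "IF (\<lambda>w. f w + c * g w) x = IF f x + c * IF g x"
proof -
  have "IF (\<lambda>w. f w + c * g w) x = (\<integral>w. f w * chi x w + c * (g w * chi x w) \<partial>M)"
    unfolding inverse_fourier_def by (simp add: algebra_simps)
  then show ?thesis
    using integrable_mult_pairing[OF assms(1,3)] integrable_mult_pairing[OF assms(2,3)]
    by (simp add: inverse_fourier_def)
qed

lemma IF_diff:
  assumes "integrable M f" "integrable M g" "x \<in> V"
  shows "IF (\<lambda>w. f w - g w) x = IF f x - IF g x"
  using IF_add_cmult[OF assms, of "-1"] by simp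

lemma IF_sum:
  assumes "\<And>i. i \<in> F \<Longrightarrow> integrable M (f i)" "x \<in> V"
  shows "IF (\<lambda>w. \<Sum>i\<in>F. c i * f i w) x = (\<Sum>i\<in>F. c i * IF (f i) x)"
proof -
  have "IF (\<lambda>w. \<Sum>i\<in>F. c i * f i w) x = (\<integral>w. (\<Sum>i\<in>F. c i * (f i w * chi x w)) \<partial>M)"
    unfolding inverse_fourier_def by (simp add: sum_distrib_right mult.assoc)
  also have "\<dots> = (\<Sum>i\<in>F. \<integral>w. c i * (f i w * chi x w) \<partial>M)"
    by (rule Bochner_Integration.integral_sum) (intro integrable_mult_right integrable_mult_pairing assms)
  finally show ?thesis by (simp add: inverse_fourier_def)
qed

lemma IF_diff_le:
  assumes "integrable M f" "integrable M g" "x \<in> V"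
  shows "ennreal (cmod (IF f x - IF g x)) \<le> qdev 1 M (\<lambda>w. f w - g w)"
proof -
  have "ennreal (cmod (IF (\<lambda>w. f w - g w) x)) \<le> (\<integral>\<^sup>+w. norm ((f w - g w) * chi x w) \<partial>M)"
    unfolding inverse_fourier_def
    by (intro integral_norm_bound_ennreal integrable_mult_pairing Bochner_Integration.integrable_diff assms)
  also have "\<dots> \<le> qdev 1 M (\<lambda>w. f w - g w)"
    unfolding qdev_def by (intro nn_integral_mono ennreal_leI) (simp add: norm_mult)
  finally show ?thesis by (simp add: IF_diff assms)
qed

lemma IF_cyl_ind:
  assumes "a \<in> V" "x \<in> V"
  shows "IF (cyl_ind (a, k)) x = of_real (real p powi (- k)) * (indicator (cyl \<zero> (- k)) x * chi a x)"
  using integral_pairing_cyl[OF assms(2,1), of k]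
  by (auto simp: inverse_fourier_def cyl_ind_def pairing_commute[of a])

lemma IF_cyl_ind_measurable: "i \<in> V \<times> UNIV \<Longrightarrow> IF (cyl_ind i) \<in> borel_measurable M"
proof -
  assume "i \<in> V \<times> UNIV"
  then obtain a k where ak: "i = (a, k)" "a \<in> V" by auto
  have "(\<lambda>x. of_real (real p powi (- k)) * (indicator (cyl \<zero> (- k)) x * chi a x)) \<in> borel_measurable M"
    using sets_cyl[OF zero_V] measurable_pairing(1)[OF ak(2)]
    by (intro borel_measurable_times borel_measurable_indicator) auto
  then show ?thesis
    using IF_cyl_ind[OF ak(2)] space_M ak(1) measurable_cong[of M "IF (cyl_ind i)"] by simp
qed

lemma IF_cyl_ind_L2: "i \<in> V \<times> UNIV \<Longrightarrow> IF (cyl_ind i) \<in> L2 M"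
proof -
  assume i: "i \<in> V \<times> UNIV"
  then obtain a k where ak: "i = (a, k)" "a \<in> V" by auto
  have "(\<lambda>x. of_real (real p powi (- k)) * (indicator (cyl \<zero> (- k)) x :: complex)) \<in> L2 M"
    using cyl_ind_L2[of "(\<zero>, - k)"] zero_V by (intro L2_cmult) (simp add: cyl_ind_def)
  then have "integrable M (\<lambda>x. (cmod (of_real (real p powi (- k)) * (indicator (cyl \<zero> (- k)) x :: complex)))\<^sup>2)"
    by (simp only: L2_def mem_Collect_eq)
  moreover have "cmod (of_real (real p powi (- k)) * (indicator (cyl \<zero> (- k)) x :: complex)) = cmod (IF (cyl_ind i) x)"
    if "x \<in> space M" for x
    using that ak by (simp add: IF_cyl_ind space_M norm_mult)
  ultimately have "integrable M (\<lambda>x. (cmod (IF (cyl_ind i) x))\<^sup>2)"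
    by (simp cong: Bochner_Integration.integrable_cong)
  then show ?thesis using IF_cyl_ind_measurable[OF i] by (simp add: L2_def)
qed

text \<open>Both sides are the measure of the intersection: on the transform side it appears as the
  integral of the character \<open>a \<ominus> b\<close> over the smaller dual cylinder. Conjugate
  symmetry reduces everything to \<open>k \<le> l\<close>.\<close>

lemma IF_cyl_ind_inner:
  assumes "i \<in> V \<times> UNIV" "j \<in> V \<times> UNIV"
  shows "L2_inner M (IF (cyl_ind i)) (IF (cyl_ind j)) = L2_inner M (cyl_ind i) (cyl_ind j)"
proof -
  have *: "L2_inner M (IF (cyl_ind (a, k))) (IF (cyl_ind (b, l))) = L2_inner M (cyl_ind (a, k)) (cyl_ind (b, l))"
    if a: "a \<in> V" and b: "b \<in> V" and "k \<le> l" for a b k l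
  proof -
    have iff: "a \<ominus> b \<in> cyl \<zero> k \<longleftrightarrow> (\<forall>j\<le>k. a j = b j)"
      using a b by (simp add: cyl_def sub_V sub_digit_zero_iff)
    let ?c = "of_real (real p powi (- k) * real p powi (- l)) :: complex"
    have "L2_inner M (IF (cyl_ind (a, k))) (IF (cyl_ind (b, l)))
        = (\<integral>x. ?c * (indicator (cyl \<zero> (- k)) x * chi (a \<ominus> b) x) \<partial>M)"
      unfolding L2_inner_def
    proof (intro Bochner_Integration.integral_cong refl)
      fix x assume "x \<in> space M"
      moreover have "cyl \<zero> (- k) \<subseteq> cyl \<zero> (- l)" using \<open>k \<le> l\<close> by (intro cyl_mono) simp
      ultimately show "IF (cyl_ind (a, k)) x * cnj (IF (cyl_ind (b, l)) x)
          = ?c * (indicator (cyl \<zero> (- k)) x * chi (a \<ominus> b) x)"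
        using a b by (auto simp: IF_cyl_ind space_M pairing_sub_left indicator_def)
    qed
    also have "\<dots> = ?c * (if a \<ominus> b \<in> cyl \<zero> k then of_real (real p powi k) else 0)"
      using integral_pairing_cyl_zero[of "a \<ominus> b" "- k"] a b by (simp add: sub_V)
    also have "\<dots> = (if \<forall>j\<le>k. a j = b j then of_real (real p powi (- l)) else 0)"
      using p_pos by (simp add: iff power_int_minus)
    also have "\<dots> = (\<integral>x. indicator (cyl a k \<inter> cyl b l) x \<partial>M)"
    proof -
      note 1 = cyl_Int[OF \<open>k \<le> l\<close>, of a b]
      have 2: "(\<integral>x. indicator (cyl b l) x \<partial>M) = complex_of_real (real p powi (- l))"
        using integral_indicator_complex[OF sets_cyl emeasure_cyl_finite] b by (simp only: measure_cyl)
      have 3: "(\<integral>x. indicator {} x \<partial>M) = (0 :: complex)"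
        using integral_indicator_complex[of "{}" M] by simp
      show ?thesis
      proof (cases "\<forall>j\<le>k. a j = b j")
        case True
        show ?thesis unfolding 1 if_P[OF True] by (rule 2[symmetric])
      next
        case False
        show ?thesis unfolding 1 if_not_P[OF False] by (rule 3[symmetric])
      qed
    qed
    also have "\<dots> = L2_inner M (cyl_ind (a, k)) (cyl_ind (b, l))"
      unfolding L2_inner_def cyl_ind_def
      by (intro Bochner_Integration.integral_cong) (auto simp: indicator_def)
    finally show ?thesis .
  qed
  obtain a k b l where ij: "i = (a, k)" "j = (b, l)" "a \<in> V" "b \<in> V" using assms by auto
  show ?thesis
  proof (cases "k \<le> l")
    case True
    then show ?thesis using * ij by simp
  next
    case False
    then have "L2_inner M (IF (cyl_ind j)) (IF (cyl_ind i)) = L2_inner M (cyl_ind j) (cyl_ind i)"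
      using *[of b a l k] ij by simp
    then show ?thesis using L2_inner_commute by metis
  qed
qed

lemma IF_lincomb:
  assumes "s \<in> lincomb (V \<times> UNIV) cyl_ind"
  shows "integrable M s" "s \<in> L2 M" "IF s \<in> L2 M" "qdev 0 M (IF s) = qdev 0 M s"
proof -
  from assms obtain F c where F: "finite F" "F \<subseteq> V \<times> UNIV" "s = (\<lambda>x. \<Sum>i\<in>F. c i * cyl_ind i x)"
    by (auto simp: lincomb_def)
  show "integrable M s"
    unfolding F(3) using F(2) cyl_ind_integrable
    by (intro Bochner_Integration.integrable_sum integrable_mult_right) auto
  show "s \<in> L2 M" unfolding F(3) using F(2) cyl_ind_L2 by (intro L2_sum) auto
  have eq: "IF s x = (\<Sum>i\<in>F. c i * IF (cyl_ind i) x)" if "x \<in> space M" for x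
    unfolding F(3) using F(2) cyl_ind_integrable that by (intro IF_sum) (auto simp: space_M)
  have "(\<lambda>x. \<Sum>i\<in>F. c i * IF (cyl_ind i) x) \<in> L2 M"
    using F(2) IF_cyl_ind_L2 by (intro L2_sum) auto
  moreover have "IF s \<in> L2 M \<longleftrightarrow> (\<lambda>x. \<Sum>i\<in>F. c i * IF (cyl_ind i) x) \<in> L2 M"
    by (rule L2_cong) (rule eq)
  ultimately show "IF s \<in> L2 M" by simp
  have "qdev 0 M (IF s) = qdev 0 M (\<lambda>x. \<Sum>i\<in>F. c i * IF (cyl_ind i) x)"
    by (rule qdev_cong) (rule eq)
  also have "\<dots> = qdev 0 M s"
    unfolding F(3)
    by (rule qdev_sum_eq[OF F(1) IF_cyl_ind_L2 cyl_ind_L2 IF_cyl_ind_inner])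
      (erule subsetD[OF F(2)])+
  finally show "qdev 0 M (IF s) = qdev 0 M s" .
qed

text \<open>
  If \<open>s\<^sub>n \<rightarrow> f\<close> in \<open>L\<^sup>1\<close> and \<open>L\<^sup>2\<close> with step functions \<open>s\<^sub>n\<close>, the transforms converge uniformly and are Cauchy in \<open>L\<^sup>2\<close>;
  Fatou's lemma identifies the two limits.
\<close>

theorem plancherel:
  assumes f: "integrable M f" "f \<in> L2 M"
  shows "IF f \<in> L2 M" "qdev 0 M (IF f) = qdev 0 M f"
proof -
  let ?r = "\<lambda>n. inverse (real (Suc n))"
  have fm: "f \<in> borel_measurable M" using f by auto
  have "qdev 1 M f < \<infinity>" using f qdev_finite_iff(1)[OF fm] by blast
  then have "appr 1 M (V \<times> UNIV) cyl_ind f" by (intro appr_cyl fm) auto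
  then have "\<exists>s\<in>lincomb (V \<times> UNIV) cyl_ind. qdev 1 M (\<lambda>x. f x - s x) < ennreal (?r n)" for n
    by (intro apprD) auto
  then obtain s where s: "\<And>n. s n \<in> lincomb (V \<times> UNIV) cyl_ind"
    "\<And>n. qdev 1 M (\<lambda>x. f x - s n x) < ennreal (?r n)" by metis
  note s_int = IF_lincomb(1)[OF s(1)] and s_L2 = IF_lincomb(2)[OF s(1)] and IFs_L2 = IF_lincomb(3)[OF s(1)]
  have sm: "s n \<in> borel_measurable M" for n using s_int by auto
  have IFsm: "IF (s n) \<in> borel_measurable M" for n using IFs_L2 by (simp add: L2_def)
  note [measurable] = IFsm
  have q: "qdev 0 M (\<lambda>x. f x - s n x) \<le> ennreal (?r n)" for n
    using qdev_0_le_1[of M "\<lambda>x. f x - s n x"] s(2)[of n] by simp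
  have lim0: "(\<lambda>n. ennreal (?r n)) \<longlonglongrightarrow> 0"
    using tendsto_ennrealI[OF LIMSEQ_inverse_real_of_nat] by simp
  have lim: "(\<lambda>n. IF (s n) x) \<longlonglongrightarrow> IF f x" if "x \<in> space M" for x
  proof -
    have "(\<lambda>n. IF f x - IF (s n) x) \<longlonglongrightarrow> 0"
    proof (rule Lim_null_comparison[OF _ LIMSEQ_inverse_real_of_nat])
      have "norm (IF f x - IF (s n) x) \<le> ?r n" for n
      proof -
        have "x \<in> V" using that space_M by simp
        from IF_diff_le[OF f(1) s_int[of n] this] less_imp_le[OF s(2)[of n]]
        have "ennreal (cmod (IF f x - IF (s n) x)) \<le> ennreal (?r n)"
          by (rule order_trans)
        then show ?thesis by (subst (asm) ennreal_le_iff) simp_all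
      qed
      then show "\<forall>\<^sub>F n in sequentially. norm (IF f x - IF (s n) x) \<le> ?r n" by simp
    qed
    from tendsto_diff[OF tendsto_const[of "IF f x"] this] show ?thesis by simp
  qed
  have IFm: "IF f \<in> borel_measurable M"
    by (rule borel_measurable_LIMSEQ_metric[OF IFsm lim])
  \<comment> \<open>Two errors of at most 1/(n + 1), each doubled by the triangle estimate, give the
    4. The estimate is uniform over the other index m \<ge> n, so it survives the limit in
    m.\<close>
  have bound: "qdev 0 M (\<lambda>x. IF f x - IF (s n) x) \<le> 4 * ennreal (?r n)" for n
  proof -
    have *: "qdev 0 M (\<lambda>x. IF (s m) x - IF (s n) x) \<le> 4 * ennreal (?r n)" if "m \<ge> n" for m
    proof -
      have "qdev 0 M (\<lambda>x. IF (s m) x - IF (s n) x) = qdev 0 M (IF (\<lambda>x. s m x - s n x))"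
        using IF_diff[OF s_int s_int] by (intro qdev_cong) (simp add: space_M)
      also have "\<dots> = qdev 0 M (\<lambda>x. s m x - s n x)"
        by (intro IF_lincomb lincomb_diff s)
      also have "\<dots> \<le> 2 * qdev 0 M (\<lambda>x. s m x - f x) + 2 * qdev 0 M (\<lambda>x. f x - s n x)"
        by (intro qdev_triangle sm fm) simp
      also have "qdev 0 M (\<lambda>x. s m x - f x) = qdev 0 M (\<lambda>x. f x - s m x)"
        by (rule qdev_minus_commute)
      also have "2 * \<dots> + 2 * qdev 0 M (\<lambda>x. f x - s n x)
          \<le> 2 * ennreal (?r n) + 2 * ennreal (?r n)"
      proof (intro add_mono mult_left_mono q)
        have "?r m \<le> ?r n" using that by simp
        then show "qdev 0 M (\<lambda>x. f x - s m x) \<le> ennreal (?r n)"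
          using q[of m] ennreal_leI order_trans by blast
      qed simp_all
      also have "\<dots> = 4 * ennreal (?r n)"
        by (simp flip: distrib_right)
      finally show ?thesis .
    qed
    let ?u = "\<lambda>m x. ennreal (0 * cmod (IF (s m) x - IF (s n) x) + (cmod (IF (s m) x - IF (s n) x))\<^sup>2)"
    have "qdev 0 M (\<lambda>x. IF f x - IF (s n) x) = (\<integral>\<^sup>+x. liminf (\<lambda>m. ?u m x) \<partial>M)"
      unfolding qdev_def
    proof (intro nn_integral_cong)
      fix x assume x: "x \<in> space M"
      have "(\<lambda>m. ?u m x) \<longlonglongrightarrow> ennreal (0 * cmod (IF f x - IF (s n) x) + (cmod (IF f x - IF (s n) x))\<^sup>2)"
        by (intro tendsto_ennrealI tendsto_intros lim[OF x])
      then show "ennreal (0 * cmod (IF f x - IF (s n) x) + (cmod (IF f x - IF (s n) x))\<^sup>2) = liminf (\<lambda>m. ?u m x)"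
        by (rule lim_imp_Liminf[symmetric, rotated]) simp
    qed
    also have "\<dots> \<le> liminf (\<lambda>m. \<integral>\<^sup>+x. ?u m x \<partial>M)"
      by (intro nn_integral_liminf) measurable
    also have "\<dots> \<le> limsup (\<lambda>m. \<integral>\<^sup>+x. ?u m x \<partial>M)"
      by (rule Liminf_le_Limsup) simp
    also have "\<dots> \<le> 4 * ennreal (?r n)"
      by (rule Limsup_bounded) (use * in \<open>auto simp: eventually_sequentially qdev_def\<close>)
    finally show ?thesis .
  qed
  have "(\<lambda>n. 4 * ennreal (?r n)) \<longlonglongrightarrow> 4 * 0"
    by (intro ennreal_tendsto_cmult lim0) simp
  then have lim4: "(\<lambda>n. 4 * ennreal (?r n)) \<longlonglongrightarrow> 0" by simp
  have limIF: "(\<lambda>n. qdev 0 M (\<lambda>x. IF f x - IF (s n) x)) \<longlonglongrightarrow> 0"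
    by (rule tendsto_sandwich[OF _ _ tendsto_const lim4]) (use bound in auto)
  have limf: "(\<lambda>n. qdev 0 M (\<lambda>x. f x - s n x)) \<longlonglongrightarrow> 0"
    by (rule tendsto_sandwich[OF _ _ tendsto_const lim0]) (use q in auto)
  show eq: "qdev 0 M (IF f) = qdev 0 M f"
  proof (rule antisym)
    show "qdev 0 M (IF f) \<le> qdev 0 M f"
      by (rule qdev_le_if_approx[OF IFm IFsm fm sm limIF])
        (use limf IF_lincomb(4)[OF s(1)] in \<open>auto simp: qdev_minus_commute[of 0 M _ f]\<close>)
    show "qdev 0 M f \<le> qdev 0 M (IF f)"
      by (rule qdev_le_if_approx[OF fm sm IFm IFsm limf])
        (use limIF IF_lincomb(4)[OF s(1)] in \<open>auto simp: qdev_minus_commute[of 0 M _ "IF f"]\<close>)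
  qed
  show "IF f \<in> L2 M"
    using eq qdev_finite_iff(2)[OF IFm] qdev_finite_iff(2)[OF fm] f(2) by simp
qed

lemma IF_inner:
  assumes f: "integrable M f" "f \<in> L2 M" and g: "integrable M g" "g \<in> L2 M"
  shows "L2_inner M (IF f) (IF g) = L2_inner M f g"
proof (rule L2_inner_eq_if_qdev_eq)
  fix c
  have "qdev 0 M (\<lambda>x. IF f x + c * IF g x) = qdev 0 M (IF (\<lambda>w. f w + c * g w))"
    using IF_add_cmult[OF f(1) g(1)] by (intro qdev_cong) (simp add: space_M)
  also have "\<dots> = qdev 0 M (\<lambda>w. f w + c * g w)"
    by (intro plancherel Bochner_Integration.integrable_add integrable_mult_right L2_add L2_cmult f g)
  finally show "qdev 0 M (\<lambda>x. IF f x + c * IF g x) = qdev 0 M (\<lambda>w. f w + c * g w)" .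
qed (use plancherel[OF f] plancherel[OF g] f g in auto)

text \<open>The transform is linear and preserves squared norms, so a finite combination has the
  same error on both sides, with the same coefficients.\<close>

lemma appr_IF_iff:
  assumes f: "integrable M f" "f \<in> L2 M" and g: "\<And>i. i \<in> I \<Longrightarrow> integrable M (g i)" "\<And>i. i \<in> I \<Longrightarrow> g i \<in> L2 M"
  shows "appr 0 M I (\<lambda>i. IF (g i)) (IF f) \<longleftrightarrow> appr 0 M I g f"
proof -
  have N: "qdev 0 M (\<lambda>x. IF f x - (\<Sum>i\<in>F. c i * IF (g i) x)) = qdev 0 M (\<lambda>x. f x - (\<Sum>i\<in>F. c i * g i x))"
    if F: "finite F" "F \<subseteq> I" for F c
  proof -
    have s: "integrable M (\<lambda>x. \<Sum>i\<in>F. c i * g i x)" "(\<lambda>x. \<Sum>i\<in>F. c i * g i x) \<in> L2 M"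
      using F g by (auto intro!: Bochner_Integration.integrable_sum integrable_mult_right L2_sum)
    have "qdev 0 M (\<lambda>x. IF f x - (\<Sum>i\<in>F. c i * IF (g i) x)) = qdev 0 M (IF (\<lambda>x. f x - (\<Sum>i\<in>F. c i * g i x)))"
    proof (intro qdev_cong)
      fix x assume "x \<in> space M"
      then have x: "x \<in> V" by (simp add: space_M)
      have "IF (\<lambda>x. \<Sum>i\<in>F. c i * g i x) x = (\<Sum>i\<in>F. c i * IF (g i) x)"
        using F g x by (intro IF_sum) auto
      then show "IF f x - (\<Sum>i\<in>F. c i * IF (g i) x) = IF (\<lambda>x. f x - (\<Sum>i\<in>F. c i * g i x)) x"
        using IF_diff[OF f(1) s(1) x] by simp
    qed
    also have "\<dots> = qdev 0 M (\<lambda>x. f x - (\<Sum>i\<in>F. c i * g i x))"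
      by (intro plancherel Bochner_Integration.integrable_diff L2_diff f s)
    finally show ?thesis .
  qed
  have "(\<exists>F c. finite F \<and> F \<subseteq> I \<and> qdev 0 M (\<lambda>x. IF f x - (\<Sum>i\<in>F. c i * IF (g i) x)) < e) \<longleftrightarrow>
      (\<exists>F c. finite F \<and> F \<subseteq> I \<and> qdev 0 M (\<lambda>x. f x - (\<Sum>i\<in>F. c i * g i x)) < e)" for e
    by (rule ex_cong1, rule ex_cong1, rule conj_cong[OF refl], rule conj_cong[OF refl], simp only: N)
  moreover have "(\<exists>s\<in>lincomb I h. qdev 0 M (\<lambda>x. k x - s x) < e) \<longleftrightarrow>
      (\<exists>F c. finite F \<and> F \<subseteq> I \<and> qdev 0 M (\<lambda>x. k x - (\<Sum>i\<in>F. c i * h i x)) < e)" for h k e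
  proof
    assume "\<exists>s\<in>lincomb I h. qdev 0 M (\<lambda>x. k x - s x) < e"
    then obtain F c where "finite F" "F \<subseteq> I" "qdev 0 M (\<lambda>x. k x - (\<Sum>i\<in>F. c i * h i x)) < e"
      by (auto simp: lincomb_def)
    then show "\<exists>F c. finite F \<and> F \<subseteq> I \<and> qdev 0 M (\<lambda>x. k x - (\<Sum>i\<in>F. c i * h i x)) < e" by blast
  next
    assume "\<exists>F c. finite F \<and> F \<subseteq> I \<and> qdev 0 M (\<lambda>x. k x - (\<Sum>i\<in>F. c i * h i x)) < e"
    then obtain F c where F: "finite F" "F \<subseteq> I" "qdev 0 M (\<lambda>x. k x - (\<Sum>i\<in>F. c i * h i x)) < e"
      by blast
    then have "(\<lambda>x. \<Sum>i\<in>F. c i * h i x) \<in> lincomb I h" by (auto simp: lincomb_def)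
    with F(3) show "\<exists>s\<in>lincomb I h. qdev 0 M (\<lambda>x. k x - s x) < e"
      by (rule bexI)
  qed
  ultimately show ?thesis unfolding appr_def by (simp only:)
qed

text \<open>Fourier inversion for cylinders: \<open>t\<close> is the forward transform of the
  indicator, obtained by conjugating the character. As cylinder indicators have dense span, this
  provides the density of the range of the transform.\<close>

lemma cyl_ind_eq_IF:
  assumes "a \<in> V"
  obtains t where "integrable M t" "t \<in> L2 M" "\<And>x. x \<in> V \<Longrightarrow> IF t x = cyl_ind (a, k) x"
proof -
  let ?P = "real p powi (- k)"
  define t where "t w = of_real ?P * (indicator (cyl \<zero> (- k)) w * cnj (chi a w))" for w
  have "IF (cyl_ind (\<zero> \<ominus> a, k)) \<in> L2 M"
    using IF_cyl_ind_L2[of "(\<zero> \<ominus> a, k)"] assms sub_V[OF zero_V] by simp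
  moreover have t_eq: "t w = IF (cyl_ind (\<zero> \<ominus> a, k)) w" if "w \<in> V" for w
    using that assms by (simp add: t_def IF_cyl_ind sub_V zero_V pairing_sub_left)
  ultimately have L2: "t \<in> L2 M" using L2_cong[of M t "IF (cyl_ind (\<zero> \<ominus> a, k))"] by (simp add: space_M)
  have int: "integrable M t"
  proof (rule Bochner_Integration.integrable_bound)
    show "integrable M (\<lambda>w. of_real ?P * cyl_ind (\<zero>, - k) w :: complex)"
      using cyl_ind_integrable[of "(\<zero>, - k)"] zero_V by simp
    show "t \<in> borel_measurable M" using L2 by (simp add: L2_def)
  qed (auto simp: t_def cyl_ind_def norm_mult)
  have "IF t x = cyl_ind (a, k) x" if x: "x \<in> V" for x
  proof -
    have "IF t x = (\<integral>w. of_real ?P * (indicator (cyl \<zero> (- k)) w * chi (x \<ominus> a) w) \<partial>M)"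
      unfolding inverse_fourier_def t_def using x assms
      by (intro Bochner_Integration.integral_cong) (simp_all add: pairing_sub_left space_M)
    also have "\<dots> = of_real ?P * (if x \<ominus> a \<in> cyl \<zero> k then of_real (real p powi k) else 0)"
      using integral_pairing_cyl_zero[of "x \<ominus> a" "- k"] x assms by (simp add: sub_V)
    also have "x \<ominus> a \<in> cyl \<zero> k \<longleftrightarrow> x \<in> cyl a k"
      using x assms by (simp add: cyl_def sub_V sub_digit_zero_iff)
    finally show ?thesis
      using p_pos by (simp add: cyl_ind_def indicator_def power_int_minus)
  qed
  with int L2 show ?thesis by (rule that)
qed

text \<open>Inner products are preserved, so only density is at stake, and it suffices to
  approximate cylinder indicators. Passing from the transforms back to \<open>g\<close> uses the
  transforms of these indicators; the other direction uses their preimages.\<close>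

theorem orthonormal_basis_IF_iff:
  assumes g: "\<And>i. i \<in> I \<Longrightarrow> integrable M (g i)" "\<And>i. i \<in> I \<Longrightarrow> g i \<in> L2 M"
  shows "orthonormal_basis_L2 M I (\<lambda>i. IF (g i)) \<longleftrightarrow> orthonormal_basis_L2 M I g"
proof -
  have IFg: "IF (g i) \<in> L2 M" if "i \<in> I" for i using plancherel g that by blast
  have gm: "g i \<in> borel_measurable M" "IF (g i) \<in> borel_measurable M" if "i \<in> I" for i
    using g(2)[OF that] IFg[OF that] by (auto simp: L2_def)
  have cyl_appr: "appr 0 M (V \<times> UNIV) cyl_ind f" if "f \<in> L2 M" for f
    using that qdev_finite_iff(2)[of f M] by (intro appr_cyl) (auto simp: L2_def)
  have "(\<forall>f\<in>L2 M. appr 0 M I (\<lambda>i. IF (g i)) f) \<longleftrightarrow> (\<forall>f\<in>L2 M. appr 0 M I g f)"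
  proof (intro iffI ballI)
    fix f assume *: "\<forall>f\<in>L2 M. appr 0 M I (\<lambda>i. IF (g i)) f" and f: "f \<in> L2 M"
    show "appr 0 M I g f"
    proof (rule appr_trans[OF order_refl gm(1) cyl_ind_measurable _ _ cyl_appr[OF f]])
      fix i :: "(int \<Rightarrow> nat) \<times> int" assume i: "i \<in> V \<times> UNIV"
      have "appr 0 M I (\<lambda>i. IF (g i)) (IF (cyl_ind i))"
        by (rule bspec[OF * IF_cyl_ind_L2[OF i]])
      then show "appr 0 M I g (cyl_ind i)"
        by (subst (asm) appr_IF_iff) (simp_all add: cyl_ind_integrable[OF i] cyl_ind_L2[OF i] g)
    qed (use f in \<open>auto simp: L2_def\<close>)
  next
    fix f assume *: "\<forall>f\<in>L2 M. appr 0 M I g f" and f: "f \<in> L2 M"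
    show "appr 0 M I (\<lambda>i. IF (g i)) f"
    proof (rule appr_trans[OF order_refl gm(2) cyl_ind_measurable _ _ cyl_appr[OF f]])
      fix i :: "(int \<Rightarrow> nat) \<times> int" assume "i \<in> V \<times> UNIV"
      then obtain a k where ak: "i = (a, k)" "a \<in> V" by auto
      obtain t where t: "integrable M t" "t \<in> L2 M" "\<And>x. x \<in> V \<Longrightarrow> IF t x = cyl_ind (a, k) x"
        using cyl_ind_eq_IF[OF ak(2)] by blast
      have "appr 0 M I (\<lambda>i. IF (g i)) (IF t)"
        by (subst appr_IF_iff) (simp_all add: t g *)
      then show "appr 0 M I (\<lambda>i. IF (g i)) (cyl_ind i)"
        by (rule appr_AE[rotated]) (auto simp: t(3) space_M ak intro: AE_I2)
    qed (use f in \<open>auto simp: L2_def\<close>)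
  qed
  then show ?thesis
    unfolding orthonormal_basis_L2_iff_appr using g IFg by (simp add: IF_inner)
qed

subsection \<open>Reduction modulo \<open>\<Lambda>\<close>\<close>

text \<open>Reduction modulo \<Lambda> with values in the fundamental domain \<open>U\<close>,
  complementary to the integer part \<open>trunc 0\<close>.\<close>

definition frac :: "(int \<Rightarrow> nat) \<Rightarrow> int \<Rightarrow> nat" where
  "frac w = (\<lambda>j. if 0 < j then w j else 0)"

lemma frac_U: "w \<in> V \<Longrightarrow> frac w \<in> U"
  using p_pos V_less[of w] unfolding vilenkin_U_def frac_def
  by (auto intro!: V_I[of _ 0])

lemma U_subset_V: "U \<subseteq> V"
  by (auto simp: vilenkin_U_def)

lemma frac_V: "w \<in> V \<Longrightarrow> frac w \<in> V"
  using frac_U U_subset_V by blast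

lemma frac_eq_sub:
  assumes "n \<in> Lam p" "w \<in> cyl n 0"
  shows "frac w = w \<ominus> n"
proof
  fix j
  have w: "w \<in> V" "\<forall>j\<le>0. w j = n j" and n: "n \<in> V" "\<forall>j>0. n j = 0"
    using assms by (auto simp: cyl_def Lam_def)
  show "frac w j = (w \<ominus> n) j"
  proof (cases "0 < j")
    case True
    then show ?thesis using n V_less[OF w(1), of j] by (simp add: frac_def ominus_def)
  next
    case False
    then show ?thesis using sub_digit_zero_iff[OF w(1) n(1), of j] w(2) by (simp add: frac_def)
  qed
qed

lemma trunc_Lam: "w \<in> V \<Longrightarrow> trunc 0 w \<in> Lam p"
  by (simp add: Lam_eq_trunc)

lemma in_cyl_trunc: "w \<in> V \<Longrightarrow> w \<in> cyl (trunc 0 w) 0"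
  by (simp add: cyl_def trunc_def)

lemma in_cyl_Lam_iff:
  assumes "n \<in> Lam p" "w \<in> V"
  shows "w \<in> cyl n 0 \<longleftrightarrow> n = trunc 0 w"
  using assms by (auto simp: cyl_def trunc_def Lam_def fun_eq_iff)

text \<open>Subtraction of \<open>n\<close> clears the digits up to position 0 only if they agree
  with those of \<open>n\<close>. Hence exactly one element of \<Lambda>, the integer part, brings a
  point into \<open>U\<close>.\<close>

lemma sub_in_U_iff:
  assumes "n \<in> Lam p" "w \<in> V"
  shows "w \<ominus> n \<in> U \<longleftrightarrow> w \<in> cyl n 0"
  using assms sub_digit_zero_iff[of w n] sub_V[of w n] Lam_V[of n]
  by (auto simp: vilenkin_U_def cyl_def)

text \<open>Characters indexed by \<Lambda> are trivial on \<Lambda>, since \<open>j\<close> and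
  \<open>1 - j\<close> are never both nonpositive.\<close>

lemma pairing_frac:
  assumes "n \<in> Lam p" "w \<in> V"
  shows "chi n (frac w) = chi n w"
proof -
  have "frac w = w \<ominus> trunc 0 w"
    by (rule frac_eq_sub) (simp_all add: trunc_Lam in_cyl_trunc assms)
  then show ?thesis
    using assms trunc_Lam[of w] by (simp add: pairing_sub_right Lam_V pairing_Lam_Lam)
qed

lemma measurable_frac [measurable]: "frac \<in> measurable M M"
proof (rule measurable_from_cyl)
  fix a k
  show "frac -` cyl a k \<inter> V \<in> sets M"
  proof (rule sets_cyl_invariant)
    fix x assume x: "x \<in> frac -` cyl a k \<inter> V"
    show "cyl x k \<subseteq> frac -` cyl a k \<inter> V"
    proof
      fix y assume y: "y \<in> cyl x k"
      then have yV: "y \<in> V" "\<forall>j\<le>k. y j = x j" by (auto simp: cyl_def)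
      then have "\<forall>j\<le>k. frac y j = frac x j" by (simp add: frac_def)
      then show "y \<in> frac -` cyl a k \<inter> V"
        using x yV(1) frac_V[OF yV(1)] by (simp add: cyl_def)
    qed
  qed simp
qed (rule frac_V)

lemma sets_vimage_frac: "A \<in> sets M \<Longrightarrow> frac -` A \<inter> V \<in> sets M"
  using measurable_sets[OF measurable_frac] by (simp add: space_M)

text \<open>For \<open>k \<ge> 0\<close> these are the elements of \<Lambda> corresponding to the
  numbers below p^k. As characters they form the dual of the finite quotient of \<open>U\<close> by
  \<open>cyl \<zero> k\<close>.\<close>

definition Lam_upto :: "int \<Rightarrow> (int \<Rightarrow> nat) set" where
  "Lam_upto k = Lam p \<inter> cyl \<zero> (- k)"

lemma finite_Lam_upto: "finite (Lam_upto k)"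
proof (rule finite_subset[OF _ finite_digits[of "1 - k" 0]])
  show "Lam_upto k \<subseteq> {x. (\<forall>j. x j < p) \<and> (\<forall>j. j \<notin> {1 - k..0} \<longrightarrow> x j = 0)}"
    using V_less unfolding Lam_upto_def Lam_def cyl_def by auto
qed

lemma zero_Lam: "\<zero> \<in> Lam p"
  using zero_V by (simp add: Lam_def)

text \<open>
  The character sum is the integral of the character over \<open>cyl \<zero> (- k)\<close>, which is the disjoint union of
  the translates of \<open>U\<close> by \<open>Lam_upto k\<close>.
\<close>

lemma sum_pairing_Lam_upto:
  assumes "y \<in> U" "0 \<le> k"
  shows "(\<Sum>n\<in>Lam_upto k. chi n y) = (if y \<in> cyl \<zero> k then of_real (real p powi k) else 0)"
proof -
  have y: "y \<in> V" "y \<in> cyl \<zero> 0" using assms U_subset_V U_eq_cyl by auto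
  have Lam: "n \<in> V" if "n \<in> Lam_upto k" for n using that Lam_V by (auto simp: Lam_upto_def)
  have ind: "(\<Sum>n\<in>Lam_upto k. indicator (cyl n 0) x) = (indicator (cyl \<zero> (- k)) x :: complex)" if "x \<in> V" for x
  proof -
    have "(\<Sum>n\<in>Lam_upto k. indicator (cyl n 0) x) = (\<Sum>n\<in>Lam_upto k. if n = trunc 0 x then 1 else 0 :: complex)"
      using that by (intro sum.cong refl) (auto simp: Lam_upto_def indicator_def in_cyl_Lam_iff)
    also have "\<dots> = (if trunc 0 x \<in> Lam_upto k then 1 else 0)"
      using finite_Lam_upto by (simp add: sum.delta)
    also have "trunc 0 x \<in> Lam_upto k \<longleftrightarrow> x \<in> cyl \<zero> (- k)"
      using that assms(2) trunc_Lam[OF that] trunc_V[OF that, of 0]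
      by (auto simp: Lam_upto_def cyl_def trunc_def)
    finally show ?thesis by (simp add: indicator_def)
  qed
  have "(\<integral>x. indicator (cyl \<zero> (- k)) x * chi y x \<partial>M)
      = (\<integral>x. (\<Sum>n\<in>Lam_upto k. indicator (cyl n 0) x * chi y x) \<partial>M)"
    by (intro Bochner_Integration.integral_cong) (simp_all add: space_M ind flip: sum_distrib_right)
  also have "\<dots> = (\<Sum>n\<in>Lam_upto k. \<integral>x. indicator (cyl n 0) x * chi y x \<partial>M)"
  proof (rule Bochner_Integration.integral_sum)
    fix n assume "n \<in> Lam_upto k"
    then show "integrable M (\<lambda>x. indicator (cyl n 0) x * chi y x)"
      using integrable_mult_pairing[OF cyl_ind_integrable[of "(n, 0)"] y(1)] Lam by (simp add: cyl_ind_def)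
  qed
  also have "\<dots> = (\<Sum>n\<in>Lam_upto k. chi n y)"
    using y Lam by (intro sum.cong refl, subst integral_pairing_cyl) (simp_all add: pairing_commute[of y])
  finally have eq: "(\<integral>x. indicator (cyl \<zero> (- k)) x * chi y x \<partial>M) = (\<Sum>n\<in>Lam_upto k. chi n y)" .
  show ?thesis
    using integral_pairing_cyl_zero[OF y(1), of "- k"] unfolding minus_minus eq .
qed

text \<open>Finite Fourier inversion on the quotient of \<open>U\<close> by
  \<open>cyl \<zero> l\<close>: the Dirichlet kernel of length p^l is exactly a multiple of an
  indicator, so step functions on \<open>U\<close> are trigonometric polynomials.\<close>

lemma indicator_cyl_eq_sum:
  assumes "y \<in> U" "b \<in> U" "0 \<le> l"
  shows "indicator (cyl b l) y = of_real (real p powi (- l)) * (\<Sum>n\<in>Lam_upto l. cnj (chi n b) * chi n y)"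
proof -
  have V: "y \<in> V" "b \<in> V" using assms U_subset_V by auto
  have sub: "y \<ominus> b \<in> V" using V by (rule sub_V)
  moreover have "\<forall>j\<le>0. (y \<ominus> b) j = 0"
    using V assms by (simp add: sub_digit_zero_iff vilenkin_U_def)
  ultimately have U: "y \<ominus> b \<in> U" by (simp add: vilenkin_U_def)
  have "(\<Sum>n\<in>Lam_upto l. cnj (chi n b) * chi n y) = (\<Sum>n\<in>Lam_upto l. chi n (y \<ominus> b))"
    using V by (intro sum.cong refl) (simp add: Lam_upto_def Lam_V pairing_sub_right)
  also have "\<dots> = (if y \<ominus> b \<in> cyl \<zero> l then of_real (real p powi l) else 0)"
    by (rule sum_pairing_Lam_upto[OF U assms(3)])
  also have "y \<ominus> b \<in> cyl \<zero> l \<longleftrightarrow> y \<in> cyl b l"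
    using sub V by (simp add: cyl_def sub_digit_zero_iff)
  finally show ?thesis using p_pos by (simp add: indicator_def power_int_minus)
qed

lemma cyl_Int_U:
  obtains "cyl a k \<inter> U = {}" | b l where "b \<in> U" "0 \<le> l" "cyl a k \<inter> U = cyl b l"
proof (cases "cyl a k \<inter> U = {}")
  case False
  show ?thesis
  proof (cases "k \<le> 0")
    case True
    then have "cyl a k \<inter> U = cyl \<zero> 0"
      using False unfolding U_eq_cyl cyl_Int[OF True] by (simp split: if_splits)
    moreover have "\<zero> \<in> U" using U_eq_cyl cyl_self zero_V by simp
    ultimately show ?thesis by (intro that(2)[of \<zero> 0]) auto
  next
    case k: False
    then have "0 \<le> k" by simp
    obtain b where b: "b \<in> cyl a k" "b \<in> U" using False by blast
    have "cyl \<zero> 0 \<inter> cyl b k = cyl b k"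
      using b(2) cyl_Int[OF \<open>0 \<le> k\<close>, of \<zero> b] by (auto simp: vilenkin_U_def)
    then have "cyl a k \<inter> U = cyl b k" using cyl_eq[OF b(1)] U_eq_cyl by auto
    with b(2) \<open>0 \<le> k\<close> show ?thesis by (rule that(2))
  qed
qed (rule that(1))

subsection \<open>Translation congruence\<close>

text \<open>Reduction carries the measure on \<open>W\<close> to the measure on \<open>U\<close>.
  For measurable \<open>W\<close> this says that almost every point of \<open>U\<close> has exactly
  one preimage in \<open>W\<close>.\<close>

definition cong_U :: "(int \<Rightarrow> nat) set \<Rightarrow> bool" where
  "cong_U W \<longleftrightarrow> (\<forall>A\<in>sets M. emeasure M (W \<inter> (frac -` A \<inter> V)) = emeasure M (U \<inter> A))"

lemma distr_frac_iff:
  assumes W: "W \<in> sets M"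
  shows "cong_U W \<longleftrightarrow> distr (density M (indicator W)) M frac = density M (indicator U)"
proof -
  have "emeasure (distr (density M (indicator W)) M frac) A = emeasure M (W \<inter> (frac -` A \<inter> V))"
    if "A \<in> sets M" for A
    using that W sets_vimage_frac[OF that]
    by (simp add: emeasure_distr emeasure_restricted space_M)
  moreover have "emeasure (density M (indicator U)) A = emeasure M (U \<inter> A)" if "A \<in> sets M" for A
    using that sets_U by (simp add: emeasure_restricted)
  ultimately show ?thesis
    unfolding cong_U_def by (metis measure_eqI sets_density sets_distr)
qed

lemma cong_U_emeasure:
  assumes "cong_U W" "W \<in> sets M"
  shows "emeasure M W = 1"
proof -
  have "V \<in> sets M" using sets.top[of M] by (simp add: space_M)
  then have "emeasure M (W \<inter> (frac -` V \<inter> V)) = emeasure M (U \<inter> V)" using assms(1) cong_U_def by blast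
  moreover have "W \<inter> (frac -` V \<inter> V) = W" using sets_subset_V[OF assms(2)] frac_V by auto
  moreover have "U \<inter> V = U" using U_subset_V by blast
  ultimately show ?thesis by (simp add: emeasure_U)
qed

lemma cong_U_nn_integral:
  assumes "cong_U W" "W \<in> sets M" and [measurable]: "f \<in> borel_measurable M"
  shows "(\<integral>\<^sup>+w. indicator W w * f (frac w) \<partial>M) = (\<integral>\<^sup>+w. indicator U w * f w \<partial>M)"
proof -
  note [measurable] = assms(2) sets_U
  have "(\<integral>\<^sup>+w. indicator W w * f (frac w) \<partial>M) = (\<integral>\<^sup>+w. f (frac w) \<partial>density M (indicator W))"
    by (subst nn_integral_density) auto
  also have "\<dots> = (\<integral>\<^sup>+w. f w \<partial>distr (density M (indicator W)) M frac)"
    by (subst nn_integral_distr) auto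
  also have "\<dots> = (\<integral>\<^sup>+w. indicator U w * f w \<partial>M)"
    using assms(1,2) by (simp add: distr_frac_iff nn_integral_density)
  finally show ?thesis .
qed

lemma cong_U_integral:
  fixes f :: "(int \<Rightarrow> nat) \<Rightarrow> complex"
  assumes "cong_U W" "W \<in> sets M" and [measurable]: "f \<in> borel_measurable M"
  shows "(\<integral>w. indicator W w * f (frac w) \<partial>M) = (\<integral>w. indicator U w * f w \<partial>M)"
proof -
  note [measurable] = assms(2) sets_U
  have ind: "(\<integral>w. g w \<partial>density M (indicator S)) = (\<integral>w. indicator S w * g w \<partial>M)"
    if [measurable]: "S \<in> sets M" "g \<in> borel_measurable M" for S and g :: "(int \<Rightarrow> nat) \<Rightarrow> complex"
  proof -
    have "density M (indicator S) = density M (\<lambda>x. ennreal (indicator S x))" by (simp add: ennreal_indicator)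
    then have "(\<integral>w. g w \<partial>density M (indicator S)) = (\<integral>w. indicator S w *\<^sub>R g w \<partial>M)"
      by (simp only:) (rule integral_density, auto)
    moreover have "(\<lambda>w. indicator S w *\<^sub>R g w) = (\<lambda>w. indicator S w * g w)"
      by (auto simp: indicator_def fun_eq_iff)
    ultimately show ?thesis by (simp only:)
  qed
  have "(\<integral>w. indicator W w * f (frac w) \<partial>M) = (\<integral>w. f (frac w) \<partial>density M (indicator W))"
    by (rule ind[symmetric]) measurable
  also have "\<dots> = (\<integral>w. f w \<partial>distr (density M (indicator W)) M frac)"
    by (rule integral_distr[symmetric]) auto
  also have "\<dots> = (\<integral>w. indicator U w * f w \<partial>M)"
    using assms(1,2) by (simp add: distr_frac_iff ind sets_U)
  finally show ?thesis .
qed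

text \<open>The character factors through \<open>frac\<close>, so the integral moves to
  \<open>U\<close>. There it vanishes unless \<open>q\<close> has no digit up to position 0, and
  elements of \<Lambda> have no others.\<close>

lemma cong_U_integral_pairing:
  assumes "cong_U W" "W \<in> sets M" "q \<in> Lam p"
  shows "(\<integral>w. indicator W w * chi q w \<partial>M) = (if q = \<zero> then 1 else 0)"
proof -
  have q: "q \<in> V" using Lam_V assms by blast
  have "(\<integral>w. indicator W w * chi q w \<partial>M) = (\<integral>w. indicator W w * chi q (frac w) \<partial>M)"
    using assms(3) by (intro Bochner_Integration.integral_cong) (simp_all add: space_M pairing_frac)
  also have "\<dots> = (\<integral>w. indicator U w * chi q w \<partial>M)"
    using assms q by (intro cong_U_integral) auto
  also have "\<dots> = (if q \<in> cyl \<zero> 0 then 1 else 0)"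
    using integral_pairing_cyl_zero[OF q, of 0] by (simp add: U_eq_cyl)
  also have "q \<in> cyl \<zero> 0 \<longleftrightarrow> q = \<zero>"
  proof
    assume "q \<in> cyl \<zero> 0"
    then have "q j = 0" for j using assms(3) by (cases "j \<le> 0") (auto simp: cyl_def Lam_def)
    then show "q = \<zero>" by (rule ext)
  qed (simp add: cyl_self zero_V)
  finally show ?thesis .
qed

text \<open>Expanding the indicator of a cylinder in \<open>U\<close> into characters turns the
  measure of its preimage in \<open>W\<close> into a finite sum of the given integrals, of which
  only the one for \<open>q = \<zero>\<close> survives. Equality on cylinders then extends to all
  measurable sets.\<close>

lemma cong_U_if_integral_pairing:
  assumes W: "W \<in> sets M" "emeasure M W < \<infinity>"
    and orth: "\<And>q. q \<in> Lam p \<Longrightarrow> (\<integral>w. indicator W w * chi q w \<partial>M) = (if q = \<zero> then 1 else 0)"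
  shows "cong_U W"
  unfolding distr_frac_iff[OF W(1)]
proof (rule measure_eqI_generator_eq[OF Int_stable_cylinders cylinders_subset])
  let ?N = "distr (density M (indicator W)) M frac"
  have N: "emeasure ?N A = emeasure M (W \<inter> (frac -` A \<inter> V))" if "A \<in> sets M" for A
    using that W sets_vimage_frac[OF that]
    by (simp add: emeasure_distr emeasure_restricted space_M)
  have cyl: "emeasure M (W \<inter> (frac -` cyl b l \<inter> V)) = emeasure M (cyl b l)" if b: "b \<in> U" and l: "0 \<le> l" for b l
  proof -
    have bV: "b \<in> V" using b U_subset_V by blast
    let ?E = "W \<inter> (frac -` cyl b l \<inter> V)"
    have E: "?E \<in> sets M" using W sets_vimage_frac[OF sets_cyl[OF bV]] by auto
    have Efin: "emeasure M ?E < \<infinity>"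
      by (rule le_less_trans[OF emeasure_mono W(2)]) (use W in auto)
    have Wint: "integrable M (indicator W :: _ \<Rightarrow> complex)"
      using W qdev_indicator[of 1 W M] qdev_finite_iff(1)[of "indicator W" M] by (simp add: ennreal_mult_less_top)
    let ?P = "of_real (real p powi (- l)) :: complex"
    have "of_real (measure M ?E) = (\<integral>w. indicator ?E w \<partial>M :: complex)"
      by (rule integral_indicator_complex[OF E Efin, symmetric])
    also have "\<dots> = (\<integral>w. ?P * (\<Sum>n\<in>Lam_upto l. cnj (chi n b) * (indicator W w * chi n w)) \<partial>M)"
    proof (intro Bochner_Integration.integral_cong refl)
      fix w assume "w \<in> space M"
      then have w: "w \<in> V" by (simp add: space_M)
      have "indicator ?E w = indicator W w * (indicator (cyl b l) (frac w) :: complex)"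
        using w by (simp add: indicator_def)
      also have "\<dots> = indicator W w * (?P * (\<Sum>n\<in>Lam_upto l. cnj (chi n b) * chi n (frac w)))"
        using indicator_cyl_eq_sum[OF frac_U[OF w] b l] by simp
      also have "(\<Sum>n\<in>Lam_upto l. cnj (chi n b) * chi n (frac w)) = (\<Sum>n\<in>Lam_upto l. cnj (chi n b) * chi n w)"
        using w by (intro sum.cong refl) (simp add: Lam_upto_def pairing_frac)
      also have "indicator W w * (?P * (\<Sum>n\<in>Lam_upto l. cnj (chi n b) * chi n w))
          = ?P * (\<Sum>n\<in>Lam_upto l. cnj (chi n b) * (indicator W w * chi n w))"
        by (simp add: sum_distrib_left mult_ac)
      finally show "indicator ?E w = ?P * (\<Sum>n\<in>Lam_upto l. cnj (chi n b) * (indicator W w * chi n w))" .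
    qed
    also have "\<dots> = ?P * (\<Sum>n\<in>Lam_upto l. cnj (chi n b) * (\<integral>w. indicator W w * chi n w \<partial>M))"
    proof -
      have "integrable M (\<lambda>w. cnj (chi n b) * (indicator W w * chi n w))" if "n \<in> Lam_upto l" for n
        using integrable_mult_pairing[OF Wint, of n] that by (simp add: Lam_upto_def Lam_V)
      then show ?thesis by (simp add: Bochner_Integration.integral_sum)
    qed
    also have "(\<Sum>n\<in>Lam_upto l. cnj (chi n b) * (\<integral>w. indicator W w * chi n w \<partial>M))
        = (\<Sum>n\<in>Lam_upto l. if n = \<zero> then 1 else 0)"
      by (intro sum.cong refl) (simp add: orth Lam_upto_def)
    also have "\<dots> = 1"
      using finite_Lam_upto zero_Lam cyl_self[OF zero_V] by (simp add: sum.delta Lam_upto_def)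
    finally have "measure M ?E = real p powi (- l)"
      by (simp only: mult_1_right of_real_eq_iff)
    then show ?thesis
      using Efin by (simp add: emeasure_cyl[OF bV] emeasure_eq_ennreal_measure)
  qed
  fix A assume "A \<in> cylinders"
  then consider "A = {}" | a k where "a \<in> V" "A = cyl a k" by (auto simp: cylinders_def)
  then show "emeasure ?N A = emeasure (density M (indicator U)) A"
  proof cases
    case (2 a k)
    then have "emeasure ?N A = emeasure M (W \<inter> (frac -` cyl a k \<inter> V))" using N sets_cyl by simp
    \<comment> \<open>\<open>frac\<close> takes values in \<open>U\<close>, so the part of the
      cylinder outside \<open>U\<close> has no preimage.\<close>
    also have "W \<inter> (frac -` cyl a k \<inter> V) = W \<inter> (frac -` (cyl a k \<inter> U) \<inter> V)"
      using frac_U by blast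
    also have "emeasure M \<dots> = emeasure M (cyl a k \<inter> U)"
      by (rule cyl_Int_U[of a k]) (simp_all add: cyl)
    also have "\<dots> = emeasure (density M (indicator U)) A"
      using 2 sets_cyl sets_U by (simp add: emeasure_restricted Int_commute)
    finally show ?thesis .
  qed simp
next
  show "range (\<lambda>n. cyl \<zero> (- int n)) \<subseteq> cylinders" using cyl_mem_cylinders[OF zero_V] by blast
  show "(\<Union>n. cyl \<zero> (- int n)) = V" by (rule V_eq_UN_cyl[symmetric])
  fix n
  let ?C = "cyl \<zero> (- int n)"
  have "emeasure (distr (density M (indicator W)) M frac) ?C = emeasure M (W \<inter> (frac -` ?C \<inter> V))"
    using W sets_vimage_frac[OF sets_cyl[OF zero_V]] sets_cyl[OF zero_V]
    by (simp add: emeasure_distr emeasure_restricted space_M)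
  also have "\<dots> \<le> emeasure M W" using W by (intro emeasure_mono) auto
  finally show "emeasure (distr (density M (indicator W)) M frac) ?C \<noteq> \<infinity>" using W(2) by auto
qed (simp_all add: sets_M)

subsection \<open>Completeness of the characters\<close>

text \<open>Cylinder approximations of \<open>A\<close> remain as good after multiplication by the
  indicator of \<open>U\<close>, because \<open>A\<close> lies in \<open>U\<close>; cut down in this
  way, each cylinder is a finite combination of characters.\<close>

lemma appr_U:
  assumes A: "A \<in> sets M" "A \<subseteq> U"
  shows "appr 0 M (Lam p) (\<lambda>n w. indicator U w * cnj (chi n w)) (indicator A)"
proof -
  have meas: "(\<lambda>w. indicator U w * cnj (chi n w)) \<in> borel_measurable M" if "n \<in> Lam p" for n
    using sets_U that Lam_V by (intro borel_measurable_times borel_measurable_cnj) auto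
  have "emeasure M A \<le> emeasure M U" using A sets_U by (intro emeasure_mono)
  then have "emeasure M A < \<infinity>" by (rule le_less_trans) (simp add: emeasure_U)
  then have 1: "appr 0 M (V \<times> UNIV) cyl_ind (indicator A)" using A by (intro appr_indicator_cyl) auto
  have 2: "appr 0 M (V \<times> UNIV) (\<lambda>i w. indicator U w * cyl_ind i w) (indicator A)"
    unfolding appr_def
  proof (intro allI impI)
    fix e :: real assume "0 < e"
    from apprD[OF 1 this] obtain F c where F: "finite F" "F \<subseteq> V \<times> UNIV"
      "qdev 0 M (\<lambda>x. indicator A x - (\<Sum>i\<in>F. c i * cyl_ind i x)) < ennreal e"
      by (auto simp: lincomb_def)
    have "qdev 0 M (\<lambda>x. indicator A x - (\<Sum>i\<in>F. c i * (indicator U x * cyl_ind i x)))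
        \<le> qdev 0 M (\<lambda>x. indicator A x - (\<Sum>i\<in>F. c i * cyl_ind i x))"
    proof (rule qdev_mono)
      fix x
      have "indicator A x - (\<Sum>i\<in>F. c i * (indicator U x * cyl_ind i x))
          = indicator U x * (indicator A x - (\<Sum>i\<in>F. c i * cyl_ind i x))"
        using A by (auto simp: indicator_def)
      then show "cmod (indicator A x - (\<Sum>i\<in>F. c i * (indicator U x * cyl_ind i x)))
          \<le> cmod (indicator A x - (\<Sum>i\<in>F. c i * cyl_ind i x))"
        by (simp add: norm_mult indicator_def)
    qed simp
    also note F(3)
    finally have "qdev 0 M (\<lambda>x. indicator A x - (\<Sum>i\<in>F. c i * (indicator U x * cyl_ind i x))) < ennreal e" .
    moreover have "(\<lambda>x. \<Sum>i\<in>F. c i * (indicator U x * cyl_ind i x)) \<in> lincomb (V \<times> UNIV) (\<lambda>i w. indicator U w * cyl_ind i w)"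
      unfolding lincomb_def using F by blast
    ultimately show "\<exists>s\<in>lincomb (V \<times> UNIV) (\<lambda>i w. indicator U w * cyl_ind i w). qdev 0 M (\<lambda>x. indicator A x - s x) < ennreal e"
      by (intro bexI[of _ "\<lambda>x. \<Sum>i\<in>F. c i * (indicator U x * cyl_ind i x)"])
  qed
  show ?thesis
  proof (rule appr_trans[where K = "V \<times> UNIV" and h = "\<lambda>i w. indicator U w * cyl_ind i w"])
    fix i :: "(int \<Rightarrow> nat) \<times> int" assume i: "i \<in> V \<times> UNIV"
    then show "(\<lambda>w. indicator U w * cyl_ind i w) \<in> borel_measurable M"
      using sets_U cyl_ind_measurable by (intro borel_measurable_times) auto
    obtain a k where ak: "i = (a, k)" using i by auto
    have "(\<lambda>w. indicator U w * cyl_ind i w) \<in> lincomb (Lam p) (\<lambda>n w. indicator U w * cnj (chi n w))"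
    proof (rule cyl_Int_U[of a k])
      assume "cyl a k \<inter> U = {}"
      then have "(\<lambda>w. indicator U w * cyl_ind i w) = (\<lambda>w. 0)"
        by (auto simp: ak cyl_ind_def indicator_def fun_eq_iff)
      then show ?thesis using lincomb_zero by simp
    next
      fix b l assume b: "b \<in> U" "0 \<le> l" "cyl a k \<inter> U = cyl b l"
      have "indicator U w * cyl_ind i w = (\<Sum>n\<in>Lam_upto l. (of_real (real p powi (- l)) * chi n b) * (indicator U w * cnj (chi n w)))" for w
      proof (cases "w \<in> U")
        case True
        \<comment> \<open>An indicator is real, so the inversion formula may be conjugated; this
          produces the conjugated characters of the family.\<close>
        have "indicator U w * cyl_ind i w = cnj (indicator (cyl b l) w)"
          using b(3) by (auto simp: ak cyl_ind_def indicator_def)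
        also have "\<dots> = (\<Sum>n\<in>Lam_upto l. (of_real (real p powi (- l)) * chi n b) * (indicator U w * cnj (chi n w)))"
          using True by (subst indicator_cyl_eq_sum[OF True b(1,2)]) (simp add: sum_distrib_left mult_ac)
        finally show ?thesis .
      qed simp
      then have "(\<lambda>w. indicator U w * cyl_ind i w)
          = (\<lambda>w. \<Sum>n\<in>Lam_upto l. (of_real (real p powi (- l)) * chi n b) * (indicator U w * cnj (chi n w)))"
        by (rule ext)
      moreover have "\<dots> \<in> lincomb (Lam p) (\<lambda>n w. indicator U w * cnj (chi n w))"
        unfolding lincomb_def using finite_Lam_upto[of l]
        by (intro CollectI exI[of _ "Lam_upto l"] exI[of _ "\<lambda>n. of_real (real p powi (- l)) * chi n b"])
           (auto simp: Lam_upto_def)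
      ultimately show ?thesis by simp
    qed
    then show "appr 0 M (Lam p) (\<lambda>n w. indicator U w * cnj (chi n w)) (\<lambda>w. indicator U w * cyl_ind i w)"
      by (rule appr_lincomb)
  qed (use A meas 2 in auto)
qed

section \<open>Enumeration of \<Lambda> and approximation on congruent sets\<close>

abbreviation lam_nat :: "nat \<Rightarrow> int \<Rightarrow> nat" where "lam_nat \<equiv> Lam_of_nat p"

lemma bij_lam_nat: "bij_betw lam_nat UNIV (Lam p)"
  unfolding Lam_of_nat_def by (rule bij_betw_inv_into[OF bij_betw_lam[OF p_ge2]])

lemma lam_nat_Lam: "lam_nat n \<in> Lam p"
  using bij_lam_nat by (auto simp: bij_betw_def)

lemma lam_nat_V: "lam_nat n \<in> V"
  by (rule Lam_V[OF lam_nat_Lam])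

lemma disjoint_cyl_lam_nat: "m \<noteq> n \<Longrightarrow> cyl (lam_nat m) 0 \<inter> cyl (lam_nat n) 0 = {}"
proof -
  assume "m \<noteq> n"
  then have "lam_nat m \<noteq> lam_nat n" using bij_lam_nat by (auto simp: bij_betw_def inj_on_def)
  moreover have "w \<notin> cyl (lam_nat n) 0" if "w \<in> cyl (lam_nat m) 0" "lam_nat m \<noteq> lam_nat n" for w
    using that in_cyl_Lam_iff[OF lam_nat_Lam, of w m] in_cyl_Lam_iff[OF lam_nat_Lam, of w n]
    by (auto simp: cyl_def)
  ultimately show ?thesis by blast
qed

lemma V_eq_UN_cyl_lam_nat: "V = (\<Union>n. cyl (lam_nat n) 0)"
proof (intro equalityI subsetI)
  fix w assume w: "w \<in> V"
  then obtain n where "trunc 0 w = lam_nat n"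
    using trunc_Lam[OF w] bij_lam_nat by (auto simp: bij_betw_def)
  then show "w \<in> (\<Union>n. cyl (lam_nat n) 0)" using in_cyl_trunc[OF w] by auto
qed (use cyl_subset_V in blast)

text \<open>On each of the countably many cosets n \<oplus> U reduction is a translation, which
  settles measurability of the image; measure is lost only where images of different pieces
  overlap.\<close>

lemma frac_image:
  assumes A: "A \<in> sets M"
  shows "frac ` A \<in> sets M" "emeasure M (frac ` A) \<le> emeasure M A"
proof -
  define B where "B n = A \<inter> cyl (lam_nat n) 0" for n
  have B: "B n \<in> sets M" for n using A sets_cyl lam_nat_V by (auto simp: B_def)
  have A_eq: "A = (\<Union>n. B n)" using V_eq_UN_cyl_lam_nat sets_subset_V[OF A] by (auto simp: B_def)
  have "frac ` B n = (\<lambda>w. w \<ominus> lam_nat n) ` B n" for n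
    by (intro image_cong refl frac_eq_sub lam_nat_Lam) (simp add: B_def)
  then have fB: "frac ` B n \<in> sets M" "emeasure M (frac ` B n) = emeasure M (B n)" for n
    using sets_sub_image[OF lam_nat_V B] by simp_all
  have fA: "frac ` A = (\<Union>n. frac ` B n)" by (subst A_eq) blast
  then show "frac ` A \<in> sets M" using fB(1) by auto
  have "emeasure M (frac ` A) \<le> (\<Sum>n. emeasure M (frac ` B n))"
    unfolding fA using fB(1) by (intro emeasure_subadditive_countably) auto
  also have "\<dots> = (\<Sum>n. emeasure M (B n))" by (simp add: fB(2))
  also have "\<dots> = emeasure M A"
  proof (subst A_eq, rule suminf_emeasure)
    show "disjoint_family B"
      using disjoint_cyl_lam_nat unfolding disjoint_family_on_def B_def by blast
  qed (use B in auto)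
  finally show "emeasure M (frac ` A) \<le> emeasure M A" .
qed

text \<open>
  Up to a null set, \<open>A\<close> is the set of points of \<open>W\<close> with reduction in \<open>frac ` A\<close>: the former is contained in the latter,
  whose measure is that of \<open>frac ` A\<close>, hence at most that of \<open>A\<close>.
\<close>

lemma appr_cong_U:
  assumes W: "cong_U W" "W \<in> sets M" and A: "A \<in> sets M" "A \<subseteq> W"
  shows "appr 0 M (Lam p) (\<lambda>n w. indicator W w * cnj (chi n w)) (indicator A)"
proof -
  note fA = frac_image[OF A(1)]
  have AV: "A \<subseteq> V" by (rule sets_subset_V[OF A(1)])
  have fAU: "frac ` A \<subseteq> U" using AV frac_U by blast
  let ?E = "W \<inter> (frac -` (frac ` A) \<inter> V)"
  have E: "?E \<in> sets M" using W sets_vimage_frac[OF fA(1)] by auto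
  have AE_sub: "A \<subseteq> ?E" using A AV by auto
  have Efin: "emeasure M ?E < \<infinity>"
    by (rule le_less_trans[OF emeasure_mono, of _ W]) (use W cong_U_emeasure[OF W] in auto)
  have "emeasure M ?E = emeasure M (U \<inter> frac ` A)" using W(1) fA(1) by (simp add: cong_U_def)
  also have "U \<inter> frac ` A = frac ` A" using fAU by blast
  finally have "emeasure M ?E \<le> emeasure M A" using fA(2) by simp
  moreover have "emeasure M A \<le> emeasure M ?E" by (rule emeasure_mono[OF AE_sub E])
  ultimately have "emeasure M ?E = emeasure M A" by (rule antisym)
  moreover have "emeasure M (?E - A) = emeasure M ?E - emeasure M A"
    using A E AE_sub Efin \<open>emeasure M ?E = emeasure M A\<close> by (intro emeasure_Diff) auto
  ultimately have "emeasure M (?E - A) = 0" using Efin by simp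
  then have null: "?E - A \<in> null_sets M" using E A by auto
  have AE: "AE w in M. (indicator A w :: complex) = indicator W w * indicator (frac ` A) (frac w)"
    using AE_not_in[OF null] AE_space
  proof eventually_elim
    case (elim w)
    then show ?case using AE_sub by (auto simp: indicator_def space_M)
  qed
  show ?thesis
    unfolding appr_def
  proof (intro allI impI)
    fix e :: real assume "0 < e"
    from apprD[OF appr_U[OF fA(1) fAU] this] obtain F c where F: "finite F" "F \<subseteq> Lam p"
      "qdev 0 M (\<lambda>x. indicator (frac ` A) x - (\<Sum>n\<in>F. c n * (indicator U x * cnj (chi n x)))) < ennreal e"
      by (auto simp: lincomb_def)
    \<comment> \<open>Written without the indicator of \<open>U\<close>, so that \<open>g\<close>
      can be composed with \<open>frac\<close> and multiplied by the indicator of either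
      set.\<close>
    define g where "g y = indicator (frac ` A) y - (\<Sum>n\<in>F. c n * cnj (chi n y))" for y
    have [measurable]: "g \<in> borel_measurable M"
      unfolding g_def using F(2) fA(1)
      by (intro borel_measurable_diff borel_measurable_sum borel_measurable_times borel_measurable_cnj
          borel_measurable_indicator borel_measurable_const measurable_pairing) (auto intro: Lam_V)
    let ?s = "\<lambda>w. \<Sum>n\<in>F. c n * (indicator W w * cnj (chi n w))"
    have "qdev 0 M (\<lambda>w. indicator A w - ?s w) = qdev 0 M (\<lambda>w. indicator W w * g (frac w))"
    proof (rule qdev_cong_AE)
      show "AE w in M. indicator A w - ?s w = indicator W w * g (frac w)"
        using AE AE_space
      proof eventually_elim
        case (elim w)
        then have w: "w \<in> V" by (simp add: space_M)
        have "(\<Sum>n\<in>F. c n * cnj (chi n (frac w))) = (\<Sum>n\<in>F. c n * cnj (chi n w))"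
          using F(2) w by (intro sum.cong refl) (auto simp: pairing_frac)
        then show ?case using elim(1) by (simp add: g_def right_diff_distrib sum_distrib_left mult_ac)
      qed
    qed
    also have "\<dots> = (\<integral>\<^sup>+w. indicator W w * ennreal ((cmod (g (frac w)))\<^sup>2) \<partial>M)"
      unfolding qdev_def by (intro nn_integral_cong) (auto simp: norm_mult indicator_def)
    also have "\<dots> = (\<integral>\<^sup>+w. indicator U w * ennreal ((cmod (g w))\<^sup>2) \<partial>M)"
      by (rule cong_U_nn_integral[OF W]) measurable
    also have "\<dots> = qdev 0 M (\<lambda>w. indicator U w * g w)"
      unfolding qdev_def by (intro nn_integral_cong) (auto simp: norm_mult indicator_def)
    also have "(\<lambda>w. indicator U w * g w) = (\<lambda>x. indicator (frac ` A) x - (\<Sum>n\<in>F. c n * (indicator U x * cnj (chi n x))))"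
      using fAU by (auto simp: g_def indicator_def fun_eq_iff)
    also note F(3)
    finally have "qdev 0 M (\<lambda>w. indicator A w - ?s w) < ennreal e" .
    moreover have "?s \<in> lincomb (Lam p) (\<lambda>n w. indicator W w * cnj (chi n w))"
      unfolding lincomb_def using F by blast
    ultimately show "\<exists>s\<in>lincomb (Lam p) (\<lambda>n w. indicator W w * cnj (chi n w)).
        qdev 0 M (\<lambda>w. indicator A w - s w) < ennreal e"
      by (intro bexI[of _ ?s])
  qed
qed

subsection \<open>Dilated and modulated indicators\<close>

definition dil :: "(int \<Rightarrow> nat) set \<Rightarrow> int \<Rightarrow> (int \<Rightarrow> nat) set" where
  "dil W j = sigma_pow (- j) ` W"

text \<open>\<open>wav W j n\<close> is the Fourier transform of \<open>\<psi>\<^bsub>j,n\<^esub>\<close> for \<open>\<psi>\<close> the inverse transform of the indicator of \<open>W\<close>; it lives on \<open>dil W j = \<rho>\<^sup>j(W)\<close>.\<close>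

definition wav :: "(int \<Rightarrow> nat) set \<Rightarrow> int \<Rightarrow> (int \<Rightarrow> nat) \<Rightarrow> (int \<Rightarrow> nat) \<Rightarrow> complex" where
  "wav W j n w = of_real (real p powr (- (real_of_int j / 2))) *
     (indicator W (sigma_pow j w) * cnj (chi n (sigma_pow j w)))"

lemma in_dil_iff: "W \<subseteq> V \<Longrightarrow> w \<in> V \<Longrightarrow> w \<in> dil W j \<longleftrightarrow> sigma_pow j w \<in> W"
  by (simp add: dil_def sigma_image_eq) (simp add: sigma_eq_rho)

lemma sets_dil: "W \<in> sets M \<Longrightarrow> dil W j \<in> sets M"
  unfolding dil_def by (rule sets_sigma_image)

lemma emeasure_dil: "W \<in> sets M \<Longrightarrow> emeasure M (dil W j) = ennreal (real p powi j) * emeasure M W"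
  unfolding dil_def by (simp add: sets_sigma_image)

text \<open>The substitution by \<open>sigma_pow j\<close> has Jacobian p^j. It turns the factor
  p^(-j/2) of \<open>wav\<close> into the p^(j/2) of the dilated function, and cancels the product
  of two such factors in an inner product.\<close>

lemma powr_half_mult:
  "real p powr (- (real_of_int j / 2)) * real p powi j = real p powr (real_of_int j / 2)"
  "real p powr (- (real_of_int j / 2)) * real p powr (- (real_of_int j / 2)) * real p powi j = 1"
proof -
  have *: "real p powi j = real p powr real_of_int j"
    using p_pos by (simp add: powr_real_of_int')
  show "real p powr (- (real_of_int j / 2)) * real p powi j = real p powr (real_of_int j / 2)"
    unfolding * powr_add[symmetric] by simp
  show "real p powr (- (real_of_int j / 2)) * real p powr (- (real_of_int j / 2)) * real p powi j = 1"
    unfolding * powr_add[symmetric] using p_pos by simp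
qed

lemma integral_sigma:
  fixes f :: "(int \<Rightarrow> nat) \<Rightarrow> complex"
  assumes "f \<in> borel_measurable M"
  shows "(\<integral>w. f (sigma_pow j w) \<partial>M) = of_real (real p powi j) * (\<integral>w. f w \<partial>M)"
  using integral_rho[OF assms, of "- j"] by (simp add: sigma_eq_rho)

lemma qdev_sigma:
  assumes [measurable]: "f \<in> borel_measurable M"
  shows "qdev 0 M (\<lambda>w. f (sigma_pow j w)) = ennreal (real p powi j) * qdev 0 M f"
  unfolding qdev_def sigma_eq_rho
  by (subst nn_integral_rho[of "\<lambda>w. ennreal (0 * cmod (f w) + (cmod (f w))\<^sup>2)"]) simp_all

text \<open>Substituting \<open>sigma_pow j\<close> in the integral undoes the dilation across the
  pairing, and the translation by \<open>n\<close> becomes the conjugated character.\<close>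

lemma dilate_translate_eq_IF_wav:
  assumes W: "W \<in> sets M" and n: "n \<in> V" and x: "x \<in> V"
  shows "dilate_translate p (IF (indicator W)) j n x = IF (wav W j n) x"
proof -
  define h where "h v = indicator W v * cnj (chi n v) * chi (rho_pow j x) v" for v
  have [measurable]: "h \<in> borel_measurable M"
    unfolding h_def using W n x rho_V
    by (intro borel_measurable_times borel_measurable_cnj borel_measurable_indicator measurable_pairing) auto
  have "IF (indicator W) (rho_pow j x \<ominus> n) = (\<integral>v. h v \<partial>M)"
    unfolding inverse_fourier_def h_def using n rho_V[OF x]
    by (intro Bochner_Integration.integral_cong) (simp_all add: space_M pairing_sub_left)
  moreover have "IF (wav W j n) x = of_real (real p powr (- (real_of_int j / 2))) * (\<integral>w. h (sigma_pow j w) \<partial>M)"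
  proof -
    have "IF (wav W j n) x = (\<integral>w. of_real (real p powr (- (real_of_int j / 2))) * h (sigma_pow j w) \<partial>M)"
      unfolding inverse_fourier_def h_def wav_def pairing_rho by (simp add: mult.assoc)
    then show ?thesis by simp
  qed
  ultimately show ?thesis
    by (simp add: dilate_translate_def integral_sigma powr_half_mult(1)[symmetric, of j])
qed

lemma wav_measurable:
  assumes W: "W \<in> sets M" and n: "n \<in> V"
  shows "wav W j n \<in> borel_measurable M"
proof -
  have "(\<lambda>v. indicator W v * cnj (chi n v)) \<in> borel_measurable M"
    using W n by (intro borel_measurable_times borel_measurable_cnj) auto
  from borel_measurable_times[OF borel_measurable_const measurable_compose[OF measurable_sigma this]]
  show ?thesis unfolding wav_def .
qed

lemma wav_integrable:
  assumes W: "W \<in> sets M" "emeasure M W < \<infinity>" and n: "n \<in> V"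
  shows "integrable M (wav W j n)" "wav W j n \<in> L2 M"
proof -
  let ?c = "of_real (real p powr (- (real_of_int j / 2))) :: complex"
  have "qdev 1 M (wav W j n) \<le> qdev 1 M (\<lambda>w. ?c * indicator (dil W j) w)"
  proof (rule qdev_mono)
    fix w assume "w \<in> space M"
    then show "cmod (wav W j n w) \<le> cmod (?c * indicator (dil W j) w)"
      using in_dil_iff[OF sets_subset_V[OF W(1)], of w j]
      by (auto simp: wav_def norm_mult space_M indicator_def)
  qed simp
  also have "\<dots> \<le> ennreal (cmod ?c + (cmod ?c)\<^sup>2) * qdev 1 M (indicator (dil W j))"
    using sets_dil[OF W(1)] by (intro qdev_cmult) auto
  also have "\<dots> < \<infinity>"
    using W by (subst qdev_indicator) (simp_all add: sets_dil emeasure_dil ennreal_mult_less_top)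
  finally show "integrable M (wav W j n)" "wav W j n \<in> L2 M"
    using qdev_finite_iff(1)[OF wav_measurable[OF W(1) n]] by auto
qed

text \<open>The change of variables removes the level \<open>j\<close> altogether. The second factor
  is conjugated, so its character appears unconjugated and the difference is
  \<open>m \<ominus> n\<close>.\<close>

lemma wav_inner:
  assumes W: "W \<in> sets M" and n: "n \<in> Lam p" "m \<in> Lam p"
  shows "L2_inner M (wav W j n) (wav W j m) = (\<integral>w. indicator W w * chi (m \<ominus> n) w \<partial>M)"
proof -
  let ?c = "real p powr (- (real_of_int j / 2))"
  define h where "h w = indicator W w * chi (m \<ominus> n) w" for w
  have h: "h \<in> borel_measurable M"
    unfolding h_def using W n sub_V Lam_V by (intro borel_measurable_times) auto
  have "L2_inner M (wav W j n) (wav W j m) = (\<integral>w. of_real (?c * ?c) * h (sigma_pow j w) \<partial>M)"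
    unfolding L2_inner_def
  proof (intro Bochner_Integration.integral_cong refl)
    fix w assume "w \<in> space M"
    then have "sigma_pow j w \<in> V" by (simp add: space_M sigma_V)
    then show "wav W j n w * cnj (wav W j m w) = of_real (?c * ?c) * h (sigma_pow j w)"
      using n by (simp add: wav_def h_def pairing_sub_left Lam_V indicator_def)
  qed
  also have "\<dots> = of_real (?c * ?c * real p powi j) * (\<integral>w. h w \<partial>M)"
    by (simp add: integral_sigma[OF h])
  also have "\<dots> = (\<integral>w. h w \<partial>M)" by (simp only: powr_half_mult(2) of_real_1 mult_1_left)
  finally show ?thesis by (simp only: h_def)
qed

lemma wav_inner_cong_U:
  assumes W: "cong_U W" "W \<in> sets M" and n: "n \<in> Lam p" "m \<in> Lam p"
  shows "L2_inner M (wav W j n) (wav W j m) = (if n = m then 1 else 0)"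
proof -
  have "m \<ominus> n = \<zero> \<longleftrightarrow> n = m"
    using sub_digit_zero_iff[of m n] n Lam_V by (auto simp: fun_eq_iff)
  then show ?thesis
    using cong_U_integral_pairing[OF W Lam_sub[OF n(2,1)]] by (simp add: wav_inner[OF W(2) n])
qed

text \<open>The level 0 case \<open>appr_cong_U\<close>, applied to the image \<open>B\<close> of
  \<open>A\<close> inside \<open>W\<close> and pulled back along \<open>sigma_pow j\<close>.\<close>

lemma appr_wav:
  assumes W: "cong_U W" "W \<in> sets M" and A: "A \<in> sets M" "A \<subseteq> dil W j"
  shows "appr 0 M (Lam p) (wav W j) (indicator A)"
  unfolding appr_def
proof (intro allI impI)
  fix e :: real assume e: "0 < e"
  let ?c = "real p powr (- (real_of_int j / 2))"
  have c: "?c \<noteq> 0" using p_pos by simp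
  define B where "B = sigma_pow j ` A"
  have AV: "A \<subseteq> V" by (rule sets_subset_V[OF A(1)])
  have B: "B \<in> sets M" unfolding B_def by (rule sets_sigma_image[OF A(1)])
  have BW: "B \<subseteq> W" using A(2) AV in_dil_iff[OF sets_subset_V[OF W(2)]] by (auto simp: B_def)
  have ind: "indicator A w = (indicator B (sigma_pow j w) :: complex)" for w
  proof -
    have "sigma_pow j w \<in> B \<longleftrightarrow> w \<in> A"
      unfolding B_def by (metis image_iff rho_sigma_apply(1))
    then show ?thesis by (simp add: indicator_def)
  qed
  have P: "0 < real p powi j" using p_pos by simp
  \<comment> \<open>The pull-back multiplies squared norms by p^j, hence the rescaled
    tolerance.\<close>
  then have "0 < e / real p powi j" using e by simp
  from apprD[OF appr_cong_U[OF W B BW] this] obtain F c where F: "finite F" "F \<subseteq> Lam p"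
    "qdev 0 M (\<lambda>w. indicator B w - (\<Sum>n\<in>F. c n * (indicator W w * cnj (chi n w)))) < ennreal (e / real p powi j)"
    by (auto simp: lincomb_def)
  define g where "g w = indicator B w - (\<Sum>n\<in>F. c n * (indicator W w * cnj (chi n w)))" for w
  have g: "g \<in> borel_measurable M"
    unfolding g_def using F(2) B W(2)
    by (intro borel_measurable_diff borel_measurable_sum borel_measurable_times borel_measurable_cnj
        borel_measurable_indicator borel_measurable_const measurable_pairing) (auto intro: Lam_V)
  let ?s = "\<lambda>w. \<Sum>n\<in>F. (c n / of_real ?c) * wav W j n w"
  have "indicator A w - ?s w = g (sigma_pow j w)" for w
    using c by (simp add: g_def ind wav_def)
  then have "qdev 0 M (\<lambda>w. indicator A w - ?s w) = ennreal (real p powi j) * qdev 0 M g"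
    using qdev_sigma[OF g, of j] by simp
  also have "\<dots> < ennreal (real p powi j) * ennreal (e / real p powi j)"
    using F(3) P unfolding g_def by (intro ennreal_mult_strict_left_mono) auto
  also have "\<dots> = ennreal (real p powi j * (e / real p powi j))"
    using P e by (intro ennreal_mult[symmetric]) (simp_all only: less_imp_le divide_nonneg_pos)
  also have "real p powi j * (e / real p powi j) = e"
    using P by (simp only: times_divide_eq_right nonzero_mult_div_cancel_left less_imp_neq[symmetric] simp_thms)
  finally have "qdev 0 M (\<lambda>w. indicator A w - ?s w) < ennreal e" .
  moreover have "?s \<in> lincomb (Lam p) (wav W j)"
    unfolding lincomb_def using F(1,2)
    by (intro CollectI exI[of _ F] exI[of _ "\<lambda>n. c n / of_real ?c"]) simp
  ultimately show "\<exists>s\<in>lincomb (Lam p) (wav W j). qdev 0 M (\<lambda>w. indicator A w - s w) < ennreal e"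
    by (intro bexI[of _ ?s])
qed

subsection \<open>The frequency side of the theorem\<close>

abbreviation wav_family ::
    "(nat \<Rightarrow> (int \<Rightarrow> nat) set) \<Rightarrow> nat \<times> int \<times> (int \<Rightarrow> nat) \<Rightarrow> (int \<Rightarrow> nat) \<Rightarrow> complex" where
  "wav_family \<Omega> \<equiv> \<lambda>(u, j, n). wav (\<Omega> u) j n"

text \<open>For density, a set of finite measure is cut along an enumeration of the supports, made
  disjoint; each part lies in one support and is approximated by the functions of that single level
  and generator.\<close>

lemma wav_family_basis_if:
  fixes P :: "nat set"
  assumes sets: "\<And>u. u \<in> P \<Longrightarrow> \<Omega> u \<in> sets M" and cong: "\<And>u. u \<in> P \<Longrightarrow> cong_U (\<Omega> u)"
    and disj: "\<And>u v j k. u \<in> P \<Longrightarrow> v \<in> P \<Longrightarrow> u \<noteq> v \<or> j \<noteq> k \<Longrightarrow> emeasure M (dil (\<Omega> u) j \<inter> dil (\<Omega> v) k) = 0"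
    and cover: "emeasure M (V - (\<Union>j. \<Union>u\<in>P. dil (\<Omega> u) j)) = 0"
  shows "orthonormal_basis_L2 M (P \<times> UNIV \<times> Lam p) (wav_family \<Omega>)"
proof -
  have fin: "emeasure M (\<Omega> u) < \<infinity>" if "u \<in> P" for u
    using cong_U_emeasure[OF cong[OF that] sets[OF that]] by simp
  let ?I = "P \<times> (UNIV :: int set) \<times> Lam p"
  have L2: "wav_family \<Omega> i \<in> L2 M" if "i \<in> ?I" for i
    using that wav_integrable(2)[OF sets fin] Lam_V by auto
  then have meas: "wav_family \<Omega> i \<in> borel_measurable M" if "i \<in> ?I" for i
    using that by (simp add: L2_def)
  have orth: "L2_inner M (wav_family \<Omega> (u, j, n)) (wav_family \<Omega> (v, k, m)) = (if (u, j, n) = (v, k, m) then 1 else 0)"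
    if i: "u \<in> P" "n \<in> Lam p" "v \<in> P" "m \<in> Lam p" for u j n v k m
  proof (cases "u = v \<and> j = k")
    case True
    then show ?thesis using wav_inner_cong_U[OF cong sets] i by simp
  next
    case False
    then have "emeasure M (dil (\<Omega> u) j \<inter> dil (\<Omega> v) k) = 0" using disj[OF i(1,3)] by blast
    then have null: "dil (\<Omega> u) j \<inter> dil (\<Omega> v) k \<in> null_sets M"
      using sets_dil[OF sets] i by (auto intro!: null_setsI)
    have "AE w in M. wav (\<Omega> u) j n w * cnj (wav (\<Omega> v) k m w) = 0"
      using AE_not_in[OF null] AE_space
    proof eventually_elim
      case (elim w)
      then have "w \<in> V" by (simp add: space_M)
      then have "sigma_pow j w \<notin> \<Omega> u \<or> sigma_pow k w \<notin> \<Omega> v"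
        using elim(1) in_dil_iff[OF sets_subset_V[OF sets]] i by blast
      then show ?case by (auto simp: wav_def)
    qed
    then have "L2_inner M (wav (\<Omega> u) j n) (wav (\<Omega> v) k m) = 0"
      unfolding L2_inner_def by (rule integral_eq_zero_AE)
    then show ?thesis using False by auto
  qed
  have complete: "appr 0 M ?I (wav_family \<Omega>) (indicator A)" if A: "A \<in> sets M" "emeasure M A < \<infinity>" for A
  \<comment> \<open>\<open>from_nat_into\<close> needs a nonempty set to enumerate. For empty
    \<open>P\<close> the covering hypothesis makes the whole space null.\<close>
  proof (cases "P = {}")
    case True
    then have "emeasure M V = 0" using cover by simp
    then have "V \<in> null_sets M" using sets.top[of M] by (auto simp: space_M intro!: null_setsI)
    from AE_not_in[OF this] AE_space have "AE w in M. (0 :: complex) = indicator A w"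
      by eventually_elim (simp add: space_M)
    then show ?thesis by (rule appr_AE) (rule appr_lincomb[OF lincomb_zero])
  next
    case False
    define t where "t = from_nat_into (P \<times> (UNIV :: int set))"
    have T: "countable (P \<times> (UNIV :: int set))" "P \<times> (UNIV :: int set) \<noteq> {}"
      using False by auto
    have t: "fst (t i) \<in> P" for i
      using from_nat_into[OF T(2), of i] unfolding t_def by (auto simp: mem_Times_iff)
    define S where "S i = dil (\<Omega> (fst (t i))) (snd (t i))" for i
    have S: "S i \<in> sets M" for i unfolding S_def by (intro sets_dil sets t)
    have UN_S: "(\<Union>i. S i) = (\<Union>j. \<Union>u\<in>P. dil (\<Omega> u) j)"
    proof -
      have "range t = P \<times> UNIV" unfolding t_def by (rule range_from_nat_into[OF T(2,1)])
      moreover have "(\<Union>i. S i) = (\<Union>x\<in>range t. dil (\<Omega> (fst x)) (snd x))" by (simp add: S_def)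
      ultimately have "(\<Union>i. S i) = (\<Union>x\<in>P \<times> UNIV. dil (\<Omega> (fst x)) (snd x))" by (simp only:)
      also have "\<dots> = (\<Union>j. \<Union>u\<in>P. dil (\<Omega> u) j)" by auto blast
      finally show ?thesis .
    qed
    define D where "D i = A \<inter> disjointed S i" for i
    have dS: "disjointed S i \<in> sets M" for i
      using sets.range_disjointed_sets[of S M] S by auto
    have D: "D i \<in> sets M" for i using A(1) dS by (auto simp: D_def)
    have UN_D: "(\<Union>i. D i) = A \<inter> (\<Union>i. S i)" using UN_disjointed_eq[of S] by (auto simp: D_def)
    have "appr 0 M ?I (wav_family \<Omega>) (indicator (\<Union>i. D i))"
    proof (rule appr_indicator_UN)
      fix i
      have "D i \<subseteq> dil (\<Omega> (fst (t i))) (snd (t i))"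
        using disjointed_subset[of S i] by (auto simp: D_def S_def)
      from appr_wav[OF cong[OF t] sets[OF t] D this]
      show "appr 0 M ?I (wav_family \<Omega>) (indicator (D i))"
        by (rule appr_reindex[where h = "\<lambda>n. (fst (t i), snd (t i), n)"]) (simp add: t)
      show "disjoint_family D"
        using disjoint_family_disjointed[of S] by (auto simp: D_def disjoint_family_on_def)
      show "emeasure M (\<Union>i. D i) < \<infinity>"
        by (rule le_less_trans[OF emeasure_mono A(2)]) (auto simp: UN_D A(1))
    qed (use D meas in auto)
    moreover have "AE w in M. (indicator (\<Union>i. D i) w :: complex) = indicator A w"
    proof -
      have "V - (\<Union>i. S i) \<in> null_sets M"
      proof (rule null_setsI)
        show "emeasure M (V - (\<Union>i. S i)) = 0" using cover by (simp only: UN_S)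
        show "V - (\<Union>i. S i) \<in> sets M" using sets.top[of M] S by (auto simp: space_M)
      qed
      from AE_not_in[OF this] AE_space show ?thesis
        by eventually_elim (auto simp: UN_D indicator_def space_M)
    qed
    ultimately show ?thesis using appr_AE by blast
  qed
  have "appr 0 M ?I (wav_family \<Omega>) f" if "f \<in> L2 M" for f
  proof (rule appr_trans[where K = "{A \<in> sets M. emeasure M A < \<infinity>}" and h = indicator])
    show "appr 0 M {A \<in> sets M. emeasure M A < \<infinity>} indicator f"
      using that qdev_finite_iff(2)[of f M] by (intro appr_indicators) (auto simp: L2_def)
  qed (use that complete meas in \<open>auto simp: L2_def\<close>)
  then show ?thesis
    unfolding orthonormal_basis_L2_iff_appr
  proof (intro conjI ballI)
    fix i k assume "i \<in> ?I" "k \<in> ?I"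
    moreover obtain u j n where i: "i = (u, j, n)" by (cases i)
    moreover obtain v l m where k: "k = (v, l, m)" by (cases k)
    ultimately have "u \<in> P" "n \<in> Lam p" "v \<in> P" "m \<in> Lam p" by auto
    from orth[OF this] show "L2_inner M (wav_family \<Omega> i) (wav_family \<Omega> k) = (if i = k then 1 else 0)"
      unfolding i k .
  qed (use L2 in blast)+
qed

text \<open>The orthonormality relations at level 0 with one translation parameter equal to zero
  list the Fourier coefficients of the indicator of \<open>\<Omega> u\<close> along
  \<Lambda>.\<close>

lemma wav_family_basis_cong_U:
  assumes basis: "orthonormal_basis_L2 M (P \<times> UNIV \<times> Lam p) (wav_family \<Omega>)"
    and u: "u \<in> P" "\<Omega> u \<in> sets M" "emeasure M (\<Omega> u) < \<infinity>"
  shows "cong_U (\<Omega> u)"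
proof (rule cong_U_if_integral_pairing[OF u(2,3)])
  fix q assume q: "q \<in> Lam p"
  have "L2_inner M (wav_family \<Omega> (u, 0, \<zero>)) (wav_family \<Omega> (u, 0, q)) = (if (u, 0 :: int, \<zero>) = (u, 0, q) then 1 else 0)"
    using basis u(1) q zero_Lam unfolding orthonormal_basis_L2_def by blast
  moreover have "q \<ominus> \<zero> = q" using add_sub_cancel[OF Lam_V[OF q] zero_V] Lam_V[OF q] by simp
  ultimately show "(\<integral>w. indicator (\<Omega> u) w * chi q w \<partial>M) = (if q = \<zero> then 1 else 0)"
    using wav_inner[OF u(2) zero_Lam q, of 0] by (auto split: if_splits)
qed

text \<open>
  The indicator of the intersection is approximated both by combinations \<open>f\<close> of one subfamily and \<open>g\<close> of the other;
  as \<open>f\<close> and \<open>g\<close> are orthogonal and close to each other, both are small.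
\<close>

lemma wav_family_basis_disjoint:
  assumes basis: "orthonormal_basis_L2 M (P \<times> UNIV \<times> Lam p) (wav_family \<Omega>)"
    and sets: "\<And>u. u \<in> P \<Longrightarrow> \<Omega> u \<in> sets M" and fin: "\<And>u. u \<in> P \<Longrightarrow> emeasure M (\<Omega> u) < \<infinity>"
    and uv: "u \<in> P" "v \<in> P" "u \<noteq> v \<or> j \<noteq> k"
  shows "emeasure M (dil (\<Omega> u) j \<inter> dil (\<Omega> v) k) = 0"
proof (rule eq_0_if_le_all_ennreal)
  let ?E = "dil (\<Omega> u) j \<inter> dil (\<Omega> v) k"
  have E: "?E \<in> sets M" using sets_dil sets uv by blast
  have Em: "(indicator ?E :: _ \<Rightarrow> complex) \<in> borel_measurable M" using E by simp
  fix e :: real assume e: "0 < e"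
  have "appr 0 M (Lam p) (wav (\<Omega> u) j) (indicator ?E)"
    using basis sets fin uv E by (intro appr_wav wav_family_basis_cong_U[OF basis]) auto
  from apprD[OF this e] obtain F c where F: "finite F" "F \<subseteq> Lam p"
    "qdev 0 M (\<lambda>w. indicator ?E w - (\<Sum>n\<in>F. c n * wav (\<Omega> u) j n w)) < ennreal e"
    by (auto simp: lincomb_def)
  have "appr 0 M (Lam p) (wav (\<Omega> v) k) (indicator ?E)"
    using basis sets fin uv E by (intro appr_wav wav_family_basis_cong_U[OF basis]) auto
  from apprD[OF this e] obtain G b where G: "finite G" "G \<subseteq> Lam p"
    "qdev 0 M (\<lambda>w. indicator ?E w - (\<Sum>n\<in>G. b n * wav (\<Omega> v) k n w)) < ennreal e"
    by (auto simp: lincomb_def)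
  let ?f = "\<lambda>w. \<Sum>n\<in>F. c n * wav (\<Omega> u) j n w" and ?g = "\<lambda>w. \<Sum>n\<in>G. b n * wav (\<Omega> v) k n w"
  have wL2: "wav (\<Omega> u) j n \<in> L2 M" "wav (\<Omega> v) k n \<in> L2 M" if "n \<in> Lam p" for n
    using wav_integrable(2) sets fin uv that Lam_V by auto
  have f: "?f \<in> L2 M" and g: "?g \<in> L2 M" using wL2 F(2) G(2) by (auto intro!: L2_sum)
  have fm: "?f \<in> borel_measurable M" and gm: "?g \<in> borel_measurable M"
    using f g by (auto simp: L2_def)
  have orth: "L2_inner M (wav (\<Omega> u) j n) (wav (\<Omega> v) k m) = 0" if "n \<in> Lam p" "m \<in> Lam p" for n m
  proof -
    have "L2_inner M (wav_family \<Omega> (u, j, n)) (wav_family \<Omega> (v, k, m)) = (if (u, j, n) = (v, k, m) then 1 else 0)"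
      using basis uv(1,2) that unfolding orthonormal_basis_L2_def by blast
    then show ?thesis using uv(3) by auto
  qed
  have "L2_inner M ?f ?g = (\<Sum>n\<in>F. c n * L2_inner M (wav (\<Omega> u) j n) ?g)"
    using F wL2 g by (intro L2_inner_sum_left) auto
  also have "\<dots> = (\<Sum>n\<in>F. c n * (\<Sum>m\<in>G. cnj (b m) * L2_inner M (wav (\<Omega> u) j n) (wav (\<Omega> v) k m)))"
    using F G wL2 by (intro sum.cong refl arg_cong2[where f = "(*)"] L2_inner_sum_right) auto
  also have "\<dots> = (\<Sum>n\<in>F. c n * (\<Sum>m\<in>G. cnj (b m) * 0))"
  proof (intro sum.cong refl arg_cong2[where f = "(*)"])
    fix n m assume "n \<in> F" "m \<in> G"
    with F(2) G(2) show "L2_inner M (wav (\<Omega> u) j n) (wav (\<Omega> v) k m) = 0" by (intro orth) auto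
  qed
  also have "\<dots> = 0" by simp
  finally have "L2_inner M ?f ?g = 0" .
  from qdev_le_diff_if_orthogonal[OF f g this]
  have "qdev 0 M ?f \<le> qdev 0 M (\<lambda>w. ?f w - ?g w)" .
  also have "\<dots> \<le> 2 * qdev 0 M (\<lambda>w. ?f w - indicator ?E w) + 2 * qdev 0 M (\<lambda>w. indicator ?E w - ?g w)"
    by (intro qdev_triangle fm gm Em) simp
  also have "qdev 0 M (\<lambda>w. ?f w - indicator ?E w) = qdev 0 M (\<lambda>w. indicator ?E w - ?f w)"
    by (rule qdev_minus_commute)
  also have "2 * \<dots> + 2 * qdev 0 M (\<lambda>w. indicator ?E w - ?g w) \<le> 2 * ennreal e + 2 * ennreal e"
    using F(3) G(3) by (intro add_mono mult_left_mono) auto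
  finally have qf: "qdev 0 M ?f \<le> 2 * ennreal e + 2 * ennreal e" .
  have "emeasure M ?E = qdev 0 M (indicator ?E)" by (simp add: qdev_indicator[OF _ E])
  also have "\<dots> = qdev 0 M (\<lambda>w. (indicator ?E w - ?f w) + ?f w)" by simp
  also have "\<dots> \<le> 2 * qdev 0 M (\<lambda>w. indicator ?E w - ?f w) + 2 * qdev 0 M ?f"
    by (intro qdev_add borel_measurable_diff fm Em) simp
  also have "\<dots> \<le> 2 * ennreal e + 2 * (2 * ennreal e + 2 * ennreal e)"
    using F(3) qf by (intro add_mono mult_left_mono) auto
  \<comment> \<open>The difference from \<open>?f\<close> contributes 2, and \<open>?f\<close>
    itself 2 (2 + 2).\<close>
  also have "\<dots> = ennreal (10 * e)"
    using e by (simp add: ennreal_mult flip: distrib_right mult.assoc)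
  finally show "emeasure M ?E \<le> ennreal (10 * e)" .
qed simp

text \<open>Every function of the system vanishes on the uncovered set, so no combination comes
  closer than 0 to the indicator of a part of it. Cutting with cylinders makes the part square
  integrable.\<close>

lemma wav_family_basis_cover:
  fixes P :: "nat set"
  assumes basis: "orthonormal_basis_L2 M (P \<times> UNIV \<times> Lam p) (wav_family \<Omega>)"
    and sets: "\<And>u. u \<in> P \<Longrightarrow> \<Omega> u \<in> sets M"
  shows "emeasure M (V - (\<Union>j. \<Union>u\<in>P. dil (\<Omega> u) j)) = 0"
proof -
  let ?Z = "V - (\<Union>j. \<Union>u\<in>P. dil (\<Omega> u) j)"
  have "V \<in> sets M" using sets.top[of M] by (simp add: space_M)
  moreover have "(\<Union>u\<in>P. dil (\<Omega> u) j) \<in> sets M" for j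
    using sets_dil[OF sets] by (intro sets.countable_UN') auto
  ultimately have Z: "?Z \<in> sets M" by auto
  have null: "?Z \<inter> cyl \<zero> (- int m) \<in> null_sets M" for m
  proof (rule null_setsI)
    let ?B = "?Z \<inter> cyl \<zero> (- int m)"
    show B: "?B \<in> sets M" using Z sets_cyl[OF zero_V] by blast
    have Bfin: "emeasure M ?B < \<infinity>"
      by (rule le_less_trans[OF emeasure_mono emeasure_cyl_finite[OF zero_V, of "- int m"]])
         (use sets_cyl[OF zero_V] in auto)
    show "emeasure M ?B = 0"
    proof (rule eq_0_if_le_all_ennreal)
      fix e :: real assume e: "0 < e"
      have "indicator ?B \<in> L2 M"
        using B Bfin qdev_finite_iff(2)[of "indicator ?B" M] by (simp add: qdev_indicator)
      then have "appr 0 M (P \<times> UNIV \<times> Lam p) (wav_family \<Omega>) (indicator ?B)"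
        using basis unfolding orthonormal_basis_L2_iff_appr by blast
      from apprD[OF this e] obtain F c where F: "finite F" "F \<subseteq> P \<times> UNIV \<times> Lam p"
        "qdev 0 M (\<lambda>w. indicator ?B w - (\<Sum>i\<in>F. c i * wav_family \<Omega> i w)) < ennreal e"
        by (auto simp: lincomb_def)
      have "emeasure M ?B = qdev 0 M (indicator ?B)" by (simp add: qdev_indicator[OF _ B])
      also have "\<dots> \<le> qdev 0 M (\<lambda>w. indicator ?B w - (\<Sum>i\<in>F. c i * wav_family \<Omega> i w))"
      proof (rule qdev_mono)
        fix w assume "w \<in> space M"
        show "cmod (indicator ?B w) \<le> cmod (indicator ?B w - (\<Sum>i\<in>F. c i * wav_family \<Omega> i w))"
        proof (cases "w \<in> ?B")
          case True
          have "wav_family \<Omega> i w = 0" if i: "i \<in> F" for i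
          proof -
            obtain u j n where ujn: "i = (u, j, n)" "u \<in> P" using F(2) i by auto
            then have "w \<notin> dil (\<Omega> u) j" using True by blast
            then have "sigma_pow j w \<notin> \<Omega> u"
              using in_dil_iff[OF sets_subset_V[OF sets[OF ujn(2)]]] True by blast
            then show ?thesis by (simp add: ujn wav_def)
          qed
          then show ?thesis by simp
        qed simp
      qed simp
      also have "\<dots> \<le> ennreal (1 * e)" using F(3) by simp
      finally show "emeasure M ?B \<le> ennreal (1 * e)" .
    qed simp
  qed
  have "(\<Union>m. ?Z \<inter> cyl \<zero> (- int m)) = ?Z"
    unfolding Int_UN_distrib[symmetric] V_eq_UN_cyl[symmetric] by blast
  moreover have "(\<Union>m. ?Z \<inter> cyl \<zero> (- int m)) \<in> null_sets M" using null by (intro null_sets_UN)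
  ultimately show ?thesis by (simp add: null_setsD1)
qed

section \<open>Partitions and equality of measures\<close>

abbreviation shift :: "nat \<Rightarrow> (int \<Rightarrow> nat) set \<Rightarrow> (int \<Rightarrow> nat) set" where
  "shift n A \<equiv> (\<lambda>w. w \<ominus> lam_nat n) ` A"

text \<open>Inclusion of the translates in \<open>U\<close> forces each piece into a single coset of
  \<open>U\<close>, where reduction is subtraction of the index. The measure of a preimage of
  \<open>A\<close> is thus the sum of the measures of the parts of the translates in
  \<open>A\<close>, and the translates tile \<open>U\<close> up to a null set.\<close>

lemma cong_U_if_partition:
  fixes N :: "nat set" and Y :: "nat \<Rightarrow> (int \<Rightarrow> nat) set"
  assumes Y: "\<And>n. n \<in> N \<Longrightarrow> Y n \<in> sets M" "disjoint_family_on Y N" "(\<Union>n\<in>N. Y n) = W"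
    and null: "\<And>m n. m \<in> N \<Longrightarrow> n \<in> N \<Longrightarrow> m \<noteq> n \<Longrightarrow>
      emeasure M (shift m (Y m) \<inter> shift n (Y n)) = 0"
    and sub: "(\<Union>n\<in>N. shift n (Y n)) \<subseteq> U"
    and cover: "emeasure M (U - (\<Union>n\<in>N. shift n (Y n))) = 0"
  shows "cong_U W"
  unfolding cong_U_def
proof
  fix A assume A: "A \<in> sets M"
  \<comment> \<open>Indices outside \<open>N\<close> are padded with the empty set, to have a
    sequence for countable additivity.\<close>
  define B where "B n = (if n \<in> N then Y n else {})" for n
  define X where "X n = shift n (B n)" for n
  have B: "B n \<in> sets M" for n using Y(1) by (simp add: B_def)
  have X: "X n \<in> sets M" for n unfolding X_def by (rule sets_sub_image[OF lam_nat_V B])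
  have UN_B: "(\<Union>n. B n) = W" using Y(3) by (auto simp: B_def split: if_splits)
  have UN_X: "(\<Union>n. X n) = (\<Union>n\<in>N. shift n (Y n))"
  proof -
    have "X n = {}" if "n \<notin> N" for n using that by (simp add: X_def B_def)
    then have "(\<Union>n. X n) = (\<Union>n\<in>N. X n)" by blast
    then show ?thesis by (simp add: X_def B_def)
  qed
  have disj: "disjoint_family B"
    using Y(2) by (auto simp: disjoint_family_on_def B_def)
  have frac_B: "frac w = w \<ominus> lam_nat n" if "w \<in> B n" for w n
  proof -
    have "w \<in> V" using sets_subset_V[OF B] that by blast
    moreover have "w \<ominus> lam_nat n \<in> U" using sub that UN_X unfolding X_def by blast
    ultimately show ?thesis
      using frac_eq_sub[OF lam_nat_Lam] sub_in_U_iff[OF lam_nat_Lam] by blast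
  qed
  define E where "E n = B n \<inter> (frac -` A \<inter> V)" for n
  have E: "E n \<in> sets M" for n using B sets_vimage_frac[OF A] by (auto simp: E_def)
  have emeasure_E: "emeasure M (E n) = emeasure M (X n \<inter> A)" for n
  proof -
    have "shift n (E n) = X n \<inter> A"
    proof (intro equalityI subsetI)
      fix y assume "y \<in> shift n (E n)"
      then obtain w where w: "w \<in> E n" "y = w \<ominus> lam_nat n" by blast
      then have "w \<in> B n" "frac w \<in> A" by (auto simp: E_def)
      then show "y \<in> X n \<inter> A" using frac_B[of w n] w(2) by (auto simp: X_def)
    next
      fix y assume y: "y \<in> X n \<inter> A"
      then obtain w where w: "w \<in> B n" "y = w \<ominus> lam_nat n" by (auto simp: X_def)
      then have "w \<in> E n" using frac_B[of w n] y sets_subset_V[OF B[of n]] by (auto simp: E_def)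
      then show "y \<in> shift n (E n)" using w(2) by blast
    qed
    then show ?thesis using sets_sub_image(2)[OF lam_nat_V E] by metis
  qed
  \<comment> \<open>All pairwise overlaps: countably many null sets, without which the translates
    are disjoint.\<close>
  define Z where "Z = (\<Union>m. \<Union>n\<in>- {m}. X m \<inter> X n)"
  have "X m \<inter> X n \<in> null_sets M" if "n \<in> - {m}" for m n
  proof (rule null_setsI)
    show "X m \<inter> X n \<in> sets M" using X by blast
    show "emeasure M (X m \<inter> X n) = 0"
      using null[of m n] that unfolding X_def B_def by auto
  qed
  then have Z: "Z \<in> null_sets M" unfolding Z_def by (intro null_sets_UN' null_sets_UN) auto
  have "W \<inter> (frac -` A \<inter> V) = (\<Union>n. E n)" unfolding E_def UN_B[symmetric] by blast
  then have "emeasure M (W \<inter> (frac -` A \<inter> V)) = emeasure M (\<Union>n. E n)" by simp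
  also have "\<dots> = (\<Sum>n. emeasure M (E n))"
  proof (rule suminf_emeasure[symmetric])
    show "disjoint_family E" using disj by (auto simp: disjoint_family_on_def E_def)
  qed (use E in auto)
  also have "\<dots> = (\<Sum>n. emeasure M (X n \<inter> A - Z))"
    using emeasure_Diff_null_set[OF Z] X A by (simp add: emeasure_E)
  also have "\<dots> = emeasure M (\<Union>n. X n \<inter> A - Z)"
  proof (rule suminf_emeasure)
    show "disjoint_family (\<lambda>n. X n \<inter> A - Z)"
      unfolding disjoint_family_on_def Z_def by blast
  qed (use X A Z in auto)
  also have "(\<Union>n. X n \<inter> A - Z) = (\<Union>n. X n) \<inter> A - Z" by blast
  also have "emeasure M ((\<Union>n. X n) \<inter> A - Z) = emeasure M ((\<Union>n. X n) \<inter> A)"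
    using X A by (intro emeasure_Diff_null_set[OF Z]) auto
  also have "(\<Union>n. X n) \<inter> A = (U \<inter> A) - (U - (\<Union>n. X n))" using sub UN_X by blast
  also have "emeasure M \<dots> = emeasure M (U \<inter> A)"
  proof (rule emeasure_Diff_null_set)
    show "U - (\<Union>n. X n) \<in> null_sets M"
    proof (rule null_setsI)
      show "U - (\<Union>n. X n) \<in> sets M" using X sets_U by auto
      show "emeasure M (U - (\<Union>n. X n)) = 0" using cover by (simp only: UN_X)
    qed
  qed (use sets_U A in blast)
  finally show "emeasure M (W \<inter> (frac -` A \<inter> V)) = emeasure M (U \<inter> A)" .
qed

text \<open>Cutting is done along the integer part. A common part \<open>B\<close> of two translates
  has disjoint preimages in two pieces, each with the measure of \<open>B\<close>, while the
  congruence allows this measure only once; finiteness forces it to be 0. The uncovered part of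
  \<open>U\<close> has an empty preimage, hence measure 0.\<close>

lemma cong_U_partition:
  assumes cong: "cong_U W" and W: "W \<in> sets M"
  defines "Y \<equiv> \<lambda>n. W \<inter> cyl (lam_nat n) 0"
  shows "Y n \<in> sets M" "disjoint_family Y" "(\<Union>n. Y n) = W"
    and "m \<noteq> n \<Longrightarrow> emeasure M (shift m (Y m) \<inter> shift n (Y n)) = 0"
    and "(\<Union>n. shift n (Y n)) \<subseteq> U"
    and "emeasure M (U - (\<Union>n. shift n (Y n))) = 0"
proof -
  have WV: "W \<subseteq> V" by (rule sets_subset_V[OF W])
  show Y: "Y n \<in> sets M" for n using W sets_cyl[OF lam_nat_V] by (auto simp: Y_def)
  show "disjoint_family Y"
    using disjoint_cyl_lam_nat unfolding disjoint_family_on_def Y_def by blast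
  show UN_Y: "(\<Union>n. Y n) = W" using WV V_eq_UN_cyl_lam_nat by (auto simp: Y_def)
  have frac_Y: "frac w = w \<ominus> lam_nat n" if "w \<in> Y n" for w n
    using that by (intro frac_eq_sub lam_nat_Lam) (simp add: Y_def)
  define X where "X n = shift n (Y n)" for n
  have X_eq: "X n = frac ` Y n" for n
    unfolding X_def by (intro image_cong refl) (simp add: frac_Y)
  have X: "X n \<in> sets M" for n unfolding X_def by (rule sets_sub_image[OF lam_nat_V Y])
  have XU: "X n \<subseteq> U" for n using WV frac_U by (auto simp: X_eq Y_def)
  then show "(\<Union>n. shift n (Y n)) \<subseteq> U" unfolding X_def by blast
  have "(U - (\<Union>n. X n)) \<in> sets M" using X sets_U by auto
  then have "emeasure M (W \<inter> (frac -` (U - (\<Union>n. X n)) \<inter> V)) = emeasure M (U \<inter> (U - (\<Union>n. X n)))"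
    using cong by (simp add: cong_U_def)
  moreover have "W \<inter> (frac -` (U - (\<Union>n. X n)) \<inter> V) = {}"
    unfolding UN_Y[symmetric] X_eq by blast
  moreover have "U \<inter> (U - (\<Union>n. X n)) = U - (\<Union>n. X n)" by blast
  ultimately have "emeasure M (U - (\<Union>n. X n)) = 0" by simp
  then show "emeasure M (U - (\<Union>n. shift n (Y n))) = 0" by (simp only: X_def)
  assume mn: "m \<noteq> n"
  define B where "B = X m \<inter> X n"
  have B: "B \<in> sets M" using X by (simp add: B_def)
  define E where "E k = Y k \<inter> (frac -` B \<inter> V)" for k
  have E: "E k \<in> sets M" for k using Y sets_vimage_frac[OF B] by (auto simp: E_def)
  have emeasure_E: "emeasure M (E k) = emeasure M B" if "k = m \<or> k = n" for k
  proof -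
    have "shift k (E k) = frac ` E k"
      by (intro image_cong refl frac_Y[symmetric]) (simp add: E_def)
    also have "\<dots> = B"
    proof (intro equalityI subsetI)
      fix y assume y: "y \<in> B"
      then have "y \<in> X k" using that by (auto simp: B_def)
      then obtain w where "w \<in> Y k" "y = frac w" by (auto simp: X_eq)
      then have "w \<in> E k" using y WV by (auto simp: E_def Y_def)
      with \<open>y = frac w\<close> show "y \<in> frac ` E k" by blast
    qed (auto simp: E_def)
    finally show ?thesis using sets_sub_image(2)[OF lam_nat_V E] by metis
  qed
  have "E m \<inter> E n = {}" using disjoint_cyl_lam_nat[OF mn] by (auto simp: E_def Y_def)
  then have "emeasure M (E m \<union> E n) = emeasure M B + emeasure M B"
    using plus_emeasure[OF E E, of m n] emeasure_E by simp
  moreover have "emeasure M (E m \<union> E n) \<le> emeasure M (W \<inter> (frac -` B \<inter> V))"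
    using W sets_vimage_frac[OF B] by (intro emeasure_mono) (auto simp: E_def Y_def)
  moreover have "emeasure M (W \<inter> (frac -` B \<inter> V)) = emeasure M B"
  proof -
    have "U \<inter> B = B" using XU by (auto simp: B_def)
    then show ?thesis using cong B by (simp add: cong_U_def)
  qed
  ultimately have le: "emeasure M B + emeasure M B \<le> emeasure M B" by simp
  have "emeasure M B \<le> emeasure M U" using XU sets_U by (intro emeasure_mono) (auto simp: B_def)
  then have "emeasure M B \<le> 1" by (simp add: emeasure_U)
  then obtain b where "0 \<le> b" "emeasure M B = ennreal b" by (cases "emeasure M B") (auto simp: top_unique)
  with le have "emeasure M B = 0" by (simp flip: ennreal_plus)
  then show "emeasure M (shift m (Y m) \<inter> shift n (Y n)) = 0"
    by (simp only: B_def X_def)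
qed

lemma cong_U_iff_partition:
  assumes W: "W \<in> sets M"
  shows "cong_U W \<longleftrightarrow> (\<exists>(N :: nat set) Y.
    (\<forall>n\<in>N. Y n \<in> sets M \<and> Y n \<noteq> {}) \<and> disjoint_family_on Y N \<and> (\<Union>n\<in>N. Y n) = W \<and>
    (\<forall>n1\<in>N. \<forall>n2\<in>N. n1 \<noteq> n2 \<longrightarrow>
       emeasure M (shift n1 (Y n1) \<inter> shift n2 (Y n2)) = 0) \<and>
    (\<Union>n\<in>N. shift n (Y n)) \<subseteq> U \<and>
    emeasure M (U - (\<Union>n\<in>N. shift n (Y n))) = 0)" (is "_ \<longleftrightarrow> (\<exists>N Y. ?P N Y)")
proof
  assume cong: "cong_U W"
  define Y where "Y n = W \<inter> cyl (lam_nat n) 0" for n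
  \<comment> \<open>Parts of a partition are nonempty, so indices with an empty part are dropped;
    the unions are unaffected.\<close>
  define N where "N = {n. Y n \<noteq> {}}"
  note Y = cong_U_partition[OF cong W, folded Y_def]
  have 1: "(\<Union>n\<in>N. Y n) = (\<Union>n. Y n)" by (auto simp: N_def)
  have 2: "(\<Union>n\<in>N. shift n (Y n)) = (\<Union>n. shift n (Y n))"
    by (auto simp: N_def)
  have "?P N Y"
    unfolding 1 2
  proof (intro conjI ballI impI)
    show "disjoint_family_on Y N" using Y(2) by (rule disjoint_family_on_mono[OF subset_UNIV])
    show "Y n \<noteq> {}" if "n \<in> N" for n using that by (simp add: N_def)
  qed (rule Y; assumption)+
  then show "\<exists>N Y. ?P N Y" by blast
next
  assume "\<exists>N Y. ?P N Y"
  then obtain N Y where "?P N Y" by blast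
  then show "cong_U W" by (intro cong_U_if_partition[of N Y]) auto
qed

text \<open>An indicator is square integrable exactly if its set has finite measure. All functions
  on the frequency side are then in L1 and L2, and the transform can be removed from the
  system.\<close>

lemma wavelet_set_iff:
  assumes sets: "\<And>u. u \<in> {1..p - 1} \<Longrightarrow> \<Omega> u \<in> sets M"
  shows "wavelet_set p M M \<Omega> \<longleftrightarrow> (\<forall>u\<in>{1..p - 1}. emeasure M (\<Omega> u) < \<infinity>) \<and>
    orthonormal_basis_L2 M ({1..p - 1} \<times> UNIV \<times> Lam p) (wav_family \<Omega>)"
proof -
  let ?I = "{1..p - 1} \<times> (UNIV :: int set) \<times> Lam p"
  have L2: "indicator (\<Omega> u) \<in> L2 M \<longleftrightarrow> emeasure M (\<Omega> u) < \<infinity>" if "u \<in> {1..p - 1}" for u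
    using sets[OF that] qdev_finite_iff(2)[of "indicator (\<Omega> u)" M] by (simp add: qdev_indicator)
  have "orthonormal_basis_L2 M ?I (\<lambda>(u, j, n). dilate_translate p (IF (indicator (\<Omega> u))) j n) \<longleftrightarrow>
      orthonormal_basis_L2 M ?I (wav_family \<Omega>)"
    if fin: "\<forall>u\<in>{1..p - 1}. emeasure M (\<Omega> u) < \<infinity>"
  proof -
    have "orthonormal_basis_L2 M ?I (\<lambda>(u, j, n). dilate_translate p (IF (indicator (\<Omega> u))) j n) \<longleftrightarrow>
        orthonormal_basis_L2 M ?I (\<lambda>i. IF (wav_family \<Omega> i))"
    proof (rule orthonormal_basis_L2_cong)
      fix i x assume i: "i \<in> ?I" and x: "x \<in> space M"
      obtain u j n where "i = (u, j, n)" by (cases i)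
      with i x show "(case i of (u, j, n) \<Rightarrow> dilate_translate p (IF (indicator (\<Omega> u))) j n) x = IF (wav_family \<Omega> i) x"
        using dilate_translate_eq_IF_wav[OF sets Lam_V] by (simp add: space_M)
    qed
    also have "\<dots> \<longleftrightarrow> orthonormal_basis_L2 M ?I (wav_family \<Omega>)"
    proof (rule orthonormal_basis_IF_iff)
      fix i assume i: "i \<in> ?I"
      obtain u j n where "i = (u, j, n)" by (cases i)
      with i show "integrable M (wav_family \<Omega> i)" "wav_family \<Omega> i \<in> L2 M"
        using wav_integrable[OF sets _ Lam_V] fin by simp_all
    qed
    finally show ?thesis .
  qed
  then show ?thesis unfolding wavelet_set_def using L2 sets by auto
qed

text \<open>Finiteness follows from (ii), which gives every set measure 1; in the other direction it
  makes the Fourier coefficients of the sets available.\<close>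

lemma wav_family_basis_iff:
  fixes P :: "nat set"
  assumes sets: "\<And>u. u \<in> P \<Longrightarrow> \<Omega> u \<in> sets M"
  shows "(\<forall>u\<in>P. emeasure M (\<Omega> u) < \<infinity>) \<and>
      orthonormal_basis_L2 M (P \<times> UNIV \<times> Lam p) (wav_family \<Omega>) \<longleftrightarrow>
    ((\<forall>u\<in>P. \<forall>v\<in>P. \<forall>j k. u \<noteq> v \<or> j \<noteq> k \<longrightarrow>
        emeasure M (sigma_pow j ` \<Omega> u \<inter> sigma_pow k ` \<Omega> v) = 0) \<and>
      emeasure M (V - (\<Union>k. \<Union>u\<in>P. sigma_pow k ` \<Omega> u)) = 0) \<and>
    (\<forall>u\<in>P. cong_U (\<Omega> u))" (is "?fin \<and> ?basis \<longleftrightarrow> (?disj \<and> ?cover) \<and> ?cong")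
proof -
  have dil: "sigma_pow k ` W = dil W (- k)" for k W by (simp add: dil_def)
  have UN: "(\<Union>k. \<Union>u\<in>P. sigma_pow k ` \<Omega> u) = (\<Union>j. \<Union>u\<in>P. dil (\<Omega> u) j)"
    unfolding dil
  proof (intro equalityI subsetI)
    fix x assume "x \<in> (\<Union>j. \<Union>u\<in>P. dil (\<Omega> u) j)"
    then obtain j u where "u \<in> P" "x \<in> dil (\<Omega> u) (- (- j))" by auto
    then show "x \<in> (\<Union>k. \<Union>u\<in>P. dil (\<Omega> u) (- k))" by blast
  qed blast
  show ?thesis
  proof
    assume *: "?fin \<and> ?basis"
    then have basis: ?basis and fin: "\<And>u. u \<in> P \<Longrightarrow> emeasure M (\<Omega> u) < \<infinity>" by auto
    have ?disj
      unfolding dil using wav_family_basis_disjoint[OF basis sets fin] by auto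
    moreover have ?cover
      unfolding UN using wav_family_basis_cover[OF basis sets] by simp
    moreover have ?cong
      using wav_family_basis_cong_U[OF basis _ sets fin] by blast
    ultimately show "(?disj \<and> ?cover) \<and> ?cong" by blast
  next
    assume *: "(?disj \<and> ?cover) \<and> ?cong"
    have ?fin using * cong_U_emeasure sets by force
    moreover have ?basis
    proof (rule wav_family_basis_if)
      show "emeasure M (V - (\<Union>j. \<Union>u\<in>P. dil (\<Omega> u) j)) = 0" using * unfolding UN by blast
      fix u v :: nat and j k :: int assume uv: "u \<in> P" "v \<in> P" "u \<noteq> v \<or> j \<noteq> k"
      then have "emeasure M (sigma_pow (- j) ` \<Omega> u \<inter> sigma_pow (- k) ` \<Omega> v) = 0" using * by auto
      then show "emeasure M (dil (\<Omega> u) j \<inter> dil (\<Omega> v) k) = 0" by (simp add: dil_def)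
    qed (use * sets in blast)+
    ultimately show "?fin \<and> ?basis" by blast
  qed
qed

end

theorem theorem3p2:
  fixes p :: nat
    and \<mu> \<mu>s :: "(int \<Rightarrow> nat) measure"
    and \<Omega> :: "nat \<Rightarrow> (int \<Rightarrow> nat) set"
  assumes "p \<ge> 2"
    and "normalized_haar p \<mu>"
    and "normalized_haar p \<mu>s"
    and "\<forall>u\<in>{1..p - 1}. \<Omega> u \<in> sets \<mu>s"
  shows "wavelet_set p \<mu> \<mu>s \<Omega> \<longleftrightarrow>
    ((\<forall>u1\<in>{1..p - 1}. \<forall>u2\<in>{1..p - 1}. \<forall>j k :: int. u1 \<noteq> u2 \<or> j \<noteq> k \<longrightarrow>
        emeasure \<mu>s (sigma_pow j ` \<Omega> u1 \<inter> sigma_pow k ` \<Omega> u2) = 0) \<and>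
     emeasure \<mu>s (vilenkin p - (\<Union>k :: int. \<Union>u\<in>{1..p - 1}. sigma_pow k ` \<Omega> u)) = 0) \<and>
    (\<forall>u\<in>{1..p - 1}. \<exists>(N :: nat set) (W :: nat \<Rightarrow> (int \<Rightarrow> nat) set).
        (\<forall>n\<in>N. W n \<in> sets \<mu>s \<and> W n \<noteq> {}) \<and> disjoint_family_on W N \<and> (\<Union>n\<in>N. W n) = \<Omega> u \<and>
        (\<forall>n1\<in>N. \<forall>n2\<in>N. n1 \<noteq> n2 \<longrightarrow>
           emeasure \<mu>s ((\<lambda>w. ominus p w (Lam_of_nat p n1)) ` W n1 \<inter>
                        (\<lambda>w. ominus p w (Lam_of_nat p n2)) ` W n2) = 0) \<and>
        (\<Union>n\<in>N. (\<lambda>w. ominus p w (Lam_of_nat p n)) ` W n) \<subseteq> vilenkin_U p \<and>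
        emeasure \<mu>s (vilenkin_U p - (\<Union>n\<in>N. (\<lambda>w. ominus p w (Lam_of_nat p n)) ` W n)) = 0)"
proof -
  interpret vilenkin_haar p \<mu>s
    by unfold_locales (use assms in auto)
  have "\<mu> = \<mu>s" by (rule haar_unique[OF assms(2)])
  have sets: "\<Omega> u \<in> sets \<mu>s" if "u \<in> {1..p - 1}" for u using assms(4) that by blast
  show ?thesis
    unfolding \<open>\<mu> = \<mu>s\<close>
    by (rule trans[OF trans[OF wavelet_set_iff wav_family_basis_iff]], erule sets, erule sets,
        intro conj_cong refl ball_cong cong_U_iff_partition sets)
qed

end
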